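(* For the fixed pair $(\mathfrak k_A,S)$, $$\{Z\in\mathfrak k_A:L_Z\neq\mathfrak g_2\}=\mathcal F_{\rm vec}\cup\mathcal F_{\rm proj}\cup\mathcal F_{\rm res}\cup\mathcal F_{\rm rf}.$$
   Context: Octonions: $\mathbb O$ has real basis $1,e_1,\dots,e_7$ with $1$ the identity, $e_i^2=-1$, and multiplication given by the oriented triples $(123),(145),(176),(246),(257),(347),(365)$: for a triple $(abc)$, $e_ae_b=e_c$, $e_be_c=e_a$, $e_ce_a=e_b$, and reversing the order changes the sign. $V=\operatorname{Im}\mathbb O=\operatorname{span}\{e_1,\dots,e_7\}$. $G_2=\operatorname{Aut}(\mathbb O)$, $\mathfrak g_2=\operatorname{Der}(\mathbb O)$ are identified with their faithful actions on $V$; kernels are taken in $V$. $\operatorname{Ad}_gZ=gZg^{-1}$. $D_{ij}=D_{e_i,e_j}\in\mathfrak g_2$ with $D_{a,b}(x)=[[a,b],x]-3[a,b,x]$, $[a,b]=ab-ba$, $[a,b,x]=(ab)x-a(bx)$. A quaternionic context is a unital subalgebra $H\subset\mathbb O$ isomorphic to the quaternions; $\mathfrak k_H=\{Z\in\mathfrak g_2:Z(H)\subseteq H\}$. $H_A=\operatorname{span}\{1,e_1,e_2,e_3\}$ and $\mathfrak k_A=\mathfrak k_{H_A}=\operatorname{span}\{D_{12},D_{13},D_{23},D_{45},D_{46},D_{47}\}$. $S\in G_2$ is the involution $S(e_1)=e_1$, $e_2\leftrightarrow e_4$, $e_3\leftrightarrow e_5$, $S(e_6)=-e_6$, $S(e_7)=-e_7$.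 $L_Z=\operatorname{Lie}\{Z,\operatorname{Ad}_SZ\}$ is the smallest real Lie subalgebra containing $Z$ and $\operatorname{Ad}_SZ$. The four families are: $\mathcal F_{\rm vec}=\{Z\in\mathfrak k_A:\ker Z\cap S(\ker Z)\neq\{0\}\}$. $\mathcal F_{\rm proj}=\bigcup_{[c:s]\in\mathbb RP^1}(\mathfrak k_A\cap\mathfrak k_{H_{[c:s]}})$, where $H_{[c:s]}$ is the quaternionic context $\mathbb R1\oplus\operatorname{span}\{ce_2+se_3,\ ce_4+se_5,\ (c^2-s^2)e_6+2cs\,e_7\}$. $\mathcal F_{\rm res}=\{\widehat Z_{a;c,s}:a,c,s\in\mathbb R,\ c^2+s^2>0\}\cup\{0\}$, where with $n=c^2+s^2$, $$\widehat Z_{a;c,s}=2c^2sD_{12}-c(c^2-s^2)D_{13}+an(D_{23}+D_{45})+(c^3-3cs^2)D_{46}+(3c^2s-s^3)D_{47}.$$ $\mathcal F_{\rm rf}=\{\lambda\operatorname{Ad}_{g_\theta}E_{\tau,\kappa}:\lambda\in\mathbb R\setminus\{0\},\ \theta\in\mathbb R,\ 0<\tau<1,\ \kappa\in\mathbb R,\ \kappa^2=(1-\tau)(\tau^2+3)/\tau\}$, where $g_\theta=\exp(\tfrac\theta2(D_{23}+D_{45}))$ and, with $D_\tau=\tau^2+3$ (a scalar), $$E_{\tau,\kappa}=(\tau-3)D_\tau D_{13}+(\tau^2-\tau+6)\kappa D_{23}+(2\tau^2+\tau+3)\kappa D_{45}-2\tau D_\tau D_{46}.$$ *)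

theory Defs
  imports "HOL-Analysis.Analysis"
begin

section \<open>Octonions\<close>

text \<open>
  An octonion is its coordinate vector with respect to the basis \<open>1, e1, ..., e7\<close>, indexed by the
  elements \<open>0, ..., 7\<close> of the type \<open>8\<close>.  The type class multiplication on \<open>real^8\<close> is the
  componentwise one; octonion multiplication is the separate operation \<open>\<odot>\<close>.
\<close>

type_synonym octonion = "real ^ 8"

definition oe :: "8 \<Rightarrow> octonion" where
  "oe i = axis i 1"

definition oriented_triples :: "(8 \<times> 8 \<times> 8) set" where
  "oriented_triples = {(1,2,3), (1,4,5), (1,7,6), (2,4,6), (2,5,7), (3,4,7), (3,6,5)}"

definition cyc_triple :: "8 \<Rightarrow> 8 \<Rightarrow> 8 \<Rightarrow> bool" where
  "cyc_triple i j k \<longleftrightarrow>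
     (i, j, k) \<in> oriented_triples \<or> (j, k, i) \<in> oriented_triples \<or> (k, i, j) \<in> oriented_triples"

text \<open>The coefficient of \<open>e\<^sub>k\<close> in \<open>e\<^sub>i e\<^sub>j\<close> for distinct \<open>i, j \<in> {1..7}\<close>; it vanishes as soon as
  two of the indices coincide or one of them is \<open>0\<close>.\<close>

definition oct_eps :: "8 \<Rightarrow> 8 \<Rightarrow> 8 \<Rightarrow> real" where
  "oct_eps i j k = (if cyc_triple i j k then 1 else if cyc_triple j i k then -1 else 0)"

definition omult :: "octonion \<Rightarrow> octonion \<Rightarrow> octonion" (infixl "\<odot>" 70) where
  "x \<odot> y = (\<chi> k. if k = 0 then x $ 0 * y $ 0 - (\<Sum>i\<in>UNIV - {0}. x $ i * y $ i)
                 else x $ 0 * y $ k + x $ k * y $ 0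
                      + (\<Sum>i\<in>UNIV. \<Sum>j\<in>UNIV. oct_eps i j k * x $ i * y $ j))"

lemma UNIV_8: "(UNIV :: 8 set) = {0, 1, 2, 3, 4, 5, 6, 7}"
proof -
  have "card {0, 1, 2, 3, 4, 5, 6, 7 :: 8} = CARD(8)"
    by simp
  then show ?thesis
    by (metis card_subset_eq finite subset_UNIV)
qed

lemma neq_8:
  "(0::8) \<noteq> 1" "(0::8) \<noteq> 2" "(0::8) \<noteq> 3" "(0::8) \<noteq> 4" "(0::8) \<noteq> 5" "(0::8) \<noteq> 6" "(0::8) \<noteq> 7"
  "(1::8) \<noteq> 0" "(1::8) \<noteq> 2" "(1::8) \<noteq> 3" "(1::8) \<noteq> 4" "(1::8) \<noteq> 5" "(1::8) \<noteq> 6" "(1::8) \<noteq> 7"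
  "(2::8) \<noteq> 0" "(2::8) \<noteq> 1" "(2::8) \<noteq> 3" "(2::8) \<noteq> 4" "(2::8) \<noteq> 5" "(2::8) \<noteq> 6" "(2::8) \<noteq> 7"
  "(3::8) \<noteq> 0" "(3::8) \<noteq> 1" "(3::8) \<noteq> 2" "(3::8) \<noteq> 4" "(3::8) \<noteq> 5" "(3::8) \<noteq> 6" "(3::8) \<noteq> 7"
  "(4::8) \<noteq> 0" "(4::8) \<noteq> 1" "(4::8) \<noteq> 2" "(4::8) \<noteq> 3" "(4::8) \<noteq> 5" "(4::8) \<noteq> 6" "(4::8) \<noteq> 7"
  "(5::8) \<noteq> 0" "(5::8) \<noteq> 1" "(5::8) \<noteq> 2" "(5::8) \<noteq> 3" "(5::8) \<noteq> 4" "(5::8) \<noteq> 6" "(5::8) \<noteq> 7"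
  "(6::8) \<noteq> 0" "(6::8) \<noteq> 1" "(6::8) \<noteq> 2" "(6::8) \<noteq> 3" "(6::8) \<noteq> 4" "(6::8) \<noteq> 5" "(6::8) \<noteq> 7"
  "(7::8) \<noteq> 0" "(7::8) \<noteq> 1" "(7::8) \<noteq> 2" "(7::8) \<noteq> 3" "(7::8) \<noteq> 4" "(7::8) \<noteq> 5" "(7::8) \<noteq> 6"
  by simp_all

lemma sum_8: "sum f UNIV = f 0 + f 1 + f 2 + f 3 + f 4 + f 5 + f 6 + f 7"
  for f :: "8 \<Rightarrow> 'a::comm_monoid_add"
  by (simp only: UNIV_8 sum.insert sum.empty finite.intros insert_iff empty_iff neq_8 simp_thms
        add.assoc add_0_right)

lemma all_8: "(\<forall>i::8. P i) \<longleftrightarrow> P 0 \<and> P 1 \<and> P 2 \<and> P 3 \<and> P 4 \<and> P 5 \<and> P 6 \<and> P 7"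
  using UNIV_8 by (metis (full_types) UNIV_I insertE singletonD)

lemma sum_8_nonzero: "sum f (UNIV - {0::8}) = f 1 + f 2 + f 3 + f 4 + f 5 + f 6 + f 7" for f :: "8 \<Rightarrow> real"
proof -
  have "sum f UNIV = f 0 + sum f (UNIV - {0::8})" by (rule sum.remove) auto
  then show ?thesis by (simp only: sum_8 add.assoc add_left_cancel)
qed

lemma omult_coords:
  fixes x y :: octonion shows
  "(x \<odot> y) $ 0 = x$0 * y$0 - x$1 * y$1 - x$2 * y$2 - x$3 * y$3 - x$4 * y$4 - x$5 * y$5 - x$6 * y$6 - x$7 * y$7"
  "(x \<odot> y) $ 1 = x$0 * y$1 + x$1 * y$0 + x$2 * y$3 - x$3 * y$2 + x$4 * y$5 - x$5 * y$4 - x$6 * y$7 + x$7 * y$6"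
  "(x \<odot> y) $ 2 = x$0 * y$2 + x$2 * y$0 - x$1 * y$3 + x$3 * y$1 + x$4 * y$6 - x$6 * y$4 + x$5 * y$7 - x$7 * y$5"
  "(x \<odot> y) $ 3 = x$0 * y$3 + x$3 * y$0 + x$1 * y$2 - x$2 * y$1 + x$4 * y$7 - x$7 * y$4 - x$5 * y$6 + x$6 * y$5"
  "(x \<odot> y) $ 4 = x$0 * y$4 + x$4 * y$0 - x$1 * y$5 + x$5 * y$1 - x$2 * y$6 + x$6 * y$2 - x$3 * y$7 + x$7 * y$3"
  "(x \<odot> y) $ 5 = x$0 * y$5 + x$5 * y$0 + x$1 * y$4 - x$4 * y$1 - x$2 * y$7 + x$7 * y$2 + x$3 * y$6 - x$6 * y$3"
  "(x \<odot> y) $ 6 = x$0 * y$6 + x$6 * y$0 + x$1 * y$7 - x$7 * y$1 + x$2 * y$4 - x$4 * y$2 - x$3 * y$5 + x$5 * y$3"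
  "(x \<odot> y) $ 7 = x$0 * y$7 + x$7 * y$0 - x$1 * y$6 + x$6 * y$1 + x$2 * y$5 - x$5 * y$2 + x$3 * y$4 - x$4 * y$3"
  by (simp_all only: omult_def vec_lambda_beta sum_8 sum_8_nonzero oct_eps_def cyc_triple_def
      oriented_triples_def insert_iff empty_iff prod.inject neq_8 simp_thms if_True if_False)

lemma omult_examples:
  "oe 1 \<odot> oe 7 = oe 6" "oe 3 \<odot> oe 6 = oe 5" "oe 5 \<odot> oe 2 = - oe 7"
  "oe 4 \<odot> oe 4 = - oe 0" "oe 0 \<odot> x = x" "x \<odot> oe 0 = x"
  by (simp_all add: vec_eq_iff all_8 omult_coords) (simp_all add: oe_def axis_def neq_8)

definition ImO :: "octonion set" where
  "ImO = span {oe 1, oe 2, oe 3, oe 4, oe 5, oe 6, oe 7}"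

definition ocomm :: "octonion \<Rightarrow> octonion \<Rightarrow> octonion" where
  "ocomm a b = a \<odot> b - b \<odot> a"

definition oassoc :: "octonion \<Rightarrow> octonion \<Rightarrow> octonion \<Rightarrow> octonion" where
  "oassoc a b x = (a \<odot> b) \<odot> x - a \<odot> (b \<odot> x)"

section \<open>Automorphisms, derivations, Lie subalgebras\<close>

text \<open>
  Linear endomorphisms of the octonions are matrices in the basis above, acting by \<open>*v\<close>.
  Automorphisms fix \<open>1\<close>, derivations kill it, and both preserve the imaginary part, so this is the
  same as working with their actions on \<open>ImO\<close>; only the kernel has to be cut down to \<open>ImO\<close>.
\<close>

definition G2 :: "(real^8^8) set" where
  "G2 = {g. invertible g \<and> (\<forall>x y. g *v (x \<odot> y) = (g *v x) \<odot> (g *v y))}"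

definition g2 :: "(real^8^8) set" where
  "g2 = {Z. \<forall>x y. Z *v (x \<odot> y) = (Z *v x) \<odot> y + x \<odot> (Z *v y)}"

definition kerV :: "real^8^8 \<Rightarrow> octonion set" where
  "kerV Z = {v \<in> ImO. Z *v v = 0}"

definition Ad :: "real^8^8 \<Rightarrow> real^8^8 \<Rightarrow> real^8^8" where
  "Ad g Z = g ** Z ** matrix_inv g"

definition mexp :: "real^8^8 \<Rightarrow> real^8^8" where
  "mexp A = (\<Sum>n. (1 / fact n) *\<^sub>R (((**) A ^^ n) (mat 1)))"

definition lie_bracket :: "real^8^8 \<Rightarrow> real^8^8 \<Rightarrow> real^8^8" where
  "lie_bracket X Y = X ** Y - Y ** X"

definition lie_subalgebra :: "(real^8^8) set \<Rightarrow> bool" where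
  "lie_subalgebra L \<longleftrightarrow> subspace L \<and> (\<forall>X\<in>L. \<forall>Y\<in>L. lie_bracket X Y \<in> L)"

definition inner_der :: "octonion \<Rightarrow> octonion \<Rightarrow> real^8^8" where
  "inner_der a b = matrix (\<lambda>x. ocomm (ocomm a b) x - 3 *\<^sub>R oassoc a b x)"

definition Dij :: "8 \<Rightarrow> 8 \<Rightarrow> real^8^8" where
  "Dij i j = inner_der (oe i) (oe j)"

section \<open>The fixed pair\<close>

text \<open>The formula makes sense for every set \<open>H\<close>; it is applied only to the quaternionic contexts
  \<open>HA\<close> and \<open>H_cs c s\<close> with \<open>(c, s) \<noteq> (0, 0)\<close>.\<close>

definition kH :: "octonion set \<Rightarrow> (real^8^8) set" where
  "kH H = {Z \<in> g2. (\<lambda>x. Z *v x) ` H \<subseteq> H}"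

definition HA :: "octonion set" where
  "HA = span {oe 0, oe 1, oe 2, oe 3}"

definition kA :: "(real^8^8) set" where
  "kA = kH HA"

text \<open>Coordinate form of \<open>e\<^sub>2 \<leftrightarrow> e\<^sub>4\<close>, \<open>e\<^sub>3 \<leftrightarrow> e\<^sub>5\<close>, \<open>e\<^sub>6 \<mapsto> - e\<^sub>6\<close>, \<open>e\<^sub>7 \<mapsto> - e\<^sub>7\<close>, with \<open>1\<close> and \<open>e\<^sub>1\<close> fixed.\<close>

definition S :: "real^8^8" where
  "S = matrix (\<lambda>x. x $ 0 *\<^sub>R oe 0 + x $ 1 *\<^sub>R oe 1 + x $ 2 *\<^sub>R oe 4 + x $ 4 *\<^sub>R oe 2
                 + x $ 3 *\<^sub>R oe 5 + x $ 5 *\<^sub>R oe 3 - x $ 6 *\<^sub>R oe 6 - x $ 7 *\<^sub>R oe 7)"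

lemma S_linear: "linear (\<lambda>x::octonion. x $ 0 *\<^sub>R oe 0 + x $ 1 *\<^sub>R oe 1 + x $ 2 *\<^sub>R oe 4 + x $ 4 *\<^sub>R oe 2
                 + x $ 3 *\<^sub>R oe 5 + x $ 5 *\<^sub>R oe 3 - x $ 6 *\<^sub>R oe 6 - x $ 7 *\<^sub>R oe 7)"
  by (rule linearI) (simp_all add: algebra_simps)

lemma S_coords:
  fixes x :: octonion
  shows "(S *v x) $ 0 = x $ 0" "(S *v x) $ 1 = x $ 1" "(S *v x) $ 2 = x $ 4" "(S *v x) $ 3 = x $ 5"
    "(S *v x) $ 4 = x $ 2" "(S *v x) $ 5 = x $ 3" "(S *v x) $ 6 = - x $ 6" "(S *v x) $ 7 = - x $ 7"
  unfolding S_def matrix_works[OF S_linear[THEN linear_matrix_vector_mul_eq[THEN iffD2]]]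
  by (simp_all add: oe_def axis_def neq_8)

lemma S_involution: "S *v (S *v x) = x"
  by (simp add: vec_eq_iff all_8 S_coords)

lemma S_omult: "S *v (x \<odot> y) = (S *v x) \<odot> (S *v y)"
  by (simp add: vec_eq_iff all_8 S_coords omult_coords)

lemma S_in_G2: "S \<in> G2"
proof -
  have "S ** S = mat 1" by (simp add: matrix_eq S_involution flip: matrix_vector_mul_assoc)
  then show ?thesis unfolding G2_def invertible_def using S_omult by blast
qed

definition LZ :: "real^8^8 \<Rightarrow> (real^8^8) set" where
  "LZ Z = lie_subalgebra hull {Z, Ad S Z}"

section \<open>The four families\<close>

definition F_vec :: "(real^8^8) set" where
  "F_vec = {Z \<in> kA. kerV Z \<inter> (\<lambda>v. S *v v) ` kerV Z \<noteq> {0}}"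

definition H_cs :: "real \<Rightarrow> real \<Rightarrow> octonion set" where
  "H_cs c s = span {oe 0, c *\<^sub>R oe 2 + s *\<^sub>R oe 3, c *\<^sub>R oe 4 + s *\<^sub>R oe 5,
                    (c\<^sup>2 - s\<^sup>2) *\<^sub>R oe 6 + (2 * c * s) *\<^sub>R oe 7}"

text \<open>A point \<open>[c : s]\<close> of the real projective line ranges over its representatives
  \<open>(c, s) \<noteq> (0, 0)\<close>; \<open>H_cs\<close> does not depend on the representative.\<close>

lemma H_cs_scale:
  assumes "r \<noteq> 0"
  shows "H_cs (r * c) (r * s) = H_cs c s"
proof -
  have sub: "H_cs (r * c) (r * s) \<subseteq> H_cs c s" for r c s
  proof -
    have 1: "(r * c) *\<^sub>R x + (r * s) *\<^sub>R y = r *\<^sub>R (c *\<^sub>R x + s *\<^sub>R y)" for x y :: octonion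
      by (simp add: scaleR_add_right)
    have 2: "((r * c)\<^sup>2 - (r * s)\<^sup>2) *\<^sub>R x + (2 * (r * c) * (r * s)) *\<^sub>R y
               = r\<^sup>2 *\<^sub>R ((c\<^sup>2 - s\<^sup>2) *\<^sub>R x + (2 * c * s) *\<^sub>R y)" for x y :: octonion
      by (simp add: scaleR_add_right algebra_simps power2_eq_square)
    show ?thesis
      unfolding H_cs_def 1 2
      by (rule span_minimal) (auto intro: span_scale span_base)
  qed
  have "H_cs c s = H_cs (inverse r * (r * c)) (inverse r * (r * s))"
    using assms by (simp flip: mult.assoc)
  with sub[of "inverse r" "r * c" "r * s"] sub[of r c s] show ?thesis by auto
qed

definition F_proj :: "(real^8^8) set" where
  "F_proj = (\<Union>(c, s) \<in> UNIV - {(0, 0)}. kA \<inter> kH (H_cs c s))"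

definition Z_hat :: "real \<Rightarrow> real \<Rightarrow> real \<Rightarrow> real^8^8" where
  "Z_hat a c s = (let n = c\<^sup>2 + s\<^sup>2 in
      (2 * c\<^sup>2 * s) *\<^sub>R Dij 1 2 - (c * (c\<^sup>2 - s\<^sup>2)) *\<^sub>R Dij 1 3
      + (a * n) *\<^sub>R (Dij 2 3 + Dij 4 5)
      + (c^3 - 3 * c * s\<^sup>2) *\<^sub>R Dij 4 6 + (3 * c\<^sup>2 * s - s^3) *\<^sub>R Dij 4 7)"

definition F_res :: "(real^8^8) set" where
  "F_res = {Z_hat a c s | a c s. c\<^sup>2 + s\<^sup>2 > 0} \<union> {0}"

definition g_theta :: "real \<Rightarrow> real^8^8" where
  "g_theta \<theta> = mexp ((\<theta> / 2) *\<^sub>R (Dij 2 3 + Dij 4 5))"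

definition E_tk :: "real \<Rightarrow> real \<Rightarrow> real^8^8" where
  "E_tk \<tau> \<kappa> = (let d = \<tau>\<^sup>2 + 3 in
      ((\<tau> - 3) * d) *\<^sub>R Dij 1 3 + ((\<tau>\<^sup>2 - \<tau> + 6) * \<kappa>) *\<^sub>R Dij 2 3
      + ((2 * \<tau>\<^sup>2 + \<tau> + 3) * \<kappa>) *\<^sub>R Dij 4 5 - (2 * \<tau> * d) *\<^sub>R Dij 4 6)"

definition F_rf :: "(real^8^8) set" where
  "F_rf = {l *\<^sub>R Ad (g_theta \<theta>) (E_tk \<tau> \<kappa>) | l \<theta> \<tau> \<kappa>.
             l \<noteq> 0 \<and> 0 < \<tau> \<and> \<tau> < 1 \<and> \<kappa>\<^sup>2 = (1 - \<tau>) * (\<tau>\<^sup>2 + 3) / \<tau>}"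

end

theory Submission
  imports Defs
begin

text \<open>The operator \<open>ad Z\<close> turns every root plane and has no real eigenvector
  there unless the root vanishes on \<open>Z\<close>, so components are separated with its square,
  whose eigenvalues are minus the squared root values. The obstacle is that these eigenvalues may
  coincide. This happens on twelve lines of the torus. Two automorphisms acting as Weyl group
  elements reduce these lines to three types: long walls, short walls and the lines of principal
  elements. Each type has its own argument. Two different kinds of conjugation occur. While
  \<open>L\<close> is an arbitrary subalgebra, all of \<open>G2\<close> is available. The four
  families, however, refer to the fixed \<open>S\<close>, so there only the rotations commuting with
  \<open>S\<close> are used, and these remove just one coordinate of \<open>Z\<close>. The vector
  \<open>k\<close> exists because \<open>Z\<close> acts as a skew map on the three-dimensional space
  \<open>Im H\<close>. Starting from a kernel vector makes \<open>Z u\<close> and \<open>Z v\<close>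
  opposite to each other, so that a single scalar \<open>m\<close> describes the action and the
  invariance of a context becomes a small polynomial system. One branch of that system is a rational
  curve, from which the odd-looking coefficients of \<open>E_tk\<close> arise.\<close>

text \<open>
  Put \<open>Y = Ad S Z\<close> and conjugate \<open>Z\<close> into a maximal torus of \<open>kA\<close>. Splitting \<open>Y\<close> into root components shows
  that the Lie algebra \<open>L\<close> generated by \<open>Z\<close> and \<open>Y\<close> contains a maximal torus of \<open>g2\<close>, unless
  \<open>[Z, [Z, Y]]\<close> is a combination of \<open>Z\<close> and \<open>Y\<close>. In the latter case solving this equation in coordinates
  puts \<open>Z\<close> into \<open>F_vec\<close> or \<open>F_proj\<close>. In the former case \<open>L\<close> is the torus plus root planes, so if it is
  proper it kills an imaginary vector, which means \<open>Z \<in> F_vec\<close>, or preserves a quaternionic context \<open>H\<close>.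
  Then \<open>S H\<close> is preserved as well, and \<open>H = S H\<close> unless \<open>L\<close> kills a vector. Choosing a nonzero \<open>k\<close> in
  the kernel of \<open>Z\<close> on \<open>Im H\<close>, the vectors \<open>u = k + S k\<close> and \<open>v = k - S k\<close> span \<open>Im H\<close> together with
  \<open>u \<odot> v\<close>, and \<open>Z\<close> acts by \<open>Z u = m (u \<odot> v)\<close>, \<open>Z v = - m (u \<odot> v)\<close>. After a rotation commuting with \<open>S\<close>
  these equations have exactly the solutions \<open>F_proj\<close>, \<open>F_res\<close> and \<open>F_rf\<close> outside \<open>F_vec\<close>; in the reverse
  direction they exhibit a context preserved by \<open>L\<close>.
\<close>

section \<open>Explicit coordinates for vectors and matrices of size eight\<close>

definition v8 :: "'a \<Rightarrow> 'a \<Rightarrow> 'a \<Rightarrow> 'a \<Rightarrow> 'a \<Rightarrow> 'a \<Rightarrow> 'a \<Rightarrow> 'a \<Rightarrow> 'a ^ 8" where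
  "v8 a0 a1 a2 a3 a4 a5 a6 a7 = (\<chi> i. if i = 0 then a0 else if i = 1 then a1 else if i = 2 then a2
     else if i = 3 then a3 else if i = 4 then a4 else if i = 5 then a5 else if i = 6 then a6 else a7)"

lemma v8_nth [simp]:
  "v8 a0 a1 a2 a3 a4 a5 a6 a7 $ 0 = a0" "v8 a0 a1 a2 a3 a4 a5 a6 a7 $ 1 = a1"
  "v8 a0 a1 a2 a3 a4 a5 a6 a7 $ 2 = a2" "v8 a0 a1 a2 a3 a4 a5 a6 a7 $ 3 = a3"
  "v8 a0 a1 a2 a3 a4 a5 a6 a7 $ 4 = a4" "v8 a0 a1 a2 a3 a4 a5 a6 a7 $ 5 = a5"
  "v8 a0 a1 a2 a3 a4 a5 a6 a7 $ 6 = a6" "v8 a0 a1 a2 a3 a4 a5 a6 a7 $ 7 = a7"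
  by (simp_all only: v8_def vec_lambda_beta neq_8 if_True if_False simp_thms)

lemma vec8_eq_iff:
  "x = y \<longleftrightarrow> x $ 0 = y $ 0 \<and> x $ 1 = y $ 1 \<and> x $ 2 = y $ 2 \<and> x $ 3 = y $ 3 \<and>
     x $ 4 = y $ 4 \<and> x $ 5 = y $ 5 \<and> x $ 6 = y $ 6 \<and> x $ 7 = y $ 7" for x y :: "'a ^ 8"
  by (simp add: vec_eq_iff all_8)

lemma v8_eta: "x = v8 (x $ 0) (x $ 1) (x $ 2) (x $ 3) (x $ 4) (x $ 5) (x $ 6) (x $ 7)"
  by (simp add: vec8_eq_iff)

lemma oe_v8:
  "oe 0 = v8 1 0 0 0 0 0 0 0" "oe 1 = v8 0 1 0 0 0 0 0 0" "oe 2 = v8 0 0 1 0 0 0 0 0"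
  "oe 3 = v8 0 0 0 1 0 0 0 0" "oe 4 = v8 0 0 0 0 1 0 0 0" "oe 5 = v8 0 0 0 0 0 1 0 0"
  "oe 6 = v8 0 0 0 0 0 0 1 0" "oe 7 = v8 0 0 0 0 0 0 0 1"
  by (simp_all add: vec8_eq_iff) (simp_all add: oe_def axis_def)

lemma mult_v8:
  "(M :: real^8^8) *v x = v8 (M $ 0 \<bullet> x) (M $ 1 \<bullet> x) (M $ 2 \<bullet> x) (M $ 3 \<bullet> x)
     (M $ 4 \<bullet> x) (M $ 5 \<bullet> x) (M $ 6 \<bullet> x) (M $ 7 \<bullet> x)"
  by (simp add: vec8_eq_iff matrix_vector_mul_component)

lemma inner_8: "x \<bullet> y = x $ 0 * y $ 0 + x $ 1 * y $ 1 + x $ 2 * y $ 2 + x $ 3 * y $ 3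
     + x $ 4 * y $ 4 + x $ 5 * y $ 5 + x $ 6 * y $ 6 + x $ 7 * y $ 7" for x y :: "real^8"
  by (simp add: inner_vec_def sum_8)

lemma matrix_mult_nth_8: "(A ** B) $ i $ j = A $ i $ 0 * B $ 0 $ j + A $ i $ 1 * B $ 1 $ j
     + A $ i $ 2 * B $ 2 $ j + A $ i $ 3 * B $ 3 $ j + A $ i $ 4 * B $ 4 $ j + A $ i $ 5 * B $ 5 $ j
     + A $ i $ 6 * B $ 6 $ j + A $ i $ 7 * B $ 7 $ j" for A B :: "real^8^8"
  by (simp add: matrix_matrix_mult_def sum_8)

section \<open>Coordinates on the derivation algebra\<close>

text \<open>\<open>ka x y\<close> runs through \<open>kA = su(2) + su(2)\<close>, where \<open>y\<close> acts trivially on \<open>HA\<close>; both brackets are twice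
  the cross product. \<open>pa\<close> parametrises the orthogonal complement of \<open>kA\<close> in \<open>g2\<close>. Its coordinate pairs
  \<open>(a4, a5)\<close>, \<open>(a6, a7)\<close>, \<open>(b4, b5)\<close>, \<open>(b6, b7)\<close>, as well as \<open>(x2, x3)\<close> and \<open>(y2, y3)\<close>, are the root planes of
  the maximal torus of all \<open>ka x 0 0 y 0 0\<close>.\<close>

definition ka :: "real \<Rightarrow> real \<Rightarrow> real \<Rightarrow> real \<Rightarrow> real \<Rightarrow> real \<Rightarrow> real^8^8" where
  "ka x1 x2 x3 y1 y2 y3 = v8
    (v8 0 0 0 0 0 0 0 0)
    (v8 0 0 (-2 * x3) (2 * x2) 0 0 0 0)
    (v8 0 (2 * x3) 0 (-2 * x1) 0 0 0 0)
    (v8 0 (-2 * x2) (2 * x1) 0 0 0 0 0)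
    (v8 0 0 0 0 0 (x1 - y1) (x2 - y2) (x3 - y3))
    (v8 0 0 0 0 (y1 - x1) 0 (-x3 - y3) (x2 + y2))
    (v8 0 0 0 0 (y2 - x2) (x3 + y3) 0 (-x1 - y1))
    (v8 0 0 0 0 (y3 - x3) (-x2 - y2) (x1 + y1) 0)"

definition pa :: "real \<Rightarrow> real \<Rightarrow> real \<Rightarrow> real \<Rightarrow> real \<Rightarrow> real \<Rightarrow> real \<Rightarrow> real \<Rightarrow> real^8^8" where
  "pa a4 a5 a6 a7 b4 b5 b6 b7 = v8
    (v8 0 0 0 0 0 0 0 0)
    (v8 0 0 0 0 (-2 * a4) (-2 * a5) (-2 * a6) (-2 * a7))
    (v8 0 0 0 0 (a7 - b4) (-a6 - b5) (a5 - b6) (-a4 - b7))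
    (v8 0 0 0 0 (b5 - a6) (-a7 - b4) (a4 - b7) (a5 + b6))
    (v8 0 (2 * a4) (b4 - a7) (a6 - b5) 0 0 0 0)
    (v8 0 (2 * a5) (a6 + b5) (a7 + b4) 0 0 0 0)
    (v8 0 (2 * a6) (b6 - a5) (b7 - a4) 0 0 0 0)
    (v8 0 (2 * a7) (a4 + b7) (-a5 - b6) 0 0 0 0)"

lemma ka_add: "ka x1 x2 x3 y1 y2 y3 + ka u1 u2 u3 v1 v2 v3 = ka (x1 + u1) (x2 + u2) (x3 + u3) (y1 + v1) (y2 + v2) (y3 + v3)"
  and ka_diff: "ka x1 x2 x3 y1 y2 y3 - ka u1 u2 u3 v1 v2 v3 = ka (x1 - u1) (x2 - u2) (x3 - u3) (y1 - v1) (y2 - v2) (y3 - v3)"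
  and ka_scale: "r *\<^sub>R ka x1 x2 x3 y1 y2 y3 = ka (r * x1) (r * x2) (r * x3) (r * y1) (r * y2) (r * y3)"
  and ka_0: "ka 0 0 0 0 0 0 = 0"
  by (simp_all add: vec8_eq_iff ka_def algebra_simps)

lemma pa_add: "pa a4 a5 a6 a7 b4 b5 b6 b7 + pa c4 c5 c6 c7 d4 d5 d6 d7
      = pa (a4 + c4) (a5 + c5) (a6 + c6) (a7 + c7) (b4 + d4) (b5 + d5) (b6 + d6) (b7 + d7)"
  and pa_scale: "r *\<^sub>R pa a4 a5 a6 a7 b4 b5 b6 b7
      = pa (r * a4) (r * a5) (r * a6) (r * a7) (r * b4) (r * b5) (r * b6) (r * b7)"
  and pa_0: "pa 0 0 0 0 0 0 0 0 = 0"
  by (simp_all add: vec8_eq_iff pa_def algebra_simps)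

lemma kp_eq_iff: "ka x1 x2 x3 y1 y2 y3 + pa a4 a5 a6 a7 b4 b5 b6 b7
      = ka u1 u2 u3 v1 v2 v3 + pa c4 c5 c6 c7 d4 d5 d6 d7
    \<longleftrightarrow> x1 = u1 \<and> x2 = u2 \<and> x3 = u3 \<and> y1 = v1 \<and> y2 = v2 \<and> y3 = v3 \<and>
       a4 = c4 \<and> a5 = c5 \<and> a6 = c6 \<and> a7 = c7 \<and> b4 = d4 \<and> b5 = d5 \<and> b6 = d6 \<and> b7 = d7"
  by (simp add: vec8_eq_iff ka_def pa_def) argo

lemma ka_eq_iff: "ka x1 x2 x3 y1 y2 y3 = ka u1 u2 u3 v1 v2 v3
    \<longleftrightarrow> x1 = u1 \<and> x2 = u2 \<and> x3 = u3 \<and> y1 = v1 \<and> y2 = v2 \<and> y3 = v3"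
  using kp_eq_iff[of x1 x2 x3 y1 y2 y3 0 0 0 0 0 0 0 0 u1 u2 u3 v1 v2 v3 0 0 0 0 0 0 0 0]
  by (simp add: pa_0)

lemma bracket_ka_ka: "lie_bracket (ka x1 x2 x3 y1 y2 y3) (ka u1 u2 u3 v1 v2 v3)
    = ka (2 * (x2 * u3 - x3 * u2)) (2 * (x3 * u1 - x1 * u3)) (2 * (x1 * u2 - x2 * u1))
         (2 * (y2 * v3 - y3 * v2)) (2 * (y3 * v1 - y1 * v3)) (2 * (y1 * v2 - y2 * v1))"
  by (simp add: vec8_eq_iff lie_bracket_def matrix_mult_nth_8 ka_def algebra_simps)

lemma bracket_ka_pa: "lie_bracket (ka x1 x2 x3 y1 y2 y3) (pa a4 a5 a6 a7 b4 b5 b6 b7)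
    = pa (a5 * x1 - a5 * y1 + 2 * a6 * x2 - a6 * y2 + 2 * a7 * x3 - a7 * y3 - b4 * x3 - b5 * x2)
         (-a4 * x1 + a4 * y1 - 2 * a6 * x3 - a6 * y3 + 2 * a7 * x2 + a7 * y2 + b4 * x2 - b5 * x3)
         (-2 * a4 * x2 + a4 * y2 + 2 * a5 * x3 + a5 * y3 - a7 * x1 - a7 * y1 - b6 * x3 + b7 * x2)
         (-2 * a4 * x3 + a4 * y3 - 2 * a5 * x2 - a5 * y2 + a6 * x1 + a6 * y1 - b6 * x2 - b7 * x3)
         (3 * a4 * x3 - 3 * a5 * x2 + 3 * b5 * x1 - b5 * y1 - b6 * y2 - b7 * y3)
         (3 * a4 * x2 + 3 * a5 * x3 - 3 * b4 * x1 + b4 * y1 - b6 * y3 + b7 * y2)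
         (3 * a6 * x3 + 3 * a7 * x2 + b4 * y2 + b5 * y3 - 3 * b7 * x1 - b7 * y1)
         (-3 * a6 * x2 + 3 * a7 * x3 + b4 * y3 - b5 * y2 + 3 * b6 * x1 + b6 * y1)"
  by (simp add: vec8_eq_iff lie_bracket_def matrix_mult_nth_8 ka_def pa_def algebra_simps)

lemma bracket_pa_pa: "lie_bracket (pa a4 a5 a6 a7 b4 b5 b6 b7) (pa c4 c5 c6 c7 d4 d5 d6 d7)
    = ka (-a4 * c5 + c4 * a5 + a6 * c7 - c6 * a7 - b4 * d5 + d4 * b5 + b6 * d7 - d6 * b7)
         (-2 * a4 * c6 + a4 * d5 + 2 * c4 * a6 - c4 * b5 - 2 * a5 * c7 - a5 * d4 + 2 * c5 * a7
            + c5 * b4 - a6 * d7 + c6 * b7 + a7 * d6 - c7 * b6)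
         (-2 * a4 * c7 + a4 * d4 + 2 * c4 * a7 - c4 * b4 + 2 * a5 * c6 + a5 * d5 - 2 * c5 * a6
            - c5 * b5 + a6 * d6 - c6 * b6 + a7 * d7 - c7 * b7)
         (3 * a4 * c5 - 3 * c4 * a5 + 3 * a6 * c7 - 3 * c6 * a7 + b4 * d5 - d4 * b5 + b6 * d7 - d6 * b7)
         (3 * a4 * c6 - 3 * c4 * a6 - 3 * a5 * c7 + 3 * c5 * a7 + b4 * d6 - d4 * b6 - b5 * d7 + d5 * b7)
         (3 * a4 * c7 - 3 * c4 * a7 + 3 * a5 * c6 - 3 * c5 * a6 + b4 * d7 - d4 * b7 + b5 * d6 - d5 * b6)"
  by (simp add: vec8_eq_iff lie_bracket_def matrix_mult_nth_8 ka_def pa_def algebra_simps)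

lemma lie_bracket_add_right: "lie_bracket A (B + C) = lie_bracket A B + lie_bracket A C"
  and lie_bracket_scale_right: "lie_bracket A (r *\<^sub>R B) = r *\<^sub>R lie_bracket A B"
  by (simp_all add: vec_eq_iff lie_bracket_def matrix_mult_nth_8 algebra_simps)

lemma ka_in_g2: "ka x1 x2 x3 y1 y2 y3 \<in> g2"
  by (simp add: g2_def vec8_eq_iff mult_v8 inner_8 omult_coords ka_def algebra_simps)

section \<open>Derivations are skew and are determined by fourteen coordinates\<close>

lemma oe_nth [simp]: "oe i $ j = (if i = j then 1 else 0)"
  by (auto simp: oe_def axis_def)

lemma mult_oe_nth: "(M *v oe j) $ i = M $ i $ j" for M :: "real^8^8"
  by (simp add: oe_def matrix_vector_mult_basis column_def)

lemma v8_expand: "x = x $ 0 *\<^sub>R oe 0 + x $ 1 *\<^sub>R oe 1 + x $ 2 *\<^sub>R oe 2 + x $ 3 *\<^sub>R oe 3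
    + x $ 4 *\<^sub>R oe 4 + x $ 5 *\<^sub>R oe 5 + x $ 6 *\<^sub>R oe 6 + x $ 7 *\<^sub>R oe 7"
  by (simp add: vec8_eq_iff)

lemma omult_0: "(x \<odot> y) $ 0 = 2 * x $ 0 * y $ 0 - x \<bullet> y"
  by (simp add: omult_coords inner_8)

lemma anticommutator: "i \<noteq> 0 \<Longrightarrow> (x \<odot> y + y \<odot> x) $ i = 2 * x $ 0 * y $ i + 2 * y $ 0 * x $ i"
proof -
  have "\<forall>i. i \<noteq> 0 \<longrightarrow> (x \<odot> y + y \<odot> x) $ i = 2 * x $ 0 * y $ i + 2 * y $ 0 * x $ i"
    unfolding all_8 by (simp add: omult_coords)
  then show "i \<noteq> 0 \<Longrightarrow> (x \<odot> y + y \<odot> x) $ i = 2 * x $ 0 * y $ i + 2 * y $ 0 * x $ i" by blast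
qed

lemma oe_square: "i \<noteq> 0 \<Longrightarrow> oe i \<odot> oe i = - oe 0"
proof -
  have "\<forall>i. i \<noteq> 0 \<longrightarrow> oe i \<odot> oe i = - oe 0"
    unfolding all_8 by (simp add: vec8_eq_iff omult_coords oe_v8)
  then show "i \<noteq> 0 \<Longrightarrow> oe i \<odot> oe i = - oe 0" by blast
qed

lemma oe_0_omult: "oe 0 \<odot> x = x" and omult_oe_0: "x \<odot> oe 0 = x"
  by (rule omult_examples)+

context
  fixes M assumes M: "M \<in> g2"
begin

lemma g2_omult: "M *v (x \<odot> y) = (M *v x) \<odot> y + x \<odot> (M *v y)"
  using M by (simp add: g2_def)

lemma g2_oe_0: "M *v oe 0 = 0"
  using g2_omult[of "oe 0" "oe 0"] by (simp add: oe_0_omult omult_oe_0)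

text \<open>Differentiating \<open>oe i \<odot> oe i = - oe 0\<close> makes the anticommutator of
  \<open>M *v oe i\<close> and \<open>oe i\<close> vanish; its coordinate \<open>i\<close> is twice
  the real part of \<open>M *v oe i\<close>.\<close>

lemma g2_nth_0: "(M *v x) $ 0 = 0"
proof -
  have "M $ 0 $ i = 0" for i
  proof (cases "i = 0")
    case True
    then show ?thesis using g2_oe_0 by (metis mult_oe_nth zero_index)
  next
    case False
    have "M *v (- oe 0) = 0"
      using g2_oe_0 by (simp add: vec.neg)
    then have "(M *v oe i) \<odot> oe i + oe i \<odot> (M *v oe i) = 0"
      using g2_omult[of "oe i" "oe i"] False by (simp add: oe_square)
    then show ?thesis
      using anticommutator[OF False, of "M *v oe i" "oe i"] False by (simp add: mult_oe_nth)
  qed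
  then show ?thesis by (simp add: matrix_vector_mul_component inner_8)
qed

text \<open>The real coordinate of a product is minus the inner product, up to a product of real
  parts. Hence this is the real coordinate of the Leibniz rule.\<close>

lemma g2_skew: "(M *v x) \<bullet> y = - (x \<bullet> (M *v y))"
  using arg_cong[OF g2_omult[of x y], of "\<lambda>v. v $ 0"] by (simp add: omult_0 g2_nth_0)

lemma g2_skew_nth: "M $ i $ j = - M $ j $ i"
  using g2_skew[of "oe i" "oe j"] by (simp add: oe_def matrix_vector_mult_basis column_def inner_axis inner_axis')

text \<open>The units \<open>oe 1\<close>, \<open>oe 2\<close>, \<open>oe 4\<close> generate the
  octonions, so the Leibniz rule expresses the remaining columns through these three. Together with
  skewness this leaves the 6 + 8 parameters of \<open>ka\<close> and \<open>pa\<close>.\<close>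

lemma g2_coords:
  obtains x1 x2 x3 y1 y2 y3 a4 a5 a6 a7 b4 b5 b6 b7
  where "M = ka x1 x2 x3 y1 y2 y3 + pa a4 a5 a6 a7 b4 b5 b6 b7"
proof -
  have p: "oe 1 \<odot> oe 2 = oe 3" "oe 1 \<odot> oe 4 = oe 5" "oe 2 \<odot> oe 4 = oe 6" "oe 2 \<odot> oe 5 = oe 7"
    by (simp_all add: vec8_eq_iff omult_coords)
  have d: "M $ i $ i = 0" for i
    using g2_skew_nth[of i i] by simp
  have z: "M $ i $ 0 = 0" "M $ 0 $ i = 0" for i
    using g2_oe_0 g2_skew_nth[of 0 i] by (simp_all flip: mult_oe_nth)
  note s = vec8_eq_iff omult_coords mult_oe_nth z d
  note sk = g2_skew_nth
  have c3: "M *v oe 3 = (M *v oe 1) \<odot> oe 2 + oe 1 \<odot> (M *v oe 2)"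
    and c5: "M *v oe 5 = (M *v oe 1) \<odot> oe 4 + oe 1 \<odot> (M *v oe 4)"
    and c6: "M *v oe 6 = (M *v oe 2) \<odot> oe 4 + oe 2 \<odot> (M *v oe 4)"
    and c7: "M *v oe 7 = (M *v oe 2) \<odot> oe 5 + oe 2 \<odot> (M *v oe 5)"
    by (simp_all flip: g2_omult add: p)
  have e3: "M $ 4 $ 3 = M $ 6 $ 1 - M $ 5 $ 2" "M $ 5 $ 3 = M $ 7 $ 1 + M $ 4 $ 2"
      "M $ 6 $ 3 = M $ 7 $ 2 - M $ 4 $ 1" "M $ 7 $ 3 = - M $ 5 $ 1 - M $ 6 $ 2"
    using c3 by (simp_all add: s)
  have e5: "M $ 6 $ 5 = M $ 2 $ 1 + M $ 7 $ 4" "M $ 7 $ 5 = M $ 3 $ 1 - M $ 6 $ 4"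
    using c5 by (simp_all add: s)
  have e6: "M $ 7 $ 6 = M $ 3 $ 2 + M $ 5 $ 4"
    using c6 by (simp_all add: s)
  let ?x1 = "M $ 3 $ 2 / 2" and ?x2 = "- M $ 3 $ 1 / 2" and ?x3 = "M $ 2 $ 1 / 2"
  let ?a4 = "M $ 4 $ 1 / 2" and ?a5 = "M $ 5 $ 1 / 2" and ?a6 = "M $ 6 $ 1 / 2" and ?a7 = "M $ 7 $ 1 / 2"
  have "M = ka ?x1 ?x2 ?x3 (M $ 5 $ 4 + ?x1) (M $ 6 $ 4 + ?x2) (M $ 7 $ 4 + ?x3)
    + pa ?a4 ?a5 ?a6 ?a7 (M $ 4 $ 2 + ?a7) (M $ 5 $ 2 - ?a6) (M $ 6 $ 2 + ?a5) (M $ 7 $ 2 - ?a4)" (is "_ = ?R")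
    unfolding vec8_eq_iff ka_def pa_def
    using e3 e5 e6 sk[of 1 2] sk[of 1 3] sk[of 1 4] sk[of 1 5] sk[of 1 6] sk[of 1 7] sk[of 2 3] sk[of 2 4] sk[of 2 5] sk[of 2 6] sk[of 2 7] sk[of 3 4] sk[of 3 5] sk[of 3 6] sk[of 3 7] sk[of 4 5] sk[of 4 6] sk[of 4 7] sk[of 5 6] sk[of 5 7] sk[of 6 7]
    by (simp add: z d field_simps)
  then show thesis by (rule that)
qed

end

lemma ImO_eq: "ImO = {x. x $ 0 = 0}"
proof
  show "ImO \<subseteq> {x. x $ 0 = 0}"
    unfolding ImO_def by (rule span_minimal) (auto simp: subspace_def)
  show "{x. x $ 0 = 0} \<subseteq> ImO"
  proof
    fix x :: octonion assume "x \<in> {x. x $ 0 = 0}"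
    then have "x = x $ 1 *\<^sub>R oe 1 + x $ 2 *\<^sub>R oe 2 + x $ 3 *\<^sub>R oe 3
      + x $ 4 *\<^sub>R oe 4 + x $ 5 *\<^sub>R oe 5 + x $ 6 *\<^sub>R oe 6 + x $ 7 *\<^sub>R oe 7"
      by (simp add: vec8_eq_iff)
    also have "\<dots> \<in> ImO"
      unfolding ImO_def by (intro span_add span_scale span_base) auto
    finally show "x \<in> ImO" .
  qed
qed

lemma HA_eq: "HA = {x. x $ 4 = 0 \<and> x $ 5 = 0 \<and> x $ 6 = 0 \<and> x $ 7 = 0}"
proof
  show "HA \<subseteq> {x. x $ 4 = 0 \<and> x $ 5 = 0 \<and> x $ 6 = 0 \<and> x $ 7 = 0}"
    unfolding HA_def by (rule span_minimal) (auto simp: subspace_def)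
  show "{x. x $ 4 = 0 \<and> x $ 5 = 0 \<and> x $ 6 = 0 \<and> x $ 7 = 0} \<subseteq> HA"
  proof
    fix x :: octonion assume "x \<in> {x. x $ 4 = 0 \<and> x $ 5 = 0 \<and> x $ 6 = 0 \<and> x $ 7 = 0}"
    then have "x = x $ 0 *\<^sub>R oe 0 + x $ 1 *\<^sub>R oe 1 + x $ 2 *\<^sub>R oe 2 + x $ 3 *\<^sub>R oe 3"
      by (simp add: vec8_eq_iff)
    also have "\<dots> \<in> HA"
      unfolding HA_def by (intro span_add span_scale span_base) auto
    finally show "x \<in> HA" .
  qed
qed

lemma kA_iff: "Z \<in> kA \<longleftrightarrow> (\<exists>x1 x2 x3 y1 y2 y3. Z = ka x1 x2 x3 y1 y2 y3)"
proof
  assume Z: "Z \<in> kA"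
  then have "Z \<in> g2" by (simp add: kA_def kH_def)
  then obtain x1 x2 x3 y1 y2 y3 a4 a5 a6 a7 b4 b5 b6 b7
    where eq: "Z = ka x1 x2 x3 y1 y2 y3 + pa a4 a5 a6 a7 b4 b5 b6 b7" by (rule g2_coords)
  have "Z *v oe 1 \<in> HA" "Z *v oe 2 \<in> HA"
    using Z by (auto simp: kA_def kH_def HA_def intro: span_base)
  then have "a4 = 0" "a5 = 0" "a6 = 0" "a7 = 0" "b4 = 0" "b5 = 0" "b6 = 0" "b7 = 0"
    unfolding HA_eq eq by (auto simp: mult_oe_nth ka_def pa_def)
  then show "\<exists>x1 x2 x3 y1 y2 y3. Z = ka x1 x2 x3 y1 y2 y3"
    using eq by (simp add: pa_0) blast
next
  assume "\<exists>x1 x2 x3 y1 y2 y3. Z = ka x1 x2 x3 y1 y2 y3"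
  then show "Z \<in> kA"
    by (auto simp: kA_def kH_def ka_in_g2 HA_eq) (simp_all add: mult_v8 inner_8 ka_def)
qed

lemma ka_in_kA [simp]: "ka x1 x2 x3 y1 y2 y3 \<in> kA"
  unfolding kA_iff by blast

lemma lie_bracket_vec: "lie_bracket X Y *v v = X *v (Y *v v) - Y *v (X *v v)"
  by (simp add: lie_bracket_def matrix_vector_mult_diff_rdistrib matrix_vector_mul_assoc)

lemma omult_add_left: "(x + y) \<odot> z = x \<odot> z + y \<odot> z"
  and omult_add_right: "x \<odot> (y + z) = x \<odot> y + x \<odot> z"
  and omult_diff_left: "(x - y) \<odot> z = x \<odot> z - y \<odot> z"
  and omult_diff_right: "x \<odot> (y - z) = x \<odot> y - x \<odot> z"
  and omult_scale_left: "(r *\<^sub>R x) \<odot> y = r *\<^sub>R (x \<odot> y)"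
  and omult_scale_right: "x \<odot> (r *\<^sub>R y) = r *\<^sub>R (x \<odot> y)"
  by (simp_all add: vec8_eq_iff omult_coords algebra_simps)

lemma omult_zero_left: "0 \<odot> x = 0" and omult_zero_right: "x \<odot> 0 = 0"
  by (simp_all add: vec8_eq_iff omult_coords)

lemma subspace_g2: "subspace g2"
  by (auto simp: subspace_def g2_def matrix_vector_mult_add_rdistrib scaleR_matrix_vector_assoc[symmetric]
      omult_add_left omult_add_right omult_scale_left omult_scale_right scaleR_add_right
      omult_zero_left omult_zero_right)

lemma lie_subalgebra_g2: "lie_subalgebra g2"
proof -
  have "lie_bracket X Y \<in> g2" if X: "X \<in> g2" and Y: "Y \<in> g2" for X Y
    using that unfolding g2_def
    by (simp add: lie_bracket_vec matrix_vector_right_distrib omult_add_left omult_add_right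
        omult_diff_left omult_diff_right)
  then show ?thesis by (auto simp: lie_subalgebra_def subspace_g2)
qed

section \<open>The adjoint action\<close>

lemma G2_invertible: "g \<in> G2 \<Longrightarrow> invertible g"
  and G2_omult: "g \<in> G2 \<Longrightarrow> g *v (x \<odot> y) = (g *v x) \<odot> (g *v y)"
  by (simp_all add: G2_def)

lemma
  assumes "g \<in> G2"
  shows G2_inv_left: "matrix_inv g ** g = mat 1" and G2_inv_right: "g ** matrix_inv g = mat 1"
proof -
  have "\<exists>h. g ** h = mat 1 \<and> h ** g = mat 1"
    using G2_invertible[OF assms] by (simp add: invertible_def)
  then have "g ** matrix_inv g = mat 1 \<and> matrix_inv g ** g = mat 1"
    unfolding matrix_inv_def by (rule someI_ex)
  then show "matrix_inv g ** g = mat 1" "g ** matrix_inv g = mat 1" by simp_all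
qed

lemma G2_inv_left_vec: "g \<in> G2 \<Longrightarrow> matrix_inv g *v (g *v x) = x"
  and G2_inv_right_vec: "g \<in> G2 \<Longrightarrow> g *v (matrix_inv g *v x) = x"
  by (simp_all add: matrix_vector_mul_assoc G2_inv_left G2_inv_right)

lemma G2_mult: "g \<in> G2 \<Longrightarrow> h \<in> G2 \<Longrightarrow> g ** h \<in> G2"
  by (simp add: G2_def invertible_mult flip: matrix_vector_mul_assoc)

lemma G2_inv: "g \<in> G2 \<Longrightarrow> matrix_inv g \<in> G2"
  unfolding G2_def
proof (intro CollectI conjI allI)
  assume "g \<in> {g. invertible g \<and> (\<forall>x y. g *v (x \<odot> y) = (g *v x) \<odot> (g *v y))}"
  then have g: "g \<in> G2" by (simp add: G2_def)
  show "invertible (matrix_inv g)"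
    using G2_inv_left[OF g] G2_inv_right[OF g] by (auto simp: invertible_def)
  fix x y
  have "matrix_inv g *v (x \<odot> y) = matrix_inv g *v (g *v ((matrix_inv g *v x) \<odot> (matrix_inv g *v y)))"
    by (simp add: G2_omult[OF g] G2_inv_right_vec[OF g])
  then show "matrix_inv g *v (x \<odot> y) = (matrix_inv g *v x) \<odot> (matrix_inv g *v y)"
    by (simp add: G2_inv_left_vec[OF g])
qed

lemma matrix_inv_eqI:
  fixes g h :: "real^8^8"
  assumes "g ** h = mat 1" "h ** g = mat 1"
  shows "matrix_inv g = h"
  unfolding matrix_inv_def
proof (rule some_equality)
  fix k assume "g ** k = mat 1 \<and> k ** g = mat 1"
  then show "k = h" by (metis assms matrix_mul_assoc matrix_mul_lid matrix_mul_rid)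
qed (use assms in simp)

lemma matrix_inv_inv: "g \<in> G2 \<Longrightarrow> matrix_inv (matrix_inv g) = g"
  by (rule matrix_inv_eqI) (simp_all add: G2_inv_left G2_inv_right)

lemma Ad_vec: "g \<in> G2 \<Longrightarrow> Ad g Z *v (g *v x) = g *v (Z *v x)"
  by (simp add: Ad_def G2_inv_left_vec flip: matrix_vector_mul_assoc)

lemma Ad_mult:
  assumes "g \<in> G2" "h \<in> G2"
  shows "Ad (g ** h) Z = Ad g (Ad h Z)"
proof -
  have "matrix_inv (g ** h) = matrix_inv h ** matrix_inv g"
    by (rule matrix_inv_eqI)
      (simp_all add: matrix_eq G2_inv_left_vec G2_inv_right_vec assms flip: matrix_vector_mul_assoc)
  then show ?thesis by (simp add: Ad_def matrix_mul_assoc)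
qed

lemma Ad_inv_left: "g \<in> G2 \<Longrightarrow> Ad (matrix_inv g) (Ad g Z) = Z"
  and Ad_inv_right: "g \<in> G2 \<Longrightarrow> Ad g (Ad (matrix_inv g) Z) = Z"
proof -
  have 1: "Ad (mat 1) Z = Z"
    by (simp add: Ad_def matrix_inv_eqI[of "mat 1" "mat 1"])
  assume g: "g \<in> G2"
  show "Ad (matrix_inv g) (Ad g Z) = Z" "Ad g (Ad (matrix_inv g) Z) = Z"
    by (simp_all add: Ad_mult[symmetric] G2_inv g G2_inv_left G2_inv_right 1)
qed

lemma Ad_apply: "Ad g Z *v x = g *v (Z *v (matrix_inv g *v x))"
  by (simp add: Ad_def flip: matrix_vector_mul_assoc)

lemma Ad_add: "Ad g (X + Y) = Ad g X + Ad g Y"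
  and Ad_scale: "Ad g (r *\<^sub>R X) = r *\<^sub>R Ad g X"
  by (simp_all add: matrix_eq Ad_apply matrix_vector_mult_add_rdistrib matrix_vector_right_distrib
      matrix_vector_mult_scaleR flip: scaleR_matrix_vector_assoc)

lemma Ad_diff: "Ad g (X - Y) = Ad g X - Ad g Y"
  by (metis Ad_add diff_add_cancel add_diff_cancel_right')

lemma Ad_bracket: "g \<in> G2 \<Longrightarrow> Ad g (lie_bracket X Y) = lie_bracket (Ad g X) (Ad g Y)"
  by (simp add: matrix_eq Ad_apply lie_bracket_vec G2_inv_left_vec matrix_vector_mult_diff_distrib)

lemma Ad_g2: "g \<in> G2 \<Longrightarrow> Z \<in> g2 \<Longrightarrow> Ad g Z \<in> g2"
proof -
  assume g: "g \<in> G2" and Z: "Z \<in> g2"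
  have "Ad g Z *v (x \<odot> y) = (Ad g Z *v x) \<odot> y + x \<odot> (Ad g Z *v y)" for x y
    using Z by (simp add: Ad_def g2_def G2_omult G2_inv g G2_inv_right_vec matrix_vector_right_distrib
        flip: matrix_vector_mul_assoc)
  then show ?thesis by (simp add: g2_def)
qed

lemma lie_subalgebra_Ad:
  assumes "g \<in> G2" "lie_subalgebra L"
  shows "lie_subalgebra (Ad g ` L)"
proof -
  have "linear (Ad g)"
    by (rule linearI) (simp_all add: Ad_add Ad_scale)
  then have "subspace (Ad g ` L)"
    using assms by (simp add: linear_subspace_image lie_subalgebra_def)
  then show ?thesis
    using assms by (fastforce simp: lie_subalgebra_def simp flip: Ad_bracket)
qed

lemma Ad_g2_image: "g \<in> G2 \<Longrightarrow> Ad g ` g2 = g2"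
  by (auto simp: Ad_g2) (metis Ad_g2 Ad_inv_right G2_inv image_eqI)

lemma lie_subalgebra_hull: "lie_subalgebra (lie_subalgebra hull A)"
  by (rule hull_in) (auto simp: lie_subalgebra_def subspace_def)

text \<open>Minimality of the hull gives one inclusion for every automorphism; the same inclusion
  for the inverse gives the other.\<close>

lemma hull_Ad: "g \<in> G2 \<Longrightarrow> lie_subalgebra hull (Ad g ` A) = Ad g ` (lie_subalgebra hull A)"
proof -
  have sub: "lie_subalgebra hull (Ad g ` A) \<subseteq> Ad g ` (lie_subalgebra hull A)" if "g \<in> G2" for g A
    by (rule hull_minimal) (use that in \<open>auto simp: hull_inc lie_subalgebra_Ad lie_subalgebra_hull\<close>)
  assume g: "g \<in> G2"
  have "A = Ad (matrix_inv g) ` Ad g ` A"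
    using g by (force simp: Ad_inv_left image_iff)
  then have "lie_subalgebra hull A \<subseteq> Ad (matrix_inv g) ` (lie_subalgebra hull (Ad g ` A))"
    using sub[OF G2_inv[OF g], of "Ad g ` A"] by simp
  then have "Ad g ` (lie_subalgebra hull A) \<subseteq> lie_subalgebra hull (Ad g ` A)"
    using g by (force simp: Ad_inv_right)
  then show ?thesis using sub[OF g] by blast
qed

lemma S_S: "S ** S = mat 1"
  by (simp add: matrix_eq S_involution flip: matrix_vector_mul_assoc)

lemma matrix_inv_S: "matrix_inv S = S"
  by (rule matrix_inv_eqI) (rule S_S)+

lemma Ad_S_vec: "Ad S Z *v x = S *v (Z *v (S *v x))"
  by (simp add: Ad_def matrix_inv_S flip: matrix_vector_mul_assoc)

lemma LZ_subalgebra: "lie_subalgebra (LZ Z)"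
  by (simp add: LZ_def lie_subalgebra_hull)

lemma LZ_in: "Z \<in> LZ Z" "Ad S Z \<in> LZ Z"
  by (simp_all add: LZ_def hull_inc)

lemma LZ_least: "lie_subalgebra L \<Longrightarrow> Z \<in> L \<Longrightarrow> Ad S Z \<in> L \<Longrightarrow> LZ Z \<subseteq> L"
  unfolding LZ_def by (rule hull_minimal) auto

lemma LZ_subset_g2: "Z \<in> g2 \<Longrightarrow> LZ Z \<subseteq> g2"
  by (simp add: LZ_least lie_subalgebra_g2 Ad_g2 S_in_G2)

text \<open>An automorphism commuting with \<open>S\<close> conjugates both generators at once. This
  is why only such automorphisms serve to normalise \<open>Z\<close>.\<close>

lemma LZ_Ad: "g \<in> G2 \<Longrightarrow> g ** S = S ** g \<Longrightarrow> LZ (Ad g Z) = Ad g ` LZ Z"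
  by (simp add: LZ_def Ad_mult[symmetric] S_in_G2 flip: hull_Ad)
   

section \<open>Explicit automorphisms\<close>

text \<open>Both sides of the multiplicativity condition are bilinear, so pairs of basis vectors
  suffice.\<close>

lemma G2_I:
  assumes "\<And>i j. g *v (oe i \<odot> oe j) = (g *v oe i) \<odot> (g *v oe j)"
    and "g ** h = mat 1" "h ** g = mat 1"
  shows "g \<in> G2"
proof -
  have lin: "linear (\<lambda>x. g *v (x \<odot> y))" "linear (\<lambda>x. (g *v x) \<odot> (g *v y))"
    "linear (\<lambda>x. g *v (y \<odot> x))" "linear (\<lambda>x. (g *v y) \<odot> (g *v x))" for y
    by (auto intro!: linearI simp: omult_add_left omult_add_right omult_scale_left omult_scale_right
        matrix_vector_right_distrib matrix_vector_mult_scaleR)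
  have B: "span (range oe) = UNIV"
  proof -
    have "x \<in> span (range oe)" for x
      by (subst v8_expand) (intro span_add span_scale span_base; simp)
    then show ?thesis by blast
  qed
  have 1: "g *v (x \<odot> oe j) = (g *v x) \<odot> (g *v oe j)" for x j
    using linear_eq_on[OF lin(1,2), of x "range oe"] assms(1) B by auto
  have "g *v (x \<odot> y) = (g *v x) \<odot> (g *v y)" for x y
    using linear_eq_on[OF lin(3,4), of y "range oe" x] 1 B by auto
  then show ?thesis
    using assms by (auto simp: G2_def invertible_def)
qed

lemma Ad_eqI: "g \<in> G2 \<Longrightarrow> g ** Z = W ** g \<Longrightarrow> Ad g Z = W"
  by (simp add: Ad_def G2_inv_right flip: matrix_mul_assoc)

text \<open>\<open>T1\<close>, \<open>T3\<close> rotate the \<open>x\<close>-part of \<open>kA\<close> and \<open>U1\<close>, \<open>U3\<close> the \<open>y\<close>-part, through twice the angle of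
  \<open>(c, s)\<close>; \<open>Rot\<close> is \<open>g_theta\<close> in algebraic form, and \<open>cyc\<close> permutes the planes \<open>(e\<^sub>2, e\<^sub>3)\<close>, \<open>(e\<^sub>4, e\<^sub>5)\<close>,
  \<open>(e\<^sub>6, e\<^sub>7)\<close> cyclically, up to sign.\<close>

definition T1 :: "real \<Rightarrow> real \<Rightarrow> real^8^8" where
  "T1 c s = v8 (v8 1 0 0 0 0 0 0 0) (v8 0 1 0 0 0 0 0 0)
    (v8 0 0 (c * c - s * s) (- 2 * c * s) 0 0 0 0) (v8 0 0 (2 * c * s) (c * c - s * s) 0 0 0 0)
    (v8 0 0 0 0 c s 0 0) (v8 0 0 0 0 (-s) c 0 0) (v8 0 0 0 0 0 0 c (-s)) (v8 0 0 0 0 0 0 s c)"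

definition T3 :: "real \<Rightarrow> real \<Rightarrow> real^8^8" where
  "T3 c s = v8 (v8 1 0 0 0 0 0 0 0) (v8 0 (c * c - s * s) (- 2 * c * s) 0 0 0 0 0)
    (v8 0 (2 * c * s) (c * c - s * s) 0 0 0 0 0) (v8 0 0 0 1 0 0 0 0)
    (v8 0 0 0 0 c 0 0 s) (v8 0 0 0 0 0 c (-s) 0) (v8 0 0 0 0 0 s c 0) (v8 0 0 0 0 (-s) 0 0 c)"

definition U1 :: "real \<Rightarrow> real \<Rightarrow> real^8^8" where
  "U1 c s = v8 (v8 1 0 0 0 0 0 0 0) (v8 0 1 0 0 0 0 0 0) (v8 0 0 1 0 0 0 0 0) (v8 0 0 0 1 0 0 0 0)
    (v8 0 0 0 0 c (-s) 0 0) (v8 0 0 0 0 s c 0 0) (v8 0 0 0 0 0 0 c (-s)) (v8 0 0 0 0 0 0 s c)"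

definition U3 :: "real \<Rightarrow> real \<Rightarrow> real^8^8" where
  "U3 c s = v8 (v8 1 0 0 0 0 0 0 0) (v8 0 1 0 0 0 0 0 0) (v8 0 0 1 0 0 0 0 0) (v8 0 0 0 1 0 0 0 0)
    (v8 0 0 0 0 c 0 0 (-s)) (v8 0 0 0 0 0 c (-s) 0) (v8 0 0 0 0 0 s c 0) (v8 0 0 0 0 s 0 0 c)"

definition Rot :: "real \<Rightarrow> real \<Rightarrow> real^8^8" where
  "Rot c s = v8 (v8 1 0 0 0 0 0 0 0) (v8 0 1 0 0 0 0 0 0)
    (v8 0 0 c (-s) 0 0 0 0) (v8 0 0 s c 0 0 0 0)
    (v8 0 0 0 0 c (-s) 0 0) (v8 0 0 0 0 s c 0 0)
    (v8 0 0 0 0 0 0 (c * c - s * s) (- 2 * c * s)) (v8 0 0 0 0 0 0 (2 * c * s) (c * c - s * s))"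

definition cyc :: "real^8^8" where
  "cyc = v8 (v8 1 0 0 0 0 0 0 0) (v8 0 1 0 0 0 0 0 0) (v8 0 0 0 0 0 0 1 0) (v8 0 0 0 0 0 0 0 (-1))
    (v8 0 0 1 0 0 0 0 0) (v8 0 0 0 1 0 0 0 0) (v8 0 0 0 0 1 0 0 0) (v8 0 0 0 0 0 (-1) 0 0)"

lemma mat_1_nth [simp]: "(mat 1 :: real^8^8) $ i $ j = (if i = j then 1 else 0)"
  by (simp add: mat_def)

lemma omult_v8: "v8 x0 x1 x2 x3 x4 x5 x6 x7 \<odot> v8 y0 y1 y2 y3 y4 y5 y6 y7 = v8
    (x0 * y0 - x1 * y1 - x2 * y2 - x3 * y3 - x4 * y4 - x5 * y5 - x6 * y6 - x7 * y7)
    (x0 * y1 + x1 * y0 + x2 * y3 - x3 * y2 + x4 * y5 - x5 * y4 - x6 * y7 + x7 * y6)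
    (x0 * y2 - x1 * y3 + x2 * y0 + x3 * y1 + x4 * y6 + x5 * y7 - x6 * y4 - x7 * y5)
    (x0 * y3 + x1 * y2 - x2 * y1 + x3 * y0 + x4 * y7 - x5 * y6 + x6 * y5 - x7 * y4)
    (x0 * y4 - x1 * y5 - x2 * y6 - x3 * y7 + x4 * y0 + x5 * y1 + x6 * y2 + x7 * y3)
    (x0 * y5 + x1 * y4 - x2 * y7 + x3 * y6 - x4 * y1 + x5 * y0 - x6 * y3 + x7 * y2)
    (x0 * y6 + x1 * y7 + x2 * y4 - x3 * y5 - x4 * y2 + x5 * y3 + x6 * y0 - x7 * y1)
    (x0 * y7 - x1 * y6 + x2 * y5 + x3 * y4 - x4 * y3 - x5 * y2 + x6 * y1 + x7 * y0)"
  by (simp add: vec8_eq_iff omult_coords)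

lemma oe_omult_oe:
  "oe 1 \<odot> oe 2 = oe 3" "oe 1 \<odot> oe 3 = - oe 2" "oe 1 \<odot> oe 4 = oe 5" "oe 1 \<odot> oe 5 = - oe 4" "oe 1 \<odot> oe 6 = - oe 7" "oe 1 \<odot> oe 7 = oe 6"
  "oe 2 \<odot> oe 1 = - oe 3" "oe 2 \<odot> oe 3 = oe 1" "oe 2 \<odot> oe 4 = oe 6" "oe 2 \<odot> oe 5 = oe 7" "oe 2 \<odot> oe 6 = - oe 4" "oe 2 \<odot> oe 7 = - oe 5"
  "oe 3 \<odot> oe 1 = oe 2" "oe 3 \<odot> oe 2 = - oe 1" "oe 3 \<odot> oe 4 = oe 7" "oe 3 \<odot> oe 5 = - oe 6" "oe 3 \<odot> oe 6 = oe 5" "oe 3 \<odot> oe 7 = - oe 4"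
  "oe 4 \<odot> oe 1 = - oe 5" "oe 4 \<odot> oe 2 = - oe 6" "oe 4 \<odot> oe 3 = - oe 7" "oe 4 \<odot> oe 5 = oe 1" "oe 4 \<odot> oe 6 = oe 2" "oe 4 \<odot> oe 7 = oe 3"
  "oe 5 \<odot> oe 1 = oe 4" "oe 5 \<odot> oe 2 = - oe 7" "oe 5 \<odot> oe 3 = oe 6" "oe 5 \<odot> oe 4 = - oe 1" "oe 5 \<odot> oe 6 = - oe 3" "oe 5 \<odot> oe 7 = oe 2"
  "oe 6 \<odot> oe 1 = oe 7" "oe 6 \<odot> oe 2 = oe 4" "oe 6 \<odot> oe 3 = - oe 5" "oe 6 \<odot> oe 4 = - oe 2" "oe 6 \<odot> oe 5 = oe 3" "oe 6 \<odot> oe 7 = - oe 1"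
  "oe 7 \<odot> oe 1 = - oe 6" "oe 7 \<odot> oe 2 = oe 5" "oe 7 \<odot> oe 3 = oe 4" "oe 7 \<odot> oe 4 = - oe 3" "oe 7 \<odot> oe 5 = - oe 2" "oe 7 \<odot> oe 6 = oe 1"
  by (simp_all add: oe_v8 omult_v8) (simp_all add: vec8_eq_iff)

lemma v8_eq_iff: "v8 a0 a1 a2 a3 a4 a5 a6 a7 = v8 b0 b1 b2 b3 b4 b5 b6 b7 \<longleftrightarrow>
    a0 = b0 \<and> a1 = b1 \<and> a2 = b2 \<and> a3 = b3 \<and> a4 = b4 \<and> a5 = b5 \<and> a6 = b6 \<and> a7 = b7"
  by (simp add: vec8_eq_iff)

lemma v8_uminus: "- v8 a0 a1 a2 a3 a4 a5 a6 a7 = v8 (-a0) (-a1) (-a2) (-a3) (-a4) (-a5) (-a6) (-a7)" for a0 :: real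
  by (simp add: vec8_eq_iff)

lemma mult_oe: "(M :: real^8^8) *v oe j = v8 (M $ 0 $ j) (M $ 1 $ j) (M $ 2 $ j) (M $ 3 $ j) (M $ 4 $ j) (M $ 5 $ j) (M $ 6 $ j) (M $ 7 $ j)"
  by (simp add: vec8_eq_iff mult_oe_nth)

lemma G2_I_imaginary:
  assumes "\<forall>i j. i \<noteq> 0 \<longrightarrow> j \<noteq> 0 \<longrightarrow> g *v (oe i \<odot> oe j) = (g *v oe i) \<odot> (g *v oe j)"
    and "g *v oe 0 = oe 0" and "g ** h = mat 1" "h ** g = mat 1"
  shows "g \<in> G2"
  using assms(3,4)
proof (rule G2_I[rotated])
  show "g *v (oe i \<odot> oe j) = (g *v oe i) \<odot> (g *v oe j)" for i j
    using assms(1,2) by (cases "i = 0"; cases "j = 0") (auto simp: oe_0_omult omult_oe_0)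
qed

lemma T1_oe:
  "T1 c s *v oe 0 = v8 1 0 0 0 0 0 0 0"
    "T1 c s *v oe 1 = v8 0 1 0 0 0 0 0 0"
    "T1 c s *v oe 2 = v8 0 0 (c * c - s * s) (2 * c * s) 0 0 0 0"
    "T1 c s *v oe 3 = v8 0 0 (- 2 * c * s) (c * c - s * s) 0 0 0 0"
    "T1 c s *v oe 4 = v8 0 0 0 0 c (-s) 0 0"
    "T1 c s *v oe 5 = v8 0 0 0 0 s c 0 0"
    "T1 c s *v oe 6 = v8 0 0 0 0 0 0 c s"
    "T1 c s *v oe 7 = v8 0 0 0 0 0 0 (-s) c"
  by (simp_all add: mult_oe T1_def)

lemma T1_G2: "T1 c s \<in> G2" if u: "c * c + s * s = 1"
proof (rule G2_I_imaginary[of _ "T1 c (- s)"])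
  \<comment> \<open>As rewrite rules these eliminate every second factor \<open>s\<close>, so that
    polynomials on the unit circle reach a normal form that is linear in \<open>s\<close>.\<close>
  have u': "s * s = 1 - c * c" "s * (s * x) = x - c * (c * x)" for x
    using u by algebra+
  show "\<forall>i j. i \<noteq> 0 \<longrightarrow> j \<noteq> 0 \<longrightarrow> T1 c s *v (oe i \<odot> oe j) = (T1 c s *v oe i) \<odot> (T1 c s *v oe j)"
    unfolding all_8
    by (simp add: oe_omult_oe oe_square vec.neg T1_oe omult_v8 v8_uminus v8_eq_iff)
      (simp add: algebra_simps u')
  show "T1 c s *v oe 0 = oe 0"
    by (rule trans[OF T1_oe(1) oe_v8(1)[symmetric]])
  show "T1 c s ** T1 c (- s) = mat 1" "T1 c (- s) ** T1 c s = mat 1"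
    by (simp_all add: vec8_eq_iff matrix_mult_nth_8 T1_def) (simp_all add: algebra_simps u')
qed

lemma Ad_T1: "Ad (T1 c s) (ka x1 x2 x3 y1 y2 y3) =
    ka x1 ((c * c - s * s) * x2 - 2 * c * s * x3) (2 * c * s * x2 + (c * c - s * s) * x3) y1 y2 y3" if u: "c * c + s * s = 1"
proof (rule Ad_eqI[OF T1_G2[OF u]])
  have u': "s * s = 1 - c * c" "s * (s * x) = x - c * (c * x)" for x
    using u by algebra+
  show "T1 c s ** ka x1 x2 x3 y1 y2 y3 = ka x1 ((c * c - s * s) * x2 - 2 * c * s * x3) (2 * c * s * x2 + (c * c - s * s) * x3) y1 y2 y3 ** T1 c s"
    by (simp add: vec8_eq_iff matrix_mult_nth_8 T1_def ka_def) (simp add: algebra_simps u')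
qed

lemma T3_oe:
  "T3 c s *v oe 0 = v8 1 0 0 0 0 0 0 0"
    "T3 c s *v oe 1 = v8 0 (c * c - s * s) (2 * c * s) 0 0 0 0 0"
    "T3 c s *v oe 2 = v8 0 (- 2 * c * s) (c * c - s * s) 0 0 0 0 0"
    "T3 c s *v oe 3 = v8 0 0 0 1 0 0 0 0"
    "T3 c s *v oe 4 = v8 0 0 0 0 c 0 0 (-s)"
    "T3 c s *v oe 5 = v8 0 0 0 0 0 c s 0"
    "T3 c s *v oe 6 = v8 0 0 0 0 0 (-s) c 0"
    "T3 c s *v oe 7 = v8 0 0 0 0 s 0 0 c"
  by (simp_all add: mult_oe T3_def)

lemma T3_G2: "T3 c s \<in> G2" if u: "c * c + s * s = 1"
proof (rule G2_I_imaginary[of _ "T3 c (- s)"])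
  have u': "s * s = 1 - c * c" "s * (s * x) = x - c * (c * x)" for x
    using u by algebra+
  show "\<forall>i j. i \<noteq> 0 \<longrightarrow> j \<noteq> 0 \<longrightarrow> T3 c s *v (oe i \<odot> oe j) = (T3 c s *v oe i) \<odot> (T3 c s *v oe j)"
    unfolding all_8
    by (simp add: oe_omult_oe oe_square vec.neg T3_oe omult_v8 v8_uminus v8_eq_iff)
      (simp add: algebra_simps u')
  show "T3 c s *v oe 0 = oe 0"
    by (rule trans[OF T3_oe(1) oe_v8(1)[symmetric]])
  show "T3 c s ** T3 c (- s) = mat 1" "T3 c (- s) ** T3 c s = mat 1"
    by (simp_all add: vec8_eq_iff matrix_mult_nth_8 T3_def) (simp_all add: algebra_simps u')
qed

lemma Ad_T3: "Ad (T3 c s) (ka x1 x2 x3 y1 y2 y3) =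
    ka ((c * c - s * s) * x1 - 2 * c * s * x2) (2 * c * s * x1 + (c * c - s * s) * x2) x3 y1 y2 y3" if u: "c * c + s * s = 1"
proof (rule Ad_eqI[OF T3_G2[OF u]])
  have u': "s * s = 1 - c * c" "s * (s * x) = x - c * (c * x)" for x
    using u by algebra+
  show "T3 c s ** ka x1 x2 x3 y1 y2 y3 = ka ((c * c - s * s) * x1 - 2 * c * s * x2) (2 * c * s * x1 + (c * c - s * s) * x2) x3 y1 y2 y3 ** T3 c s"
    by (simp add: vec8_eq_iff matrix_mult_nth_8 T3_def ka_def) (simp add: algebra_simps u')
qed

lemma U1_oe:
  "U1 c s *v oe 0 = v8 1 0 0 0 0 0 0 0"
    "U1 c s *v oe 1 = v8 0 1 0 0 0 0 0 0"
    "U1 c s *v oe 2 = v8 0 0 1 0 0 0 0 0"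
    "U1 c s *v oe 3 = v8 0 0 0 1 0 0 0 0"
    "U1 c s *v oe 4 = v8 0 0 0 0 c s 0 0"
    "U1 c s *v oe 5 = v8 0 0 0 0 (-s) c 0 0"
    "U1 c s *v oe 6 = v8 0 0 0 0 0 0 c s"
    "U1 c s *v oe 7 = v8 0 0 0 0 0 0 (-s) c"
  by (simp_all add: mult_oe U1_def)

lemma U1_G2: "U1 c s \<in> G2" if u: "c * c + s * s = 1"
proof (rule G2_I_imaginary[of _ "U1 c (- s)"])
  have u': "s * s = 1 - c * c" "s * (s * x) = x - c * (c * x)" for x
    using u by algebra+
  show "\<forall>i j. i \<noteq> 0 \<longrightarrow> j \<noteq> 0 \<longrightarrow> U1 c s *v (oe i \<odot> oe j) = (U1 c s *v oe i) \<odot> (U1 c s *v oe j)"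
    unfolding all_8
    by (simp add: oe_omult_oe oe_square vec.neg U1_oe omult_v8 v8_uminus v8_eq_iff)
      (simp add: algebra_simps u')
  show "U1 c s *v oe 0 = oe 0"
    by (rule trans[OF U1_oe(1) oe_v8(1)[symmetric]])
  show "U1 c s ** U1 c (- s) = mat 1" "U1 c (- s) ** U1 c s = mat 1"
    by (simp_all add: vec8_eq_iff matrix_mult_nth_8 U1_def) (simp_all add: algebra_simps u')
qed

lemma Ad_U1: "Ad (U1 c s) (ka x1 x2 x3 y1 y2 y3) =
    ka x1 x2 x3 y1 ((c * c - s * s) * y2 - 2 * c * s * y3) (2 * c * s * y2 + (c * c - s * s) * y3)" if u: "c * c + s * s = 1"
proof (rule Ad_eqI[OF U1_G2[OF u]])
  have u': "s * s = 1 - c * c" "s * (s * x) = x - c * (c * x)" for x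
    using u by algebra+
  show "U1 c s ** ka x1 x2 x3 y1 y2 y3 = ka x1 x2 x3 y1 ((c * c - s * s) * y2 - 2 * c * s * y3) (2 * c * s * y2 + (c * c - s * s) * y3) ** U1 c s"
    by (simp add: vec8_eq_iff matrix_mult_nth_8 U1_def ka_def) (simp add: algebra_simps u')
qed

lemma U3_oe:
  "U3 c s *v oe 0 = v8 1 0 0 0 0 0 0 0"
    "U3 c s *v oe 1 = v8 0 1 0 0 0 0 0 0"
    "U3 c s *v oe 2 = v8 0 0 1 0 0 0 0 0"
    "U3 c s *v oe 3 = v8 0 0 0 1 0 0 0 0"
    "U3 c s *v oe 4 = v8 0 0 0 0 c 0 0 s"
    "U3 c s *v oe 5 = v8 0 0 0 0 0 c s 0"
    "U3 c s *v oe 6 = v8 0 0 0 0 0 (-s) c 0"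
    "U3 c s *v oe 7 = v8 0 0 0 0 (-s) 0 0 c"
  by (simp_all add: mult_oe U3_def)

lemma U3_G2: "U3 c s \<in> G2" if u: "c * c + s * s = 1"
proof (rule G2_I_imaginary[of _ "U3 c (- s)"])
  have u': "s * s = 1 - c * c" "s * (s * x) = x - c * (c * x)" for x
    using u by algebra+
  show "\<forall>i j. i \<noteq> 0 \<longrightarrow> j \<noteq> 0 \<longrightarrow> U3 c s *v (oe i \<odot> oe j) = (U3 c s *v oe i) \<odot> (U3 c s *v oe j)"
    unfolding all_8
    by (simp add: oe_omult_oe oe_square vec.neg U3_oe omult_v8 v8_uminus v8_eq_iff)
      (simp add: algebra_simps u')
  show "U3 c s *v oe 0 = oe 0"
    by (rule trans[OF U3_oe(1) oe_v8(1)[symmetric]])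
  show "U3 c s ** U3 c (- s) = mat 1" "U3 c (- s) ** U3 c s = mat 1"
    by (simp_all add: vec8_eq_iff matrix_mult_nth_8 U3_def) (simp_all add: algebra_simps u')
qed

lemma Ad_U3: "Ad (U3 c s) (ka x1 x2 x3 y1 y2 y3) =
    ka x1 x2 x3 ((c * c - s * s) * y1 - 2 * c * s * y2) (2 * c * s * y1 + (c * c - s * s) * y2) y3" if u: "c * c + s * s = 1"
proof (rule Ad_eqI[OF U3_G2[OF u]])
  have u': "s * s = 1 - c * c" "s * (s * x) = x - c * (c * x)" for x
    using u by algebra+
  show "U3 c s ** ka x1 x2 x3 y1 y2 y3 = ka x1 x2 x3 ((c * c - s * s) * y1 - 2 * c * s * y2) (2 * c * s * y1 + (c * c - s * s) * y2) y3 ** U3 c s"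
    by (simp add: vec8_eq_iff matrix_mult_nth_8 U3_def ka_def) (simp add: algebra_simps u')
qed

lemma Rot_oe:
  "Rot c s *v oe 0 = v8 1 0 0 0 0 0 0 0"
    "Rot c s *v oe 1 = v8 0 1 0 0 0 0 0 0"
    "Rot c s *v oe 2 = v8 0 0 c s 0 0 0 0"
    "Rot c s *v oe 3 = v8 0 0 (-s) c 0 0 0 0"
    "Rot c s *v oe 4 = v8 0 0 0 0 c s 0 0"
    "Rot c s *v oe 5 = v8 0 0 0 0 (-s) c 0 0"
    "Rot c s *v oe 6 = v8 0 0 0 0 0 0 (c * c - s * s) (2 * c * s)"
    "Rot c s *v oe 7 = v8 0 0 0 0 0 0 (- 2 * c * s) (c * c - s * s)"
  by (simp_all add: mult_oe Rot_def)

lemma Rot_G2: "Rot c s \<in> G2" if u: "c * c + s * s = 1"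
proof (rule G2_I_imaginary[of _ "Rot c (- s)"])
  have u': "s * s = 1 - c * c" "s * (s * x) = x - c * (c * x)" for x
    using u by algebra+
  show "\<forall>i j. i \<noteq> 0 \<longrightarrow> j \<noteq> 0 \<longrightarrow> Rot c s *v (oe i \<odot> oe j) = (Rot c s *v oe i) \<odot> (Rot c s *v oe j)"
    unfolding all_8
    by (simp add: oe_omult_oe oe_square vec.neg Rot_oe omult_v8 v8_uminus v8_eq_iff)
      (simp add: algebra_simps u')
  show "Rot c s *v oe 0 = oe 0"
    by (rule trans[OF Rot_oe(1) oe_v8(1)[symmetric]])
  show "Rot c s ** Rot c (- s) = mat 1" "Rot c (- s) ** Rot c s = mat 1"
    by (simp_all add: vec8_eq_iff matrix_mult_nth_8 Rot_def) (simp_all add: algebra_simps u')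
qed

text \<open>For \<open>(c, s)\<close> the cosine and sine of an angle, the coefficients on the
  \<open>y\<close>-part are those of the triple angle: \<open>Rot\<close> turns the
  \<open>x\<close>-part once while it turns the \<open>y\<close>-part three times. This is the
  source of the cubic coefficients in \<open>Z_hat\<close>.\<close>

lemma Ad_Rot: "Ad (Rot c s) (ka x1 x2 x3 y1 y2 y3) =
    ka x1 (c * x2 - s * x3) (s * x2 + c * x3) y1
      ((c * c * c - 3 * c * s * s) * y2 - (3 * c * c * s - s * s * s) * y3)
      ((3 * c * c * s - s * s * s) * y2 + (c * c * c - 3 * c * s * s) * y3)" if u: "c * c + s * s = 1"
proof (rule Ad_eqI[OF Rot_G2[OF u]])
  have u': "s * s = 1 - c * c" "s * (s * x) = x - c * (c * x)" for x
    using u by algebra+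
  show "Rot c s ** ka x1 x2 x3 y1 y2 y3 = ka x1 (c * x2 - s * x3) (s * x2 + c * x3) y1
      ((c * c * c - 3 * c * s * s) * y2 - (3 * c * c * s - s * s * s) * y3)
      ((3 * c * c * s - s * s * s) * y2 + (c * c * c - 3 * c * s * s) * y3) ** Rot c s"
    by (simp add: vec8_eq_iff matrix_mult_nth_8 Rot_def ka_def) (simp add: algebra_simps u')
qed

lemma cyc_oe:
  "cyc *v oe 0 = v8 1 0 0 0 0 0 0 0"
    "cyc *v oe 1 = v8 0 1 0 0 0 0 0 0"
    "cyc *v oe 2 = v8 0 0 0 0 1 0 0 0"
    "cyc *v oe 3 = v8 0 0 0 0 0 1 0 0"
    "cyc *v oe 4 = v8 0 0 0 0 0 0 1 0"
    "cyc *v oe 5 = v8 0 0 0 0 0 0 0 (-1)"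
    "cyc *v oe 6 = v8 0 0 1 0 0 0 0 0"
    "cyc *v oe 7 = v8 0 0 0 (-1) 0 0 0 0"
  by (simp_all add: mult_oe cyc_def)

lemma cyc_G2: "cyc \<in> G2"
proof (rule G2_I_imaginary[of _ "cyc ** cyc"])
  show "\<forall>i j. i \<noteq> 0 \<longrightarrow> j \<noteq> 0 \<longrightarrow> cyc *v (oe i \<odot> oe j) = (cyc *v oe i) \<odot> (cyc *v oe j)"
    unfolding all_8
    by (simp add: oe_omult_oe oe_square vec.neg cyc_oe omult_v8 v8_uminus v8_eq_iff)
  show "cyc *v oe 0 = oe 0"
    by (rule trans[OF cyc_oe(1) oe_v8(1)[symmetric]])
qed (simp_all add: vec8_eq_iff matrix_mult_nth_8 cyc_def)

text \<open>On the torus this is a Weyl group element of order three, a rotation by a third of a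
  turn for the invariant form \<open>3 * x\<^sup>2 + y\<^sup>2\<close>.\<close>

lemma Ad_cyc: "Ad cyc (ka x 0 0 y 0 0) = ka (- (x + y) / 2) 0 0 ((3 * x - y) / 2) 0 0"
  by (rule Ad_eqI[OF cyc_G2]) (simp add: vec8_eq_iff matrix_mult_nth_8 cyc_def ka_def field_simps)

section \<open>Rotating elements of \<open>kA\<close> into the maximal torus\<close>

lemma half_angle: "\<exists>c s. c * c + s * s = 1 \<and> 2 * c * s * p + (c * c - s * s) * q = 0" for p q :: real
proof (cases "q = 0")
  case True
  then show ?thesis by (intro exI[of _ 1] exI[of _ 0]) simp
next
  case False
  \<comment> \<open>The tangent of the wanted angle, obtained as a root of the quadratic
    \<open>q * t\<^sup>2 - 2 * p * t - q\<close>.\<close>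
  define t where "t = (p + sqrt (p\<^sup>2 + q\<^sup>2)) / q"
  have "(sqrt (p\<^sup>2 + q\<^sup>2))\<^sup>2 = p\<^sup>2 + q\<^sup>2" by simp
  moreover have "sqrt (p\<^sup>2 + q\<^sup>2) = q * t - p" using False by (simp add: t_def)
  ultimately have "(q * t - p)\<^sup>2 = p\<^sup>2 + q\<^sup>2" by simp
  then have "q * (q * t\<^sup>2 - 2 * p * t - q) = 0" by algebra
  then have "q * t\<^sup>2 - 2 * p * t - q = 0" using False by (metis mult_eq_0_iff)
  then have t: "2 * t * p + (1 - t\<^sup>2) * q = 0" by algebra
  define c where "c = 1 / sqrt (1 + t\<^sup>2)"
  have "1 + t\<^sup>2 > 0" by (simp add: add_pos_nonneg)
  then have "c * c * (1 + t\<^sup>2) = 1" by (simp add: c_def)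
  then have "c * c + (t * c) * (t * c) = 1"
    by (simp add: power2_eq_square algebra_simps)
  moreover have "2 * c * (t * c) * p + (c * c - (t * c) * (t * c)) * q = c * c * (2 * t * p + (1 - t\<^sup>2) * q)"
    by (simp add: power2_eq_square algebra_simps)
  ultimately show ?thesis using t by (intro exI[of _ c] exI[of _ "t * c"]) simp
qed

lemma unit_angle: "\<exists>c s. c * c + s * s = 1 \<and> s * p + c * q = 0" for p q :: real
proof (cases "p = 0 \<and> q = 0")
  case True
  then show ?thesis by (intro exI[of _ 1] exI[of _ 0]) simp
next
  case False
  define r where "r = sqrt (p\<^sup>2 + q\<^sup>2)"
  have "p\<^sup>2 + q\<^sup>2 > 0" using False by (simp add: sum_power2_gt_zero_iff)
  then have "r > 0" "r * r = p\<^sup>2 + q\<^sup>2" by (simp_all only: r_def real_sqrt_gt_zero real_sqrt_mult_self abs_of_pos)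
  then have "r * r = p\<^sup>2 + q\<^sup>2" "r \<noteq> 0" by simp_all
  have "(p / r) * (p / r) + (- q / r) * (- q / r) = (p\<^sup>2 + q\<^sup>2) / (r * r)"
    by (simp add: add_divide_distrib power2_eq_square)
  then have "(p / r) * (p / r) + (- q / r) * (- q / r) = 1"
    using \<open>r * r = p\<^sup>2 + q\<^sup>2\<close> \<open>r \<noteq> 0\<close> by (metis divide_self mult_eq_0_iff)
  then show ?thesis using \<open>r \<noteq> 0\<close> by (intro exI[of _ "p / r"] exI[of _ "- q / r"]) simp
qed

text \<open>\<open>T1\<close> clears the third coordinate and then \<open>T3\<close> the second.
  Both act only on the \<open>x\<close>-factor, whence the quantification over the
  \<open>y\<close>-part: one and the same \<open>g\<close> can later be applied to several
  elements.\<close>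

lemma diag_x:
  obtains g r where "g \<in> G2" "\<And>y1 y2 y3. Ad g (ka x1 x2 x3 y1 y2 y3) = ka r 0 0 y1 y2 y3"
    "\<And>y1 y2 y3. Ad g (ka 0 0 0 y1 y2 y3) = ka 0 0 0 y1 y2 y3"
proof -
  obtain c s where 1: "c * c + s * s = 1" "2 * c * s * x2 + (c * c - s * s) * x3 = 0"
    using half_angle by blast
  define z where "z = (c * c - s * s) * x2 - 2 * c * s * x3"
  obtain c' s' where 2: "c' * c' + s' * s' = 1" "2 * c' * s' * x1 + (c' * c' - s' * s') * z = 0"
    using half_angle by blast
  note G = T3_G2[OF 2(1)] T1_G2[OF 1(1)]
  show thesis
  proof (rule that[of "T3 c' s' ** T1 c s" "(c' * c' - s' * s') * x1 - 2 * c' * s' * z"])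
    show "T3 c' s' ** T1 c s \<in> G2" using G by (rule G2_mult)
  next
    fix y1 y2 y3
    show "Ad (T3 c' s' ** T1 c s) (ka x1 x2 x3 y1 y2 y3)
        = ka ((c' * c' - s' * s') * x1 - 2 * c' * s' * z) 0 0 y1 y2 y3"
      using 1 2 by (simp add: Ad_mult G Ad_T1 Ad_T3 z_def[symmetric])
    show "Ad (T3 c' s' ** T1 c s) (ka 0 0 0 y1 y2 y3) = ka 0 0 0 y1 y2 y3"
      using 1 2 by (simp add: Ad_mult G Ad_T1 Ad_T3)
  qed
qed

lemma diag_y:
  obtains g r where "g \<in> G2" "\<And>x1 x2 x3. Ad g (ka x1 x2 x3 y1 y2 y3) = ka x1 x2 x3 r 0 0"
    "\<And>x1 x2 x3. Ad g (ka x1 x2 x3 0 0 0) = ka x1 x2 x3 0 0 0"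
proof -
  obtain c s where 1: "c * c + s * s = 1" "2 * c * s * y2 + (c * c - s * s) * y3 = 0"
    using half_angle by blast
  define z where "z = (c * c - s * s) * y2 - 2 * c * s * y3"
  obtain c' s' where 2: "c' * c' + s' * s' = 1" "2 * c' * s' * y1 + (c' * c' - s' * s') * z = 0"
    using half_angle by blast
  note G = U3_G2[OF 2(1)] U1_G2[OF 1(1)]
  show thesis
  proof (rule that[of "U3 c' s' ** U1 c s" "(c' * c' - s' * s') * y1 - 2 * c' * s' * z"])
    show "U3 c' s' ** U1 c s \<in> G2" using G by (rule G2_mult)
  next
    fix x1 x2 x3
    show "Ad (U3 c' s' ** U1 c s) (ka x1 x2 x3 y1 y2 y3)
        = ka x1 x2 x3 ((c' * c' - s' * s') * y1 - 2 * c' * s' * z) 0 0"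
      using 1 2 by (simp add: Ad_mult G Ad_U1 Ad_U3 z_def[symmetric])
    show "Ad (U3 c' s' ** U1 c s) (ka x1 x2 x3 0 0 0) = ka x1 x2 x3 0 0 0"
      using 1 2 by (simp add: Ad_mult G Ad_U1 Ad_U3)
  qed
qed

section \<open>Subalgebras containing a given element of a torus\<close>

lemma pa_eq_iff: "pa a4 a5 a6 a7 b4 b5 b6 b7 = pa c4 c5 c6 c7 d4 d5 d6 d7
    \<longleftrightarrow> a4 = c4 \<and> a5 = c5 \<and> a6 = c6 \<and> a7 = c7 \<and> b4 = d4 \<and> b5 = d5 \<and> b6 = d6 \<and> b7 = d7"
  using kp_eq_iff[of 0 0 0 0 0 0 a4 a5 a6 a7 b4 b5 b6 b7 0 0 0 0 0 0 c4 c5 c6 c7 d4 d5 d6 d7]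
  by (simp add: ka_0)

lemma ka_uminus: "- ka x1 x2 x3 y1 y2 y3 = ka (- x1) (- x2) (- x3) (- y1) (- y2) (- y3)"
  and pa_uminus: "- pa a4 a5 a6 a7 b4 b5 b6 b7 = pa (- a4) (- a5) (- a6) (- a7) (- b4) (- b5) (- b6) (- b7)"
  using ka_scale[of "- 1"] pa_scale[of "- 1"] by simp_all

abbreviation torus :: "real \<Rightarrow> real \<Rightarrow> real^8^8" where
  "torus x y \<equiv> ka x 0 0 y 0 0"

lemma linear_sum_list: "linear f \<Longrightarrow> f (sum_list zs) = sum_list (map f zs)"
  by (induction zs) (simp_all add: linear_0 linear_add)

lemma subspace_sum_list: "subspace L \<Longrightarrow> (\<And>x. x \<in> set xs \<Longrightarrow> x \<in> L) \<Longrightarrow> sum_list xs \<in> L"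
  by (induction xs) (simp_all add: subspace_0 subspace_add)

text \<open>Subtracting the first eigenvalue from \<open>M\<close> kills the first summand and
  multiplies each of the others by a nonzero number. By induction the others lie in
  \<open>L\<close>, and so does the first.\<close>

lemma eigen_components:
  fixes L :: "'a::real_vector set"
  assumes L: "subspace L" and M: "linear M" "\<And>X. X \<in> L \<Longrightarrow> M X \<in> L"
    and "\<And>m x. (m, x) \<in> set ps \<Longrightarrow> M x = m *\<^sub>R x" "distinct (map fst ps)" "sum_list (map snd ps) \<in> L"
  shows "snd ` set ps \<subseteq> L"
  using assms(4-)
proof (induction "length ps" arbitrary: ps)
  case 0
  then show ?case by simp
next
  case (Suc n)
  then obtain m x qs where ps: "ps = (m, x) # qs" by (cases ps) auto
  let ?s = "sum_list (map snd qs)"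
  define f where "f = (\<lambda>(k, y :: 'a). (k, (k - m) *\<^sub>R y))"
  have "M ?s = sum_list (map M (map snd qs))"
    using M(1) by (rule linear_sum_list)
  also have "map M (map snd qs) = map (\<lambda>p. fst p *\<^sub>R snd p) qs"
    unfolding map_map by (rule map_cong) (use Suc.prems(1) ps in auto)
  finally have "M ?s = sum_list (map (\<lambda>p. fst p *\<^sub>R snd p) qs)" .
  then have "M (x + ?s) - m *\<^sub>R (x + ?s) = sum_list (map (\<lambda>p. fst p *\<^sub>R snd p - m *\<^sub>R snd p) qs)"
    using Suc.prems(1)[of m x] ps linear_sum_list[OF linear_scale_self[of m], of "map snd qs"]
    by (simp add: linear_add[OF M(1)] sum_list_subtractf scaleR_add_right o_def)
  also have "\<dots> = sum_list (map snd (map f qs))"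
    by (simp add: f_def o_def case_prod_beta scaleR_left_diff_distrib)
  finally have sum: "sum_list (map snd (map f qs)) \<in> L"
    using Suc.prems(3) ps L M(2) by (metis subspace_diff subspace_scale sum_list.Cons list.map(2) snd_conv)
  have eig: "M y = k *\<^sub>R y" if ky: "(k, y) \<in> set (map f qs)" for k y
  proof -
    obtain z where "(k, z) \<in> set qs" "y = (k - m) *\<^sub>R z"
      using ky by (auto simp: f_def)
    then show ?thesis
      using Suc.prems(1)[of k z] ps linear_scale[OF M(1)] by simp
  qed
  have "map fst (map f qs) = map fst qs"
    by (simp add: f_def o_def case_prod_beta)
  moreover have "distinct (map fst qs)"
    using Suc.prems(2) ps by simp
  ultimately have "distinct (map fst (map f qs))"
    by (simp only:)
  moreover have "n = length (map f qs)"
    using Suc.hyps(2) ps by simp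
  ultimately have "snd ` set (map f qs) \<subseteq> L"
    using sum eig by (intro Suc.hyps(1))
  have q: "y \<in> L" if "(k, y) \<in> set qs" for k y
  proof -
    have "(k - m) *\<^sub>R y \<in> L"
      using \<open>snd ` set (map f qs) \<subseteq> L\<close> that by (force simp: f_def image_iff)
    moreover have "k \<noteq> m"
      using Suc.prems(2) ps that by force
    ultimately show ?thesis
      using subspace_scale[OF L, of "(k - m) *\<^sub>R y" "inverse (k - m)"] by simp
  qed
  have "?s \<in> L"
    by (rule subspace_sum_list[OF L]) (use q in auto)
  then have "x \<in> L"
    using Suc.prems(3) ps L by (metis add_diff_cancel_right' subspace_diff sum_list.Cons list.map(2) snd_conv)
  then show ?case using q ps by auto
qed

lemma linear_ad_sq: "linear (\<lambda>X. lie_bracket Z (lie_bracket Z X))"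
  by (rule linearI) (simp_all add: lie_bracket_add_right lie_bracket_scale_right)

lemma bracket_torus:
  "lie_bracket (torus x y) (ka u1 u2 u3 v1 v2 v3) = ka 0 (- 2 * x * u3) (2 * x * u2) 0 (- 2 * y * v3) (2 * y * v2)"
  "lie_bracket (torus x y) (pa a4 a5 a6 a7 b4 b5 b6 b7) =
    pa ((x - y) * a5) (- (x - y) * a4) (- (x + y) * a7) ((x + y) * a6)
      ((3 * x - y) * b5) (- (3 * x - y) * b4) (- (3 * x + y) * b7) ((3 * x + y) * b6)"
  by (simp_all add: bracket_ka_ka bracket_ka_pa pa_eq_iff ka_eq_iff algebra_simps)

text \<open>The factors are the squares of the six positive roots of \<open>g2\<close>, evaluated at
  the torus element.\<close>

lemma ad_sq_torus:
  "lie_bracket (torus x y) (lie_bracket (torus x y) (ka u1 u2 u3 v1 v2 v3)) =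
    - ka 0 ((2 * x)\<^sup>2 * u2) ((2 * x)\<^sup>2 * u3) 0 ((2 * y)\<^sup>2 * v2) ((2 * y)\<^sup>2 * v3)"
  "lie_bracket (torus x y) (lie_bracket (torus x y) (pa a4 a5 a6 a7 b4 b5 b6 b7)) =
    - pa ((x - y)\<^sup>2 * a4) ((x - y)\<^sup>2 * a5) ((x + y)\<^sup>2 * a6) ((x + y)\<^sup>2 * a7)
      ((3 * x - y)\<^sup>2 * b4) ((3 * x - y)\<^sup>2 * b5) ((3 * x + y)\<^sup>2 * b6) ((3 * x + y)\<^sup>2 * b7)"
  by (simp_all add: bracket_torus ka_uminus pa_uminus ka_eq_iff pa_eq_iff power2_eq_square) (simp add: algebra_simps)

definition contains_torus :: "(real^8^8) set \<Rightarrow> bool" where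
  "contains_torus L \<longleftrightarrow> (\<exists>g\<in>G2. \<forall>x y. Ad g (torus x y) \<in> L)"

lemma contains_torus_Ad:
  assumes "g \<in> G2" "contains_torus (Ad g ` L)"
  shows "contains_torus L"
proof -
  obtain h where h: "h \<in> G2" "\<And>x y. Ad h (torus x y) \<in> Ad g ` L"
    using assms(2) by (auto simp: contains_torus_def)
  have "Ad (matrix_inv g ** h) (torus x y) \<in> L" for x y
  proof -
    obtain X where "X \<in> L" "Ad h (torus x y) = Ad g X"
      using h(2)[of x y] by blast
    then show ?thesis by (simp add: Ad_mult G2_inv assms h Ad_inv_left)
  qed
  then show ?thesis
    using assms h unfolding contains_torus_def by (blast intro: G2_mult G2_inv)
qed

lemma contains_torusI:
  assumes "g \<in> G2" "subspace L" "Z \<in> L" "W \<in> L" "Ad g Z = torus x y" "Ad g W = torus u v"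
    and d: "x * v \<noteq> y * u"
  shows "contains_torus L"
proof -
  have "Ad (matrix_inv g) (torus s t) \<in> L" for s t
  proof -
    \<comment> \<open>Cramer's rule for writing \<open>torus s t\<close> through the two given
      independent elements.\<close>
    define p q where "p = (s * v - t * u) / (x * v - y * u)" and "q = (t * x - s * y) / (x * v - y * u)"
    have "p * x + q * u = s" "p * y + q * v = t"
      using d unfolding p_def q_def by (simp_all add: divide_simps) (simp_all add: algebra_simps)
    then have "torus s t = Ad g (p *\<^sub>R Z + q *\<^sub>R W)"
      by (simp add: Ad_add Ad_scale assms ka_add ka_scale)
    then have "Ad (matrix_inv g) (torus s t) = p *\<^sub>R Z + q *\<^sub>R W"
      by (simp add: Ad_inv_left assms)
    then show ?thesis using assms by (simp add: subspace_add subspace_scale)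
  qed
  then show ?thesis
    using assms unfolding contains_torus_def by (blast intro: G2_inv)
qed

lemma Ad_mat_1: "Ad (mat 1) Z = Z"
  by (simp add: Ad_def matrix_inv_eqI[of "mat 1" "mat 1"])

lemma mat_1_G2: "mat 1 \<in> G2"
  by (auto simp: G2_def invertible_def intro: exI[of _ "mat 1"])

lemma contains_torusI':
  "subspace L \<Longrightarrow> torus x y \<in> L \<Longrightarrow> torus u v \<in> L \<Longrightarrow> x * v \<noteq> y * u \<Longrightarrow> contains_torus L"
  by (rule contains_torusI[OF mat_1_G2]) (auto simp: Ad_mat_1)

text \<open>With this sign, \<open>\<mu>\<close> is the common squared root value on those root
  components of \<open>Y\<close> that the case analysis leaves over, or 0 if none is left.\<close>

definition resonant :: "real^8^8 \<Rightarrow> real^8^8 \<Rightarrow> bool" where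
  "resonant Z Y \<longleftrightarrow> (\<exists>\<alpha> \<mu>. lie_bracket Z (lie_bracket Z Y) = \<alpha> *\<^sub>R Z - \<mu> *\<^sub>R Y)"

lemma resonant_Ad:
  assumes g: "g \<in> G2" and "resonant (Ad g Z) (Ad g Y)"
  shows "resonant Z Y"
proof -
  obtain \<alpha> \<mu> where "Ad g (lie_bracket Z (lie_bracket Z Y)) = Ad g (\<alpha> *\<^sub>R Z - \<mu> *\<^sub>R Y)"
    using assms by (auto simp: resonant_def Ad_bracket Ad_diff Ad_scale)
  then have "lie_bracket Z (lie_bracket Z Y) = \<alpha> *\<^sub>R Z - \<mu> *\<^sub>R Y"
    by (metis Ad_inv_left g)
  then show ?thesis by (auto simp: resonant_def)
qed

lemma sumsq_pos: "p \<noteq> 0 \<or> q \<noteq> 0 \<Longrightarrow> p * p + q * q \<noteq> 0" for p q :: real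
  by (simp add: sum_squares_eq_zero_iff)

text \<open>The element \<open>ka u1 u2 u3 v 0 0\<close> commutes with \<open>torus 0 y\<close>, and
  diagonalising its \<open>x\<close>-part does not move \<open>torus 0 y\<close>. The result is a
  pair of independent elements of one torus.\<close>

lemma torus_from_x:
  assumes L: "subspace L" "torus 0 y \<in> L" "y \<noteq> 0" "ka u1 u2 u3 v 0 0 \<in> L" "\<not> (u1 = 0 \<and> u2 = 0 \<and> u3 = 0)"
  shows "contains_torus L"
proof -
  obtain g r where g: "g \<in> G2" "\<And>y1 y2 y3. Ad g (ka u1 u2 u3 y1 y2 y3) = ka r 0 0 y1 y2 y3"
    "\<And>y1 y2 y3. Ad g (ka 0 0 0 y1 y2 y3) = ka 0 0 0 y1 y2 y3"
    using diag_x by blast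
  have "r \<noteq> 0"
    using Ad_inv_left[OF g(1), of "ka u1 u2 u3 0 0 0"] Ad_inv_left[OF g(1), of "ka 0 0 0 0 0 0"] g(2,3) assms(5)
    by (auto simp: ka_eq_iff)
  then show ?thesis
    using contains_torusI[OF g(1) L(1) L(2) L(4), of 0 y r v] g(2,3) \<open>y \<noteq> 0\<close> by simp
qed

lemma torus_from_y:
  assumes L: "subspace L" "torus x 0 \<in> L" "x \<noteq> 0" "ka u 0 0 v1 v2 v3 \<in> L" "\<not> (v1 = 0 \<and> v2 = 0 \<and> v3 = 0)"
  shows "contains_torus L"
proof -
  obtain g r where g: "g \<in> G2" "\<And>x1 x2 x3. Ad g (ka x1 x2 x3 v1 v2 v3) = ka x1 x2 x3 r 0 0"
    "\<And>x1 x2 x3. Ad g (ka x1 x2 x3 0 0 0) = ka x1 x2 x3 0 0 0"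
    using diag_y by blast
  have "r \<noteq> 0"
    using Ad_inv_left[OF g(1), of "ka 0 0 0 v1 v2 v3"] Ad_inv_left[OF g(1), of "ka 0 0 0 0 0 0"] g(2,3) assms(5)
    by (auto simp: ka_eq_iff)
  then show ?thesis
    using contains_torusI[OF g(1) L(1) L(2) L(4), of x 0 u r] g(2,3) \<open>x \<noteq> 0\<close> by simp
qed

locale subalgebra_with_torus_element =
  fixes L x y
  assumes L: "lie_subalgebra L" and Z: "torus x y \<in> L"
begin

lemma sub: "subspace L"
  using L by (simp add: lie_subalgebra_def)

lemma bracket: "X \<in> L \<Longrightarrow> Y \<in> L \<Longrightarrow> lie_bracket X Y \<in> L"
  using L by (simp add: lie_subalgebra_def)

lemma double: "X \<in> L \<Longrightarrow> lie_bracket X (lie_bracket (torus x y) X) \<in> L"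
  using Z by (intro bracket)

lemma components:
  assumes "\<And>m X. (m, X) \<in> set ps \<Longrightarrow> lie_bracket (torus x y) (lie_bracket (torus x y) X) = - (m *\<^sub>R X)"
    and "distinct (map fst ps)" "sum_list (map snd ps) \<in> L" "(m, X) \<in> set ps"
  shows "X \<in> L"
proof -
  have *: "map fst (map (\<lambda>(m, X). (- m, X)) ps) = map uminus (map fst ps)"
    "map snd (map (\<lambda>(m, X). (- m, X)) ps) = map snd ps"
    by (simp_all add: o_def case_prod_beta)
  have "snd ` set (map (\<lambda>(m, X). (- m, X)) ps) \<subseteq> L"
  proof (rule eigen_components[OF sub linear_ad_sq[of "torus x y"]])
    show "distinct (map fst (map (\<lambda>(m, X). (- m, X)) ps))"
      unfolding * using assms(2) by (simp add: distinct_map inj_on_def)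
  qed (use assms(1,3) Z bracket in \<open>auto simp: o_def case_prod_beta\<close>)
  then show ?thesis using assms(4) by force
qed

text \<open>The names record the short (\<open>s\<close>) or long (\<open>l\<close>) root attached to each of the planes \<open>a\<close>, \<open>b\<close>, \<open>c\<close>,
  that is \<open>(e\<^sub>2, e\<^sub>3)\<close>, \<open>(e\<^sub>4, e\<^sub>5)\<close>, \<open>(e\<^sub>6, e\<^sub>7)\<close>. For \<open>P\<close> in a root plane, \<open>[P, [Z, P]]\<close> is a multiple of the
  coroot, so \<open>L\<close> contains a torus unless \<open>Z\<close> is itself such a multiple.\<close>

lemma coroot_sa:
  assumes "ka 0 p q 0 0 0 \<in> L" "p \<noteq> 0 \<or> q \<noteq> 0" "x \<noteq> 0" "y \<noteq> 0"
  shows "contains_torus L"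
proof -
  let ?P = "ka 0 p q 0 0 0" and ?n = "p * p + q * q"
  have "lie_bracket ?P (lie_bracket (torus x y) ?P) = torus (4 * x * ?n) (0)"
    by (simp add: bracket_torus bracket_ka_ka ka_eq_iff algebra_simps)
  then have "torus (4 * x * ?n) (0) \<in> L"
    using double[OF assms(1)] by simp
  moreover have "x * (0) - y * (4 * x * ?n) = (- 4 * x * y) * ?n"
    by (simp add: algebra_simps)
  then have "x * (0) - y * (4 * x * ?n) \<noteq> 0"
    using assms(2-) sumsq_pos[OF assms(2)] by (simp only: mult_eq_0_iff) simp
  then have "x * (0) \<noteq> y * (4 * x * ?n)"
    by (metis right_minus_eq)
  ultimately show ?thesis using contains_torusI'[OF sub Z] by blast
qed

lemma coroot_la:
  assumes "ka 0 0 0 0 p q \<in> L" "p \<noteq> 0 \<or> q \<noteq> 0" "x \<noteq> 0" "y \<noteq> 0"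
  shows "contains_torus L"
proof -
  let ?P = "ka 0 0 0 0 p q" and ?n = "p * p + q * q"
  have "lie_bracket ?P (lie_bracket (torus x y) ?P) = torus (0) (4 * y * ?n)"
    by (simp add: bracket_torus bracket_ka_ka ka_eq_iff algebra_simps)
  then have "torus (0) (4 * y * ?n) \<in> L"
    using double[OF assms(1)] by simp
  moreover have "x * (4 * y * ?n) - y * (0) = (4 * x * y) * ?n"
    by (simp add: algebra_simps)
  then have "x * (4 * y * ?n) - y * (0) \<noteq> 0"
    using assms(2-) sumsq_pos[OF assms(2)] by (simp only: mult_eq_0_iff) simp
  then have "x * (4 * y * ?n) \<noteq> y * (0)"
    by (metis right_minus_eq)
  ultimately show ?thesis using contains_torusI'[OF sub Z] by blast
qed

lemma coroot_sb:
  assumes "pa p q 0 0 0 0 0 0 \<in> L" "p \<noteq> 0 \<or> q \<noteq> 0" "x - y \<noteq> 0" "3 * x + y \<noteq> 0"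
  shows "contains_torus L"
proof -
  let ?P = "pa p q 0 0 0 0 0 0" and ?n = "p * p + q * q"
  have "lie_bracket ?P (lie_bracket (torus x y) ?P) = torus ((x - y) * ?n) (- 3 * (x - y) * ?n)"
    by (simp add: bracket_torus bracket_pa_pa ka_eq_iff algebra_simps)
  then have "torus ((x - y) * ?n) (- 3 * (x - y) * ?n) \<in> L"
    using double[OF assms(1)] by simp
  moreover have "x * (- 3 * (x - y) * ?n) - y * ((x - y) * ?n) = (- 1 * (x - y) * (3 * x + y)) * ?n"
    by (simp add: algebra_simps)
  then have "x * (- 3 * (x - y) * ?n) - y * ((x - y) * ?n) \<noteq> 0"
    using assms(2-) sumsq_pos[OF assms(2)] by (simp only: mult_eq_0_iff) simp
  then have "x * (- 3 * (x - y) * ?n) \<noteq> y * ((x - y) * ?n)"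
    by (metis right_minus_eq)
  ultimately show ?thesis using contains_torusI'[OF sub Z] by blast
qed

lemma coroot_lb:
  assumes "pa 0 0 0 0 0 0 p q \<in> L" "p \<noteq> 0 \<or> q \<noteq> 0" "x - y \<noteq> 0" "3 * x + y \<noteq> 0"
  shows "contains_torus L"
proof -
  let ?P = "pa 0 0 0 0 0 0 p q" and ?n = "p * p + q * q"
  have "lie_bracket ?P (lie_bracket (torus x y) ?P) = torus ((3 * x + y) * ?n) ((3 * x + y) * ?n)"
    by (simp add: bracket_torus bracket_pa_pa ka_eq_iff algebra_simps)
  then have "torus ((3 * x + y) * ?n) ((3 * x + y) * ?n) \<in> L"
    using double[OF assms(1)] by simp
  moreover have "x * ((3 * x + y) * ?n) - y * ((3 * x + y) * ?n) = ((x - y) * (3 * x + y)) * ?n"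
    by (simp add: algebra_simps)
  then have "x * ((3 * x + y) * ?n) - y * ((3 * x + y) * ?n) \<noteq> 0"
    using assms(2-) sumsq_pos[OF assms(2)] by (simp only: mult_eq_0_iff) simp
  then have "x * ((3 * x + y) * ?n) \<noteq> y * ((3 * x + y) * ?n)"
    by (metis right_minus_eq)
  ultimately show ?thesis using contains_torusI'[OF sub Z] by blast
qed

lemma coroot_sc:
  assumes "pa 0 0 p q 0 0 0 0 \<in> L" "p \<noteq> 0 \<or> q \<noteq> 0" "x + y \<noteq> 0" "3 * x - y \<noteq> 0"
  shows "contains_torus L"
proof -
  let ?P = "pa 0 0 p q 0 0 0 0" and ?n = "p * p + q * q"
  have "lie_bracket ?P (lie_bracket (torus x y) ?P) = torus ((x + y) * ?n) (3 * (x + y) * ?n)"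
    by (simp add: bracket_torus bracket_pa_pa ka_eq_iff algebra_simps)
  then have "torus ((x + y) * ?n) (3 * (x + y) * ?n) \<in> L"
    using double[OF assms(1)] by simp
  moreover have "x * (3 * (x + y) * ?n) - y * ((x + y) * ?n) = ((x + y) * (3 * x - y)) * ?n"
    by (simp add: algebra_simps)
  then have "x * (3 * (x + y) * ?n) - y * ((x + y) * ?n) \<noteq> 0"
    using assms(2-) sumsq_pos[OF assms(2)] by (simp only: mult_eq_0_iff) simp
  then have "x * (3 * (x + y) * ?n) \<noteq> y * ((x + y) * ?n)"
    by (metis right_minus_eq)
  ultimately show ?thesis using contains_torusI'[OF sub Z] by blast
qed

lemma coroot_lc:
  assumes "pa 0 0 0 0 p q 0 0 \<in> L" "p \<noteq> 0 \<or> q \<noteq> 0" "x + y \<noteq> 0" "3 * x - y \<noteq> 0"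
  shows "contains_torus L"
proof -
  let ?P = "pa 0 0 0 0 p q 0 0" and ?n = "p * p + q * q"
  have "lie_bracket ?P (lie_bracket (torus x y) ?P) = torus ((3 * x - y) * ?n) (- (3 * x - y) * ?n)"
    by (simp add: bracket_torus bracket_pa_pa ka_eq_iff algebra_simps)
  then have "torus ((3 * x - y) * ?n) (- (3 * x - y) * ?n) \<in> L"
    using double[OF assms(1)] by simp
  moreover have "x * (- (3 * x - y) * ?n) - y * ((3 * x - y) * ?n) = (- 1 * (x + y) * (3 * x - y)) * ?n"
    by (simp add: algebra_simps)
  then have "x * (- (3 * x - y) * ?n) - y * ((3 * x - y) * ?n) \<noteq> 0"
    using assms(2-) sumsq_pos[OF assms(2)] by (simp only: mult_eq_0_iff) simp
  then have "x * (- (3 * x - y) * ?n) \<noteq> y * ((3 * x - y) * ?n)"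
    by (metis right_minus_eq)
  ultimately show ?thesis using contains_torusI'[OF sub Z] by blast
qed

lemma torus_part: "torus u v \<in> L \<Longrightarrow> x * v \<noteq> y * u \<Longrightarrow> contains_torus L"
  using contains_torusI'[OF sub Z] by blast

text \<open>Under \<open>nz\<close> no root vanishes at \<open>Z\<close>; together with
  \<open>P\<close> this makes all seven eigenvalues distinct, so each root component of
  \<open>Y\<close> lies in \<open>L\<close> separately. A single nonzero one then supplies a coroot
  independent of \<open>Z\<close>, and if there is none, \<open>Y\<close> commutes with
  \<open>Z\<close>.\<close>

lemma regular_case:
  assumes Y: "ka u1 u2 u3 v1 v2 v3 + pa a4 a5 a6 a7 b4 b5 b6 b7 \<in> L" (is "?Y \<in> L")
    and nz: "x \<noteq> 0" "y \<noteq> 0" "x - y \<noteq> 0" "x + y \<noteq> 0" "3 * x - y \<noteq> 0" "3 * x + y \<noteq> 0"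
    and P: "2 * x - y \<noteq> 0" "2 * x + y \<noteq> 0" "5 * x - y \<noteq> 0" "5 * x + y \<noteq> 0" "x - 3 * y \<noteq> 0" "x + 3 * y \<noteq> 0"
  shows "contains_torus L \<or> resonant (torus x y) ?Y"
proof -
  let ?ps = "[(0, ka u1 0 0 v1 0 0), ((2 * x)\<^sup>2, ka 0 u2 u3 0 0 0), ((2 * y)\<^sup>2, ka 0 0 0 0 v2 v3),
    ((x - y)\<^sup>2, pa a4 a5 0 0 0 0 0 0), ((x + y)\<^sup>2, pa 0 0 a6 a7 0 0 0 0),
    ((3 * x - y)\<^sup>2, pa 0 0 0 0 b4 b5 0 0), ((3 * x + y)\<^sup>2, pa 0 0 0 0 0 0 b6 b7)]"
  have sum: "sum_list (map snd ?ps) = ?Y"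
    by (simp add: ka_add pa_add algebra_simps)
  have d: "distinct (map fst ?ps)"
  proof -
    \<comment> \<open>Both \<open>p - q\<close> and \<open>p + q\<close> are nonzero multiples of
      linear forms assumed not to vanish; the instances below run through all pairs of
      roots.\<close>
    have ne: "p\<^sup>2 \<noteq> q\<^sup>2" if "p - q = k * a" "p + q = l * b" "k \<noteq> 0" "a \<noteq> 0" "l \<noteq> 0" "b \<noteq> 0" for p q k a l b :: real
      using that by (metis eq_neg_iff_add_eq_0 mult_eq_0_iff power2_eq_iff right_minus_eq)
    show ?thesis
      using nz P
        ne[of "2 * x" "2 * y" 2 "x - y" 2 "x + y"] ne[of "2 * x" "x - y" 1 "x + y" 1 "3 * x - y"]
        ne[of "2 * x" "x + y" 1 "x - y" 1 "3 * x + y"] ne[of "2 * x" "3 * x - y" "-1" "x - y" 1 "5 * x - y"]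
        ne[of "2 * x" "3 * x + y" "-1" "x + y" 1 "5 * x + y"] ne[of "2 * y" "x - y" "-1" "x - 3 * y" 1 "x + y"]
        ne[of "2 * y" "x + y" "-1" "x - y" 1 "x + 3 * y"] ne[of "2 * y" "3 * x - y" "-3" "x - y" 1 "3 * x + y"]
        ne[of "2 * y" "3 * x + y" "-1" "3 * x - y" 3 "x + y"] ne[of "x - y" "x + y" "-2" y 2 x]
        ne[of "x - y" "3 * x - y" "-2" x 2 "2 * x - y"] ne[of "x - y" "3 * x + y" "-2" "x + y" 4 x]
        ne[of "x + y" "3 * x - y" "-2" "x - y" 4 x] ne[of "x + y" "3 * x + y" "-2" x 2 "2 * x + y"]
        ne[of "3 * x - y" "3 * x + y" "-2" y 6 x]
      by (simp add: algebra_simps del: power_mult_distrib)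
  qed
  have e: "lie_bracket (torus x y) (lie_bracket (torus x y) X) = - (m *\<^sub>R X)" if "(m, X) \<in> set ?ps" for m X
    using that by (auto simp: ad_sq_torus ka_scale pa_scale ka_0)
  have in_L: "X \<in> L" if "(m, X) \<in> set ?ps" for m X
    by (rule components[OF e d _ that]) (simp_all only: sum Y)
  show ?thesis
  proof (cases "u2 = 0 \<and> u3 = 0 \<and> v2 = 0 \<and> v3 = 0 \<and> a4 = 0 \<and> a5 = 0 \<and> a6 = 0 \<and> a7 = 0 \<and>
      b4 = 0 \<and> b5 = 0 \<and> b6 = 0 \<and> b7 = 0")
    case True
    then have "lie_bracket (torus x y) (lie_bracket (torus x y) ?Y) = 0 *\<^sub>R torus x y - 0 *\<^sub>R ?Y"
      by (simp add: pa_0 ad_sq_torus ka_0)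
    then show ?thesis unfolding resonant_def by blast
  next
    case False
    then consider "u2 \<noteq> 0 \<or> u3 \<noteq> 0" | "v2 \<noteq> 0 \<or> v3 \<noteq> 0" | "a4 \<noteq> 0 \<or> a5 \<noteq> 0" | "a6 \<noteq> 0 \<or> a7 \<noteq> 0"
      | "b4 \<noteq> 0 \<or> b5 \<noteq> 0" | "b6 \<noteq> 0 \<or> b7 \<noteq> 0" by blast
    then have "contains_torus L"
    proof cases
      case 1
      show ?thesis by (rule coroot_sa[OF in_L[of "(2 * x)\<^sup>2"] 1]) (use nz in auto)
    next
      case 2
      show ?thesis by (rule coroot_la[OF in_L[of "(2 * y)\<^sup>2"] 2]) (use nz in auto)
    next
      case 3
      show ?thesis by (rule coroot_sb[OF in_L[of "(x - y)\<^sup>2"] 3]) (use nz in auto)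
    next
      case 4
      show ?thesis by (rule coroot_sc[OF in_L[of "(x + y)\<^sup>2"] 4]) (use nz in auto)
    next
      case 5
      show ?thesis by (rule coroot_lc[OF in_L[of "(3 * x - y)\<^sup>2"] 5]) (use nz in auto)
    next
      case 6
      show ?thesis by (rule coroot_lb[OF in_L[of "(3 * x + y)\<^sup>2"] 6]) (use nz in auto)
    qed
    then show ?thesis ..
  qed
qed

text \<open>Here a short and a long simple root take the same value on \<open>Z\<close>, as they do for principal \<open>so(3)\<close>.\<close>

lemma principal_case:
  assumes Y: "ka u1 u2 u3 v1 v2 v3 + pa a4 a5 a6 a7 b4 b5 b6 b7 \<in> L" (is "?Y \<in> L")
    and x: "x \<noteq> 0" and y: "y = 2 * x"
  shows "contains_torus L \<or> resonant (torus x y) ?Y"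
proof -
  \<comment> \<open>The roots \<open>x - y\<close> and \<open>3 * x - y\<close> take the values
    \<open>- x\<close> and \<open>x\<close> here. Their planes share an eigenvalue and stay together
    as one component, the one that survives in the resonant case.\<close>
  let ?ps = "[(0, ka u1 0 0 v1 0 0), (4 * x\<^sup>2, ka 0 u2 u3 0 0 0), (16 * x\<^sup>2, ka 0 0 0 0 v2 v3),
    (x\<^sup>2, pa a4 a5 0 0 b4 b5 0 0), (9 * x\<^sup>2, pa 0 0 a6 a7 0 0 0 0), (25 * x\<^sup>2, pa 0 0 0 0 0 0 b6 b7)]"
  have sum: "sum_list (map snd ?ps) = ?Y"
    by (simp add: ka_add pa_add algebra_simps)
  have d: "distinct (map fst ?ps)"
    using x by simp
  have e: "lie_bracket (torus x y) (lie_bracket (torus x y) X) = - (m *\<^sub>R X)" if "(m, X) \<in> set ?ps" for m X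
    using that by (auto simp: ad_sq_torus ka_scale pa_scale ka_0 y power2_eq_square)
  have in_L: "X \<in> L" if "(m, X) \<in> set ?ps" for m X
    by (rule components[OF e d _ that]) (simp_all only: sum Y)
  show ?thesis
  proof (cases "u2 = 0 \<and> u3 = 0 \<and> v2 = 0 \<and> v3 = 0 \<and> a6 = 0 \<and> a7 = 0 \<and> b6 = 0 \<and> b7 = 0 \<and> v1 = 2 * u1")
    case True
    then have "lie_bracket (torus x y) (lie_bracket (torus x y) ?Y) = (x * u1) *\<^sub>R torus x y - (x\<^sup>2) *\<^sub>R ?Y"
      by (simp add: lie_bracket_add_right ad_sq_torus ka_0 ka_scale pa_scale ka_add pa_uminus
          scaleR_add_right y power2_eq_square diff_add_eq_diff_diff_swap)
        (simp add: ka_diff ka_0 pa_uminus pa_eq_iff algebra_simps)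
    then show ?thesis unfolding resonant_def by blast
  next
    case False
    then consider "u2 \<noteq> 0 \<or> u3 \<noteq> 0" | "v2 \<noteq> 0 \<or> v3 \<noteq> 0" | "a6 \<noteq> 0 \<or> a7 \<noteq> 0"
      | "b6 \<noteq> 0 \<or> b7 \<noteq> 0" | "v1 \<noteq> 2 * u1" by blast
    then have "contains_torus L"
    proof cases
      case 1
      show ?thesis by (rule coroot_sa[OF in_L[of "4 * x\<^sup>2"] 1]) (use x y in auto)
    next
      case 2
      show ?thesis by (rule coroot_la[OF in_L[of "16 * x\<^sup>2"] 2]) (use x y in auto)
    next
      case 3
      show ?thesis by (rule coroot_sc[OF in_L[of "9 * x\<^sup>2"] 3]) (use x y in auto)
    next
      case 4
      show ?thesis by (rule coroot_lb[OF in_L[of "25 * x\<^sup>2"] 4]) (use x y in auto)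
    next
      case 5
      show ?thesis by (rule torus_part[OF in_L[of 0]]) (use x y 5 in auto)
    qed
    then show ?thesis ..
  qed
qed

text \<open>On the walls the centraliser of \<open>Z\<close> is \<open>\<real> Z + su(2)\<close>, and any further element of it in \<open>L\<close> yields a
  torus. The brackets \<open>[P, [Z, P]]\<close> produce such an element.\<close>

lemma long_wall_case:
  assumes Y: "ka u1 u2 u3 v1 v2 v3 + pa a4 a5 a6 a7 b4 b5 b6 b7 \<in> L" (is "?Y \<in> L")
    and x: "x \<noteq> 0" and y: "y = 0"
  shows "contains_torus L \<or> resonant (torus x y) ?Y"
proof -
  let ?ps = "[(0, ka u1 0 0 v1 v2 v3), (4 * x\<^sup>2, ka 0 u2 u3 0 0 0),
    (x\<^sup>2, pa a4 a5 a6 a7 0 0 0 0), (9 * x\<^sup>2, pa 0 0 0 0 b4 b5 b6 b7)]"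
  have sum: "sum_list (map snd ?ps) = ?Y"
    by (simp add: ka_add pa_add algebra_simps)
  have d: "distinct (map fst ?ps)"
    using x by simp
  have e: "lie_bracket (torus x y) (lie_bracket (torus x y) X) = - (m *\<^sub>R X)" if "(m, X) \<in> set ?ps" for m X
    using that by (auto simp: ad_sq_torus ka_scale pa_scale ka_0 y power2_eq_square)
  have in_L: "X \<in> L" if "(m, X) \<in> set ?ps" for m X
    by (rule components[OF e d _ that]) (simp_all only: sum Y)
  note torus = torus_from_y[OF sub Z[unfolded y] x]
  \<comment> \<open>With \<open>z = p + i q\<close> and \<open>w = r + i s\<close> the assumptions
    say that \<open>z\<close> and \<open>w\<close> have equal modulus and product 0: the Hopf map
    vanishes only at the origin.\<close>
  have hopf: "p = 0 \<and> q = 0 \<and> r = 0 \<and> s = 0"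
    if "r * r + s * s = p * p + q * q" "p * s + q * r = 0" "p * r - q * s = 0" for p q r s :: real
  proof -
    have "(p * p + q * q) * (r * r + s * s) = (p * s + q * r) * (p * s + q * r) + (p * r - q * s) * (p * r - q * s)"
      by (simp add: algebra_simps)
    then have "p * p + q * q = 0" "r * r + s * s = 0" using that by auto
    then show ?thesis by (simp add: sum_squares_eq_zero_iff)
  qed
  have A: "contains_torus L" if a: "\<not> (a4 = 0 \<and> a5 = 0 \<and> a6 = 0 \<and> a7 = 0)"
  proof (rule torus)
    have "lie_bracket (pa a4 a5 a6 a7 0 0 0 0) (lie_bracket (torus x y) (pa a4 a5 a6 a7 0 0 0 0)) \<in> L"
      by (rule double, rule in_L[of "x\<^sup>2"]) simp
    also have "lie_bracket (pa a4 a5 a6 a7 0 0 0 0) (lie_bracket (torus x y) (pa a4 a5 a6 a7 0 0 0 0)) =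
      ka (x * (a4 * a4 + a5 * a5 + a6 * a6 + a7 * a7)) 0 0
        (3 * x * ((a6 * a6 + a7 * a7) - (a4 * a4 + a5 * a5))) (- 6 * x * (a4 * a7 + a5 * a6)) (6 * x * (a4 * a6 - a5 * a7))"
      by (simp add: bracket_torus bracket_pa_pa ka_eq_iff y algebra_simps)
    finally show "ka (x * (a4 * a4 + a5 * a5 + a6 * a6 + a7 * a7)) 0 0
        (3 * x * ((a6 * a6 + a7 * a7) - (a4 * a4 + a5 * a5))) (- 6 * x * (a4 * a7 + a5 * a6)) (6 * x * (a4 * a6 - a5 * a7)) \<in> L" .
    show "\<not> (3 * x * ((a6 * a6 + a7 * a7) - (a4 * a4 + a5 * a5)) = 0 \<and> - 6 * x * (a4 * a7 + a5 * a6) = 0 \<and>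
        6 * x * (a4 * a6 - a5 * a7) = 0)"
    proof
      assume "3 * x * ((a6 * a6 + a7 * a7) - (a4 * a4 + a5 * a5)) = 0 \<and> - 6 * x * (a4 * a7 + a5 * a6) = 0 \<and>
        6 * x * (a4 * a6 - a5 * a7) = 0"
      then have "a6 * a6 + a7 * a7 = a4 * a4 + a5 * a5" "a4 * a7 + a5 * a6 = 0" "a4 * a6 - a5 * a7 = 0"
        using x by simp_all
      from hopf[OF this] show False using a by simp
    qed
  qed
  have B: "contains_torus L" if a: "\<not> (b4 = 0 \<and> b5 = 0 \<and> b6 = 0 \<and> b7 = 0)"
  proof (rule torus)
    have "lie_bracket (pa 0 0 0 0 b4 b5 b6 b7) (lie_bracket (torus x y) (pa 0 0 0 0 b4 b5 b6 b7)) \<in> L"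
      by (rule double, rule in_L[of "9 * x\<^sup>2"]) simp
    also have "lie_bracket (pa 0 0 0 0 b4 b5 b6 b7) (lie_bracket (torus x y) (pa 0 0 0 0 b4 b5 b6 b7)) =
      ka (3 * x * (b4 * b4 + b5 * b5 + b6 * b6 + b7 * b7)) 0 0
        (3 * x * ((b6 * b6 + b7 * b7) - (b4 * b4 + b5 * b5))) (- 6 * x * (b4 * b7 + b5 * b6)) (6 * x * (b4 * b6 - b5 * b7))"
      by (simp add: bracket_torus bracket_pa_pa ka_eq_iff y algebra_simps)
    finally show "ka (3 * x * (b4 * b4 + b5 * b5 + b6 * b6 + b7 * b7)) 0 0
        (3 * x * ((b6 * b6 + b7 * b7) - (b4 * b4 + b5 * b5))) (- 6 * x * (b4 * b7 + b5 * b6)) (6 * x * (b4 * b6 - b5 * b7)) \<in> L" .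
    show "\<not> (3 * x * ((b6 * b6 + b7 * b7) - (b4 * b4 + b5 * b5)) = 0 \<and> - 6 * x * (b4 * b7 + b5 * b6) = 0 \<and>
        6 * x * (b4 * b6 - b5 * b7) = 0)"
    proof
      assume "3 * x * ((b6 * b6 + b7 * b7) - (b4 * b4 + b5 * b5)) = 0 \<and> - 6 * x * (b4 * b7 + b5 * b6) = 0 \<and>
        6 * x * (b4 * b6 - b5 * b7) = 0"
      then have "b6 * b6 + b7 * b7 = b4 * b4 + b5 * b5" "b4 * b7 + b5 * b6 = 0" "b4 * b6 - b5 * b7 = 0"
        using x by simp_all
      from hopf[OF this] show False using a by simp
    qed
  qed
  show ?thesis
  proof (cases "v1 = 0 \<and> v2 = 0 \<and> v3 = 0 \<and> a4 = 0 \<and> a5 = 0 \<and> a6 = 0 \<and> a7 = 0 \<and> b4 = 0 \<and> b5 = 0 \<and> b6 = 0 \<and> b7 = 0")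
    case True
    then have "lie_bracket (torus x y) (lie_bracket (torus x y) ?Y) = (4 * x * u1) *\<^sub>R torus x y - (4 * x\<^sup>2) *\<^sub>R ?Y"
      by (simp add: pa_0 ad_sq_torus ka_0 ka_scale ka_diff ka_uminus ka_eq_iff y power2_eq_square)
    then show ?thesis unfolding resonant_def by blast
  next
    case False
    have "ka u1 0 0 v1 v2 v3 \<in> L"
      by (rule in_L) force
    then show ?thesis using False A B torus by blast
  qed
qed

text \<open>With \<open>A = a4 + i a5\<close>, \<open>B = a6 + i a7\<close>, \<open>C = b4 + i b5\<close>, \<open>D = b6 + i b7\<close> the hypotheses read
  \<open>A\<^sup>2 = - i B C\<close>, \<open>B\<^sup>2 = - i A D\<close>, \<open>A cnj C - cnj B D = 2 i cnj A B\<close>, \<open>A B = - C D\<close> and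
  \<open>\<bar>A\<bar>\<^sup>2 + \<bar>C\<bar>\<^sup>2 = \<bar>B\<bar>\<^sup>2 + \<bar>D\<bar>\<^sup>2\<close>. Multiplying the third one by \<open>A cnj B\<close> gives \<open>(\<bar>A\<bar>\<^sup>2 + \<bar>B\<bar>\<^sup>2)\<^sup>2 = 0\<close>.\<close>

lemma moment_zero:
  assumes r1: "a4 * a4 - a5 * a5 - (a6 * b5 + a7 * b4) = 0" and r2: "2 * a4 * a5 + (a6 * b4 - a7 * b5) = 0"
    and r3: "a6 * a6 - a7 * a7 - (a4 * b7 + a5 * b6) = 0" and r4: "2 * a6 * a7 + (a4 * b6 - a5 * b7) = 0"
    and r5: "a4 * b4 + a5 * b5 - a6 * b6 - a7 * b7 + 2 * (a4 * a7 - a5 * a6) = 0"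
    and r6: "a5 * b4 - a4 * b5 + a7 * b6 - a6 * b7 - 2 * (a4 * a6 + a5 * a7) = 0"
    and r7: "a4 * a6 - a5 * a7 + b4 * b6 - b5 * b7 = 0" and r8: "a4 * a7 + a5 * a6 + b4 * b7 + b5 * b6 = 0"
    and r9: "- a4 * a4 - a5 * a5 + a6 * a6 + a7 * a7 - b4 * b4 - b5 * b5 + b6 * b6 + b7 * b7 = (0 :: real)"
  shows "a4 = 0 \<and> a5 = 0 \<and> a6 = 0 \<and> a7 = 0 \<and> b4 = 0 \<and> b5 = 0 \<and> b6 = 0 \<and> b7 = 0"
proof -
  have "((a4 * a4 + a5 * a5) + (a6 * a6 + a7 * a7))\<^sup>2 =
      - (a5 * b4 - a4 * b5 + a7 * b6 - a6 * b7 - 2 * (a4 * a6 + a5 * a7)) * (a4 * a6 + a5 * a7)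
      - (a4 * b4 + a5 * b5 - a6 * b6 - a7 * b7 + 2 * (a4 * a7 - a5 * a6)) * (a5 * a6 - a4 * a7)
      + (a4 * a4 - a5 * a5) * (a4 * a4 - a5 * a5 - (a6 * b5 + a7 * b4))
      + (2 * a4 * a5) * (2 * a4 * a5 + (a6 * b4 - a7 * b5))
      + (a6 * a6 - a7 * a7) * (a6 * a6 - a7 * a7 - (a4 * b7 + a5 * b6))
      + (2 * a6 * a7) * (2 * a6 * a7 + (a4 * b6 - a5 * b7))"
    by (simp add: algebra_simps power2_eq_square)
  then have "(a4 * a4 + a5 * a5) + (a6 * a6 + a7 * a7) = 0"
    unfolding r1 r2 r3 r4 r5 r6 by simp
  then have a: "a4 = 0" "a5 = 0" "a6 = 0" "a7 = 0"
    by (simp_all add: add_nonneg_eq_0_iff sum_squares_eq_zero_iff)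
  have "(b4 * b4 + b5 * b5) * (b6 * b6 + b7 * b7) = (b4 * b6 - b5 * b7)\<^sup>2 + (b4 * b7 + b5 * b6)\<^sup>2"
    by (simp add: algebra_simps power2_eq_square)
  moreover have "b4 * b4 + b5 * b5 = b6 * b6 + b7 * b7"
    using r9 by (simp add: a)
  ultimately have "b4 * b4 + b5 * b5 = 0" "b6 * b6 + b7 * b7 = 0"
    using r7 r8 by (auto simp: a)
  then show ?thesis using a by (simp add: sum_squares_eq_zero_iff)
qed

lemma short_wall_case:
  assumes Y: "ka u1 u2 u3 v1 v2 v3 + pa a4 a5 a6 a7 b4 b5 b6 b7 \<in> L" (is "?Y \<in> L")
    and x: "x = 0" and y: "y \<noteq> 0"
  shows "contains_torus L \<or> resonant (torus x y) ?Y"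
proof -
  let ?p = "pa a4 a5 a6 a7 b4 b5 b6 b7"
  let ?ps = "[(0, ka u1 u2 u3 v1 0 0), (4 * y\<^sup>2, ka 0 0 0 0 v2 v3), (y\<^sup>2, ?p)]"
  have sum: "sum_list (map snd ?ps) = ?Y"
    by (simp add: ka_add pa_add algebra_simps)
  have d: "distinct (map fst ?ps)"
    using y by simp
  have e: "lie_bracket (torus x y) (lie_bracket (torus x y) X) = - (m *\<^sub>R X)" if "(m, X) \<in> set ?ps" for m X
    using that by (auto simp: ad_sq_torus ka_scale pa_scale ka_0 x power2_eq_square)
  have in_L: "X \<in> L" if "(m, X) \<in> set ?ps" for m X
    by (rule components[OF e d _ that]) (simp_all only: sum Y)
  have Y0: "ka u1 u2 u3 v1 0 0 \<in> L" and Y2: "ka 0 0 0 0 v2 v3 \<in> L" and Y1: "?p \<in> L"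
    by (rule in_L, force)+
  note torus = torus_from_x[OF sub Z[unfolded x] y]
  \<comment> \<open>\<open>Z\<close>, the \<open>v\<close>-component of \<open>Y\<close> and the
    bracket of the two span the whole second \<open>su(2)\<close>. Hence \<open>[P, [N, P]]\<close>
    is in \<open>L\<close> for \<open>P = ?p\<close> and every \<open>N\<close> of that
    \<open>su(2)\<close>, and its \<open>y\<close>-part can be subtracted, leaving a pure
    \<open>x\<close>-part that must vanish when \<open>L\<close> contains no torus.\<close>
  have both: "contains_torus L" if v: "v2 \<noteq> 0 \<or> v3 \<noteq> 0"
    and p: "\<not> (a4 = 0 \<and> a5 = 0 \<and> a6 = 0 \<and> a7 = 0 \<and> b4 = 0 \<and> b5 = 0 \<and> b6 = 0 \<and> b7 = 0)"
  proof -
    have "lie_bracket (torus x y) (ka 0 0 0 0 v2 v3) \<in> L"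
      by (intro bracket Z Y2)
    then have Y2': "ka 0 0 0 0 (- 2 * y * v3) (2 * y * v2) \<in> L"
      by (simp add: bracket_torus x)
    have su2: "ka 0 0 0 n1 n2 n3 \<in> L" for n1 n2 n3
    proof -
      let ?N = "v2 * v2 + v3 * v3"
      have N: "?N \<noteq> 0" using v by (rule sumsq_pos)
      have "ka 0 0 0 n1 n2 n3 = (n1 / y) *\<^sub>R torus x y + ((n2 * v2 + n3 * v3) / ?N) *\<^sub>R ka 0 0 0 0 v2 v3
        + ((n3 * v2 - n2 * v3) / (2 * y * ?N)) *\<^sub>R ka 0 0 0 0 (- 2 * y * v3) (2 * y * v2)"
        using y N by (simp add: ka_scale ka_add ka_eq_iff x divide_simps) (use v in \<open>auto simp: algebra_simps\<close>)
      then show ?thesis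
        using Z Y2 Y2' sub by (simp add: subspace_add subspace_scale)
    qed
    have X: "contains_torus L" if "lie_bracket ?p (lie_bracket (ka 0 0 0 n1 n2 n3) ?p) = ka X1 X2 X3 w1 w2 w3"
      "\<not> (X1 = 0 \<and> X2 = 0 \<and> X3 = 0)" for n1 n2 n3 X1 X2 X3 w1 w2 w3
    proof (rule torus)
      have "ka X1 X2 X3 w1 w2 w3 \<in> L"
        unfolding that(1)[symmetric] by (intro bracket Y1 su2)
      then have "ka X1 X2 X3 w1 w2 w3 - ka 0 0 0 w1 w2 w3 \<in> L"
        by (intro subspace_diff sub su2)
      then show "ka X1 X2 X3 0 0 0 \<in> L" by (simp add: ka_diff)
    qed (rule that(2))
    show ?thesis
    proof (rule ccontr)
      assume c: "\<not> contains_torus L"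
      note X' = X[unfolded bracket_ka_pa bracket_pa_pa, OF refl]
      \<comment> \<open>The three unit vectors \<open>N\<close> contribute three coordinates each:
        nine equations, which up to linear combination are the hypotheses of
        \<open>moment_zero\<close>.\<close>
      have E1: "- a4 * a4 - a5 * a5 + a6 * a6 + a7 * a7 - b4 * b4 - b5 * b5 + b6 * b6 + b7 * b7 = 0 \<and>
          4 * a4 * a7 + 2 * a4 * b4 - 4 * a5 * a6 + 2 * a5 * b5 - 2 * a6 * b6 - 2 * a7 * b7 = 0 \<and>
          - 4 * a4 * a6 - 2 * a4 * b5 - 4 * a5 * a7 + 2 * a5 * b4 - 2 * a6 * b7 + 2 * a7 * b6 = 0"
        by (rule ccontr, rule notE[OF c], rule X'[of 1 0 0], erule contrapos_nn) (simp add: algebra_simps)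
      have E2: "- 2 * a4 * a7 - 2 * a5 * a6 - 2 * b4 * b7 - 2 * b5 * b6 = 0 \<and>
          - 2 * a4 * a4 + 2 * a4 * b7 + 2 * a5 * a5 + 2 * a5 * b6 - 2 * a6 * a6 + 2 * a6 * b5 + 2 * a7 * a7 + 2 * a7 * b4 = 0 \<and>
          4 * a4 * a5 - 2 * a4 * b6 + 2 * a5 * b7 - 4 * a6 * a7 + 2 * a6 * b4 - 2 * a7 * b5 = 0"
        by (rule ccontr, rule notE[OF c], rule X'[of 0 0 1], erule contrapos_nn) (simp add: algebra_simps)
      have E3: "2 * a4 * a6 - 2 * a5 * a7 + 2 * b4 * b6 - 2 * b5 * b7 = 0 \<and>
          - 4 * a4 * a5 - 2 * a4 * b6 + 2 * a5 * b7 - 4 * a6 * a7 - 2 * a6 * b4 + 2 * a7 * b5 = 0 \<and>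
          - 2 * a4 * a4 - 2 * a4 * b7 + 2 * a5 * a5 - 2 * a5 * b6 + 2 * a6 * a6 + 2 * a6 * b5 - 2 * a7 * a7 + 2 * a7 * b4 = 0"
        by (rule ccontr, rule notE[OF c], rule X'[of 0 1 0], erule contrapos_nn) (simp add: algebra_simps)
      have "a4 = 0 \<and> a5 = 0 \<and> a6 = 0 \<and> a7 = 0 \<and> b4 = 0 \<and> b5 = 0 \<and> b6 = 0 \<and> b7 = 0"
      proof (rule moment_zero)
        show "a4 * a4 - a5 * a5 - (a6 * b5 + a7 * b4) = 0" using E1 E2 E3 by argo
        show "2 * a4 * a5 + (a6 * b4 - a7 * b5) = 0" using E1 E2 E3 by argo
        show "a6 * a6 - a7 * a7 - (a4 * b7 + a5 * b6) = 0" using E1 E2 E3 by argo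
        show "2 * a6 * a7 + (a4 * b6 - a5 * b7) = 0" using E1 E2 E3 by argo
        show "a4 * b4 + a5 * b5 - a6 * b6 - a7 * b7 + 2 * (a4 * a7 - a5 * a6) = 0" using E1 E2 E3 by argo
        show "a5 * b4 - a4 * b5 + a7 * b6 - a6 * b7 - 2 * (a4 * a6 + a5 * a7) = 0" using E1 E2 E3 by argo
        show "a4 * a6 - a5 * a7 + b4 * b6 - b5 * b7 = 0" using E1 E2 E3 by argo
        show "a4 * a7 + a5 * a6 + b4 * b7 + b5 * b6 = 0" using E1 E2 E3 by argo
        show "- a4 * a4 - a5 * a5 + a6 * a6 + a7 * a7 - b4 * b4 - b5 * b5 + b6 * b6 + b7 * b7 = 0" using E1 E2 E3 by argo
      qed
      with p show False by simp
    qed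
  qed
  show ?thesis
  proof (cases "u1 = 0 \<and> u2 = 0 \<and> u3 = 0")
    case False
    then show ?thesis using torus Y0 by blast
  next
    case u: True
    show ?thesis
    proof (cases "v2 = 0 \<and> v3 = 0")
      case True
      with u have "lie_bracket (torus x y) (lie_bracket (torus x y) ?Y) = (y * v1) *\<^sub>R torus x y - (y\<^sup>2) *\<^sub>R ?Y"
        by (simp add: lie_bracket_add_right ad_sq_torus ka_0 ka_scale pa_scale x power2_eq_square scaleR_add_right
            mult_ac)
      then show ?thesis unfolding resonant_def by blast
    next
      case v: False
      show ?thesis
      proof (cases "a4 = 0 \<and> a5 = 0 \<and> a6 = 0 \<and> a7 = 0 \<and> b4 = 0 \<and> b5 = 0 \<and> b6 = 0 \<and> b7 = 0")
        case True
        with u have "lie_bracket (torus x y) (lie_bracket (torus x y) ?Y) = (4 * y * v1) *\<^sub>R torus x y - (4 * y\<^sup>2) *\<^sub>R ?Y"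
          by (simp add: pa_0 ad_sq_torus ka_0 ka_scale ka_diff ka_uminus ka_eq_iff x power2_eq_square)
        then show ?thesis unfolding resonant_def by blast
      next
        case False
        then show ?thesis using both v by blast
      qed
    qed
  qed
qed

end

section \<open>Reduction of the exceptional torus elements by the Weyl group\<close>

definition dichotomy :: "real \<Rightarrow> real \<Rightarrow> bool" where
  "dichotomy x y \<longleftrightarrow> (\<forall>L Y. lie_subalgebra L \<longrightarrow> torus x y \<in> L \<longrightarrow> Y \<in> L \<longrightarrow> Y \<in> g2 \<longrightarrow>
     contains_torus L \<or> resonant (torus x y) Y)"

lemma dichotomyI:
  assumes "\<And>L u1 u2 u3 v1 v2 v3 a4 a5 a6 a7 b4 b5 b6 b7. lie_subalgebra L \<Longrightarrow> torus x y \<in> L \<Longrightarrow>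
      ka u1 u2 u3 v1 v2 v3 + pa a4 a5 a6 a7 b4 b5 b6 b7 \<in> L \<Longrightarrow>
      contains_torus L \<or> resonant (torus x y) (ka u1 u2 u3 v1 v2 v3 + pa a4 a5 a6 a7 b4 b5 b6 b7)"
  shows "dichotomy x y"
  unfolding dichotomy_def
proof (intro allI impI)
  fix L Y assume L: "lie_subalgebra L" "torus x y \<in> L" "Y \<in> L" "Y \<in> g2"
  obtain u1 u2 u3 v1 v2 v3 a4 a5 a6 a7 b4 b5 b6 b7
    where "Y = ka u1 u2 u3 v1 v2 v3 + pa a4 a5 a6 a7 b4 b5 b6 b7"
    using g2_coords[OF L(4)] by blast
  then show "contains_torus L \<or> resonant (torus x y) Y"
    using assms L by blast
qed

text \<open>Because \<open>dichotomy\<close> ranges over all \<open>L\<close> and \<open>Y\<close>,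
  it is a property of the torus element alone and can be transported by any automorphism that maps
  the torus element to another one.\<close>

lemma dichotomy_Ad:
  assumes g: "g \<in> G2" and eq: "Ad g (torus x y) = torus x' y'" and "dichotomy x' y'"
  shows "dichotomy x y"
  unfolding dichotomy_def
proof (intro allI impI)
  fix L Y assume L: "lie_subalgebra L" "torus x y \<in> L" "Y \<in> L" "Y \<in> g2"
  have "contains_torus (Ad g ` L) \<or> resonant (torus x' y') (Ad g Y)"
    using assms(3)[unfolded dichotomy_def, rule_format, of "Ad g ` L" "Ad g Y"] L g eq
    by (metis Ad_g2 imageI lie_subalgebra_Ad)
  then show "contains_torus L \<or> resonant (torus x y) Y"
    using contains_torus_Ad[OF g] resonant_Ad[OF g] eq by metis
qed

lemma dichotomy_cyc: "dichotomy (- (x + y) / 2) ((3 * x - y) / 2) \<Longrightarrow> dichotomy x y"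
  by (rule dichotomy_Ad[OF cyc_G2 Ad_cyc])

lemma dichotomy_flip: "dichotomy x (- y) \<Longrightarrow> dichotomy x y"
  by (rule dichotomy_Ad[OF U3_G2[of 0 1]]) (simp_all add: Ad_U3)

lemma dichotomy_zero: "dichotomy 0 0"
proof -
  have "resonant 0 Y" for Y
    unfolding resonant_def by (intro exI[of _ 0]) (simp add: lie_bracket_def)
  then show ?thesis by (simp add: dichotomy_def ka_0)
qed

lemma dichotomy_principal: "dichotomy x (2 * x)"
proof (cases "x = 0")
  case False
  then show ?thesis
    by (intro dichotomyI subalgebra_with_torus_element.principal_case)
      (simp_all add: subalgebra_with_torus_element_def)
qed (simp add: dichotomy_zero)

lemma dichotomy_long_wall: "dichotomy x 0"
proof (cases "x = 0")
  case False
  then show ?thesis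
    by (intro dichotomyI subalgebra_with_torus_element.long_wall_case)
      (simp_all add: subalgebra_with_torus_element_def)
qed (simp add: dichotomy_zero)

lemma dichotomy_short_wall: "dichotomy 0 y"
proof (cases "y = 0")
  case False
  then show ?thesis
    by (intro dichotomyI subalgebra_with_torus_element.short_wall_case)
      (simp_all add: subalgebra_with_torus_element_def)
qed (simp add: dichotomy_zero)

text \<open>The twelve exceptional lines form three orbits under \<open>cyc\<close> and the sign
  change of \<open>y\<close>: the long walls \<open>y = 0\<close>,
  \<open>y = \<plusminus> 3 x\<close>; the short walls \<open>x = 0\<close>,
  \<open>y = \<plusminus> x\<close>; and the principal lines \<open>y = \<plusminus> 2 x\<close>,
  \<open>y = \<plusminus> 5 x\<close>, \<open>x = \<plusminus> 3 y\<close>.\<close>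

lemma dichotomy_always: "dichotomy x y"
proof -
  have P5: "dichotomy x (- 5 * x)" for x
    by (rule dichotomy_cyc) (use dichotomy_principal[of "2 * x"] in simp)
  have P3: "dichotomy (- 3 * y) y" for y
    by (rule dichotomy_cyc) (use P5[of y] in simp)
  have I1: "dichotomy x (3 * x)" for x
    by (rule dichotomy_cyc) (use dichotomy_long_wall[of "- 2 * x"] in simp)
  have I2: "dichotomy x (- 3 * x)" for x
    by (rule dichotomy_cyc) (use I1[of x] in simp)
  have II1: "dichotomy x (- x)" for x
    by (rule dichotomy_cyc) (use dichotomy_short_wall[of "2 * x"] in simp)
  have II2: "dichotomy x x" for x
    by (rule dichotomy_flip) (rule II1)
  have P': "dichotomy x (- 2 * x)" "dichotomy x (5 * x)" "dichotomy (3 * x) x" for x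
    by (rule dichotomy_flip, use dichotomy_principal[of x] P5[of x] P3[of "- x"] in simp)+
  show ?thesis
  proof (cases "x = 0 \<or> y = 0 \<or> y = x \<or> y = - x \<or> y = 3 * x \<or> y = - 3 * x \<or> y = 2 * x \<or> y = - 2 * x \<or>
      y = 5 * x \<or> y = - 5 * x \<or> x = 3 * y \<or> x = - 3 * y")
    case True
    then show ?thesis
      using dichotomy_long_wall[of x] dichotomy_short_wall[of y] dichotomy_principal[of x] P5[of x] P3[of y] I1[of x] I2[of x] II1[of x] II2[of x]
        P'(1,2)[of x] P'(3)[of y] by (elim disjE) (simp_all only:)
  next
    case False
    have nz: "x \<noteq> 0" "y \<noteq> 0" "x - y \<noteq> 0" "x + y \<noteq> 0" "3 * x - y \<noteq> 0" "3 * x + y \<noteq> 0"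
      "2 * x - y \<noteq> 0" "2 * x + y \<noteq> 0" "5 * x - y \<noteq> 0" "5 * x + y \<noteq> 0" "x - 3 * y \<noteq> 0" "x + 3 * y \<noteq> 0"
      by (rule notI, rule notE[OF False], simp add: eq_neg_iff_add_eq_0 add.commute)+
    show ?thesis
      by (intro dichotomyI subalgebra_with_torus_element.regular_case)
        (use nz in \<open>simp_all add: subalgebra_with_torus_element_def\<close>)
  qed
qed

text \<open>If \<open>L\<close> contains no torus, then \<open>Z\<close>, \<open>Y\<close> and \<open>[Z, Y]\<close> span a line or a copy of \<open>so(3)\<close>.\<close>

lemma torus_or_resonant:
  assumes L: "lie_subalgebra L" and Z: "Z \<in> kA" "Z \<in> L" and Y: "Y \<in> L" "Y \<in> g2"
  shows "contains_torus L \<or> resonant Z Y"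
proof -
  obtain x1 x2 x3 y1 y2 y3 where eq: "Z = ka x1 x2 x3 y1 y2 y3"
    using Z by (auto simp: kA_iff)
  obtain g x where g: "g \<in> G2" "\<And>y1 y2 y3. Ad g (ka x1 x2 x3 y1 y2 y3) = ka x 0 0 y1 y2 y3"
    by (rule diag_x[of x1 x2 x3]) (rule that)
  obtain h y where h: "h \<in> G2" "\<And>x1 x2 x3. Ad h (ka x1 x2 x3 y1 y2 y3) = ka x1 x2 x3 y 0 0"
    by (rule diag_y[of y1 y2 y3]) (rule that)
  have hg: "h ** g \<in> G2" using h(1) g(1) by (rule G2_mult)
  have "Ad (h ** g) Z = torus x y"
    using g h by (simp add: Ad_mult eq)
  then have "contains_torus (Ad (h ** g) ` L) \<or> resonant (Ad (h ** g) Z) (Ad (h ** g) Y)"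
    using dichotomy_always[of x y, unfolded dichotomy_def, rule_format, of "Ad (h ** g) ` L" "Ad (h ** g) Y"]
      lie_subalgebra_Ad[OF hg L] Ad_g2[OF hg Y(2)] Z Y by (metis imageI)
  then show ?thesis
    using contains_torus_Ad[OF hg] resonant_Ad[OF hg] by blast
qed

section \<open>Subalgebras containing a torus\<close>

lemma Ad_cyc_pa:
  "Ad cyc (pa 0 0 p q r s 0 0) = ka 0 q p 0 r (- s)"
  "Ad cyc (pa p q 0 0 0 0 r s) = pa 0 0 p (- q) (- r) (- s) 0 0"
  by (rule Ad_eqI[OF cyc_G2], simp add: vec8_eq_iff matrix_mult_nth_8 cyc_def ka_def pa_def)+

locale subalgebra_with_torus =
  fixes L
  assumes L: "lie_subalgebra L" and torus: "torus x y \<in> L" and L_g2: "L \<subseteq> g2"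
begin

text \<open>A sample regular element: the roots take the values 2, 8, -3, 5, -1, 7 at it, whose
  squares are nonzero and distinct.\<close>

sublocale subalgebra_with_torus_element L 1 4
  using L torus by unfold_locales

definition "sa \<longleftrightarrow> (\<forall>p q. ka 0 p q 0 0 0 \<in> L)"
definition "la \<longleftrightarrow> (\<forall>p q. ka 0 0 0 0 p q \<in> L)"
definition "sb \<longleftrightarrow> (\<forall>p q. pa p q 0 0 0 0 0 0 \<in> L)"
definition "sc \<longleftrightarrow> (\<forall>p q. pa 0 0 p q 0 0 0 0 \<in> L)"
definition "lc \<longleftrightarrow> (\<forall>p q. pa 0 0 0 0 p q 0 0 \<in> L)"
definition "lb \<longleftrightarrow> (\<forall>p q. pa 0 0 0 0 0 0 p q \<in> L)"

text \<open>The bracket with the regular element is a quarter turn of the root plane times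
  \<open>k\<close>, so one nonzero vector and its image span the plane.\<close>

lemma plane:
  assumes "F p q \<in> L" "lie_bracket (torus 1 4) (F p q) = F (- k * q) (k * p)" "k \<noteq> 0" "p \<noteq> 0 \<or> q \<noteq> 0"
    "\<And>r s. r *\<^sub>R F p q + s *\<^sub>R F (- k * q) (k * p) = F (r * p - s * k * q) (r * q + s * k * p)"
  shows "F u v \<in> L"
proof -
  have "F (- k * q) (k * p) \<in> L"
    using bracket[OF torus[of 1 4] assms(1)] unfolding assms(2) .
  then have *: "F (r * p - s * k * q) (r * q + s * k * p) \<in> L" for r s
    unfolding assms(5)[symmetric] using assms(1) sub by (simp add: subspace_add subspace_scale)
  let ?n = "p * p + q * q"
  have n: "?n \<noteq> 0" using assms(4) by (rule sumsq_pos)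
  have "(u * p + v * q) / ?n * p - ((v * p - u * q) / (k * ?n)) * k * q = u"
    "(u * p + v * q) / ?n * q + ((v * p - u * q) / (k * ?n)) * k * p = v"
    using n assms(3) by (auto simp: divide_simps) (simp_all add: algebra_simps)
  then show ?thesis using *[of "(u * p + v * q) / ?n" "(v * p - u * q) / (k * ?n)"] by simp
qed

lemma planes:
  assumes "ka u1 u2 u3 v1 v2 v3 + pa a4 a5 a6 a7 b4 b5 b6 b7 \<in> L" (is "?Y \<in> L")
  shows "u2 \<noteq> 0 \<or> u3 \<noteq> 0 \<Longrightarrow> sa" "v2 \<noteq> 0 \<or> v3 \<noteq> 0 \<Longrightarrow> la" "a4 \<noteq> 0 \<or> a5 \<noteq> 0 \<Longrightarrow> sb"
    "a6 \<noteq> 0 \<or> a7 \<noteq> 0 \<Longrightarrow> sc" "b4 \<noteq> 0 \<or> b5 \<noteq> 0 \<Longrightarrow> lc" "b6 \<noteq> 0 \<or> b7 \<noteq> 0 \<Longrightarrow> lb"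
proof -
  let ?ps = "[(0 :: real, ka u1 0 0 v1 0 0), (4, ka 0 u2 u3 0 0 0), (64, ka 0 0 0 0 v2 v3),
    (9, pa a4 a5 0 0 0 0 0 0), (25, pa 0 0 a6 a7 0 0 0 0),
    (1, pa 0 0 0 0 b4 b5 0 0), (49, pa 0 0 0 0 0 0 b6 b7)]"
  have sum: "sum_list (map snd ?ps) = ?Y"
    by (simp add: ka_add pa_add algebra_simps)
  have d: "distinct (map fst ?ps)"
    by simp
  have e: "lie_bracket (torus 1 4) (lie_bracket (torus 1 4) X) = - (m *\<^sub>R X)" if "(m, X) \<in> set ?ps" for m X
    using that by (auto simp: ad_sq_torus ka_scale pa_scale ka_0)
  have in_L: "X \<in> L" if "(m, X) \<in> set ?ps" for m X
    by (rule components[OF e d _ that]) (simp_all only: sum assms)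
  note s = bracket_torus ka_scale pa_scale ka_add pa_add ka_eq_iff pa_eq_iff
  show sa if "u2 \<noteq> 0 \<or> u3 \<noteq> 0"
    unfolding sa_def
    by (intro allI, rule plane[of "\<lambda>p q. ka 0 p q 0 0 0" u2 u3 2])
      (use that in_L[of 4] in \<open>auto simp: s\<close>)
  show la if "v2 \<noteq> 0 \<or> v3 \<noteq> 0"
    unfolding la_def
    by (intro allI, rule plane[of "\<lambda>p q. ka 0 0 0 0 p q" v2 v3 8])
      (use that in_L[of 64] in \<open>auto simp: s\<close>)
  show sb if "a4 \<noteq> 0 \<or> a5 \<noteq> 0"
    unfolding sb_def
    by (intro allI, rule plane[of "\<lambda>p q. pa p q 0 0 0 0 0 0" a4 a5 3])
      (use that in_L[of 9] in \<open>auto simp: s\<close>)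
  show sc if "a6 \<noteq> 0 \<or> a7 \<noteq> 0"
    unfolding sc_def
    by (intro allI, rule plane[of "\<lambda>p q. pa 0 0 p q 0 0 0 0" a6 a7 5])
      (use that in_L[of 25] in \<open>auto simp: s\<close>)
  show lc if "b4 \<noteq> 0 \<or> b5 \<noteq> 0"
    unfolding lc_def
    by (intro allI, rule plane[of "\<lambda>p q. pa 0 0 0 0 p q 0 0" b4 b5 1])
      (use that in_L[of 1] in \<open>auto simp: s\<close>)
  show lb if "b6 \<noteq> 0 \<or> b7 \<noteq> 0"
    unfolding lb_def
    by (intro allI, rule plane[of "\<lambda>p q. pa 0 0 0 0 0 0 p q" b6 b7 7])
      (use that in_L[of 49] in \<open>auto simp: s\<close>)
qed

text \<open>The bracket of two root planes has nonzero components in the planes of the sum and the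
  difference of the roots, whenever these are roots. One pair of unit vectors detects this.\<close>

lemma closure:
  "sa \<Longrightarrow> sb \<Longrightarrow> sc \<and> lc" "sa \<Longrightarrow> sc \<Longrightarrow> sb \<and> lb" "sb \<Longrightarrow> sc \<Longrightarrow> sa \<and> la"
  "sa \<Longrightarrow> lc \<Longrightarrow> sb" "sa \<Longrightarrow> lb \<Longrightarrow> sc" "sb \<Longrightarrow> la \<Longrightarrow> sc" "sb \<Longrightarrow> lc \<Longrightarrow> sa" "sc \<Longrightarrow> la \<Longrightarrow> sb" "sc \<Longrightarrow> lb \<Longrightarrow> sa"
proof -
  have KP: "u2 \<noteq> 0 \<or> u3 \<noteq> 0 \<Longrightarrow> sa" "v2 \<noteq> 0 \<or> v3 \<noteq> 0 \<Longrightarrow> la"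
    if "lie_bracket X Y = ka u1 u2 u3 v1 v2 v3" "X \<in> L" "Y \<in> L" for X Y u1 u2 u3 v1 v2 v3
    using planes(1,2)[of u1 u2 u3 v1 v2 v3 0 0 0 0 0 0 0 0] bracket[OF that(2,3)] that(1) by (auto simp: pa_0)
  have PP: "a4 \<noteq> 0 \<or> a5 \<noteq> 0 \<Longrightarrow> sb" "a6 \<noteq> 0 \<or> a7 \<noteq> 0 \<Longrightarrow> sc" "b4 \<noteq> 0 \<or> b5 \<noteq> 0 \<Longrightarrow> lc" "b6 \<noteq> 0 \<or> b7 \<noteq> 0 \<Longrightarrow> lb"
    if "lie_bracket X Y = pa a4 a5 a6 a7 b4 b5 b6 b7" "X \<in> L" "Y \<in> L" for X Y a4 a5 a6 a7 b4 b5 b6 b7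
    using planes(3-)[of 0 0 0 0 0 0 a4 a5 a6 a7 b4 b5 b6 b7] bracket[OF that(2,3)] that(1) by (auto simp: ka_0)
  note d = sa_def la_def sb_def sc_def lc_def lb_def
  note k = bracket_ka_pa and p = bracket_pa_pa
  let ?sa = "ka 0 1 0 0 0 0" and ?la = "ka 0 0 0 0 1 0" and ?sb = "pa 1 0 0 0 0 0 0 0" and ?sc = "pa 0 0 1 0 0 0 0 0"
    and ?lc = "pa 0 0 0 0 1 0 0 0" and ?lb = "pa 0 0 0 0 0 0 1 0"
  have m: "sa \<Longrightarrow> ?sa \<in> L" "la \<Longrightarrow> ?la \<in> L" "sb \<Longrightarrow> ?sb \<in> L" "sc \<Longrightarrow> ?sc \<in> L" "lc \<Longrightarrow> ?lc \<in> L" "lb \<Longrightarrow> ?lb \<in> L"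
    by (auto simp: d)
  show "sc \<and> lc" if sa sb
    using PP(2,3)[OF k m(1)[OF that(1)] m(3)[OF that(2)]] by simp
  show "sb \<and> lb" if sa sc
    using PP(1,4)[OF k m(1)[OF that(1)] m(4)[OF that(2)]] by simp
  show "sa \<and> la" if sb sc
    using KP[OF p m(3)[OF that(1)] m(4)[OF that(2)]] by simp
  show sb if sa lc
    using PP(1)[OF k m(1)[OF that(1)] m(5)[OF that(2)]] by simp
  show sc if sa lb
    using PP(2)[OF k m(1)[OF that(1)] m(6)[OF that(2)]] by simp
  show sc if sb la
    using PP(2)[OF k m(2)[OF that(2)] m(3)[OF that(1)]] by simp
  show sa if sb lc
    using KP(1)[OF p m(3)[OF that(1)] m(5)[OF that(2)]] by simp
  show sb if sc la
    using PP(1)[OF k m(2)[OF that(2)] m(4)[OF that(1)]] by simp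
  show sa if sc lb
    using KP(1)[OF p m(4)[OF that(1)] m(6)[OF that(2)]] by simp
qed

lemma all_planes: "sa \<Longrightarrow> sb \<Longrightarrow> sc \<Longrightarrow> g2 \<subseteq> L"
proof
  fix X assume *: sa sb sc "X \<in> g2"
  then have l: la lb lc using closure by blast+
  obtain u1 u2 u3 v1 v2 v3 a4 a5 a6 a7 b4 b5 b6 b7
    where X: "X = ka u1 u2 u3 v1 v2 v3 + pa a4 a5 a6 a7 b4 b5 b6 b7"
    using g2_coords[OF *(4)] by blast
  also have "\<dots> = torus u1 v1 + ka 0 u2 u3 0 0 0 + ka 0 0 0 0 v2 v3 + pa a4 a5 0 0 0 0 0 0 + pa 0 0 a6 a7 0 0 0 0
    + pa 0 0 0 0 b4 b5 0 0 + pa 0 0 0 0 0 0 b6 b7"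
    by (simp add: ka_add pa_add add.assoc)
  also have "\<dots> \<in> L"
    using * l unfolding sa_def sb_def sc_def la_def lb_def lc_def
    by (intro subspace_add[OF sub] torus) auto
  finally show "X \<in> L" .
qed

text \<open>Two short planes force the third and hence all of \<open>g2\<close>, so a proper
  \<open>L\<close> has at most one. With none, \<open>L\<close> lies in the \<open>su(3)\<close>
  that kills \<open>oe 1\<close>. With one, only the long plane orthogonal to it can be present, and
  a power of \<open>cyc\<close> carries the resulting \<open>so(4)\<close> to
  \<open>kA\<close>.\<close>

lemma reducible:
  assumes "L \<noteq> g2"
  shows "(\<forall>X\<in>L. X *v oe 1 = 0) \<or> L \<subseteq> kA \<or> (\<forall>X\<in>L. Ad cyc X \<in> kA) \<or> (\<forall>X\<in>L. Ad cyc (Ad cyc X) \<in> kA)"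
proof -
  have not3: "\<not> (sa \<and> sb \<and> sc)"
    using all_planes assms L_g2 by blast
  have coords: thesis if XL: "X \<in> L" and C: "\<And>u1 u2 u3 v1 v2 v3 a4 a5 a6 a7 b4 b5 b6 b7.
      X = ka u1 u2 u3 v1 v2 v3 + pa a4 a5 a6 a7 b4 b5 b6 b7 \<Longrightarrow> \<not> sa \<longrightarrow> u2 = 0 \<and> u3 = 0 \<Longrightarrow> \<not> la \<longrightarrow> v2 = 0 \<and> v3 = 0 \<Longrightarrow>
      \<not> sb \<longrightarrow> a4 = 0 \<and> a5 = 0 \<Longrightarrow> \<not> sc \<longrightarrow> a6 = 0 \<and> a7 = 0 \<Longrightarrow> \<not> lc \<longrightarrow> b4 = 0 \<and> b5 = 0 \<Longrightarrow> \<not> lb \<longrightarrow> b6 = 0 \<and> b7 = 0 \<Longrightarrow> thesis"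
    for X thesis
  proof -
    obtain u1 u2 u3 v1 v2 v3 a4 a5 a6 a7 b4 b5 b6 b7
      where X: "X = ka u1 u2 u3 v1 v2 v3 + pa a4 a5 a6 a7 b4 b5 b6 b7"
      by (rule g2_coords[OF subsetD[OF L_g2 XL]])
    show thesis
      by (rule C[OF X]) (use planes[OF XL[unfolded X]] in blast)+
  qed
  consider "\<not> sa" "\<not> sb" "\<not> sc" | sa "\<not> sb" "\<not> sc" "\<not> lb" "\<not> lc" | sb "\<not> sa" "\<not> sc" "\<not> la" "\<not> lc" | sc "\<not> sa" "\<not> sb" "\<not> la" "\<not> lb"
    using not3 closure by blast
  then show ?thesis
  proof cases
    case 1
    have "X *v oe 1 = 0" if "X \<in> L" for X
      by (rule coords[OF that]) (use 1 in \<open>auto simp: vec8_eq_iff mult_oe_nth ka_def pa_def\<close>)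
    then show ?thesis by blast
  next
    case 2
    have "X \<in> kA" if "X \<in> L" for X
      by (rule coords[OF that]) (use 2 in \<open>auto simp: pa_0\<close>)
    then show ?thesis by blast
  next
    case 3
    have "Ad cyc (Ad cyc X) \<in> kA" if "X \<in> L" for X
      by (rule coords[OF that]) (use 3 in \<open>auto simp: Ad_add Ad_cyc Ad_cyc_pa ka_add\<close>)
    then show ?thesis by blast
  next
    case 4
    have "Ad cyc X \<in> kA" if "X \<in> L" for X
      by (rule coords[OF that]) (use 4 in \<open>auto simp: Ad_add Ad_cyc Ad_cyc_pa ka_add\<close>)
    then show ?thesis by blast
  qed
qed

end

lemma contains_torus_reducible:
  assumes hyps: "lie_subalgebra L" "L \<subseteq> g2" "L \<noteq> g2" and t: "contains_torus L"
  obtains g where "g \<in> G2" "\<forall>X\<in>L. X *v (g *v oe 1) = 0"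
    | g where "g \<in> G2" "\<forall>X\<in>L. Ad (matrix_inv g) X \<in> kA"
proof -
  obtain g where g: "g \<in> G2" "\<And>x y. Ad g (torus x y) \<in> L"
    using t by (auto simp: contains_torus_def)
  let ?h = "matrix_inv g"
  have h: "?h \<in> G2" using g by (simp add: G2_inv)
  have mem: "X \<in> L \<Longrightarrow> Ad ?h X \<in> Ad ?h ` L" for X by simp
  interpret subalgebra_with_torus "Ad ?h ` L"
  proof
    show "lie_subalgebra (Ad ?h ` L)"
      by (rule lie_subalgebra_Ad[OF h hyps(1)])
    show "torus x y \<in> Ad ?h ` L" for x y
      using mem[OF g(2)[of x y]] by (simp add: Ad_inv_left g)
    show "Ad ?h ` L \<subseteq> g2"
      using hyps(2) h by (auto intro: Ad_g2)
  qed
  have "Ad ?h ` L \<noteq> g2"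
  proof
    assume "Ad ?h ` L = g2"
    then have "Ad g ` Ad ?h ` L = g2" by (simp add: Ad_g2_image g)
    then show False using hyps(3) by (simp add: image_image Ad_inv_right g)
  qed
  then consider "\<forall>X\<in>L. Ad ?h X *v oe 1 = 0" | "\<forall>X\<in>L. Ad ?h X \<in> kA" | "\<forall>X\<in>L. Ad cyc (Ad ?h X) \<in> kA"
    | "\<forall>X\<in>L. Ad cyc (Ad cyc (Ad ?h X)) \<in> kA"
    using reducible by blast
  then show thesis
  proof cases
    case 1
    have "X *v (g *v oe 1) = 0" if "X \<in> L" for X
      using Ad_vec[OF g(1), of "Ad ?h X" "oe 1"] 1 that by (simp add: Ad_inv_right g)
    then show thesis using that(1) g(1) by blast
  next
    case 2
    then show thesis using that(2) g(1) by blast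
  next
    case 3
    have "cyc ** ?h \<in> G2" using cyc_G2 h by (rule G2_mult)
    with 3 show thesis
      using that(2)[of "matrix_inv (cyc ** ?h)"] by (simp add: G2_inv matrix_inv_inv Ad_mult cyc_G2 h)
  next
    case 4
    have "cyc ** (cyc ** ?h) \<in> G2" using cyc_G2 h by (intro G2_mult)
    with 4 show thesis
      using that(2)[of "matrix_inv (cyc ** (cyc ** ?h))"]
      by (simp add: G2_inv matrix_inv_inv Ad_mult G2_mult cyc_G2 h)
  qed
qed

section \<open>The four families generate proper subalgebras\<close>

lemma ka_v8: "ka x1 x2 x3 y1 y2 y3 *v v8 v0 v1 v2 v3 v4 v5 v6 v7 = v8 0
    (2 * x2 * v3 - 2 * x3 * v2) (2 * x3 * v1 - 2 * x1 * v3) (2 * x1 * v2 - 2 * x2 * v1)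
    ((x1 - y1) * v5 + (x2 - y2) * v6 + (x3 - y3) * v7) ((y1 - x1) * v4 - (x3 + y3) * v6 + (x2 + y2) * v7)
    ((y2 - x2) * v4 + (x3 + y3) * v5 - (x1 + y1) * v7) ((y3 - x3) * v4 - (x2 + y2) * v5 + (x1 + y1) * v6)"
  by (simp add: vec8_eq_iff mult_v8 inner_8 ka_def algebra_simps)

lemma S_v8: "S *v v8 v0 v1 v2 v3 v4 v5 v6 v7 = v8 v0 v1 v4 v5 v2 v3 (- v6) (- v7)"
  by (simp add: vec8_eq_iff S_coords)

lemma
  fixes a0 :: real
  shows v8_diff: "v8 a0 a1 a2 a3 a4 a5 a6 a7 - v8 b0 b1 b2 b3 b4 b5 b6 b7 =
    v8 (a0 - b0) (a1 - b1) (a2 - b2) (a3 - b3) (a4 - b4) (a5 - b5) (a6 - b6) (a7 - b7)"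
  and v8_add: "v8 a0 a1 a2 a3 a4 a5 a6 a7 + v8 b0 b1 b2 b3 b4 b5 b6 b7 =
    v8 (a0 + b0) (a1 + b1) (a2 + b2) (a3 + b3) (a4 + b4) (a5 + b5) (a6 + b6) (a7 + b7)"
  and v8_scale: "r *\<^sub>R v8 a0 a1 a2 a3 a4 a5 a6 a7 =
    v8 (r * a0) (r * a1) (r * a2) (r * a3) (r * a4) (r * a5) (r * a6) (r * a7)"
  and v8_0: "0 = v8 0 0 0 0 0 0 0 (0 :: real)"
  by (simp_all add: vec8_eq_iff)

lemma Rot_v8: "Rot c s *v v8 v0 v1 v2 v3 v4 v5 v6 v7 = v8 v0 v1 (c * v2 - s * v3) (s * v2 + c * v3)
    (c * v4 - s * v5) (s * v4 + c * v5) ((c * c - s * s) * v6 - 2 * c * s * v7) (2 * c * s * v6 + (c * c - s * s) * v7)"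
  by (simp add: vec8_eq_iff mult_v8 inner_8 Rot_def)

lemma Rot_S: "Rot c s ** S = S ** Rot c s"
proof -
  have "Rot c s *v (S *v v8 v0 v1 v2 v3 v4 v5 v6 v7) = S *v (Rot c s *v v8 v0 v1 v2 v3 v4 v5 v6 v7)"
    for v0 v1 v2 v3 v4 v5 v6 v7
    by (simp add: S_v8 Rot_v8 v8_eq_iff)
  then show ?thesis
    unfolding matrix_eq by (metis v8_eta matrix_vector_mul_assoc)
qed

lemma Rot_inv: "c * c + s * s = 1 \<Longrightarrow> matrix_inv (Rot c s) = Rot c (- s)"
proof (rule matrix_inv_eqI)
  assume u: "c * c + s * s = 1"
  have u': "s * s = 1 - c * c" "s * (s * x) = x - c * (c * x)" for x
    using u by algebra+
  show "Rot c s ** Rot c (- s) = mat 1" "Rot c (- s) ** Rot c s = mat 1"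
    by (simp_all add: vec8_eq_iff matrix_mult_nth_8 Rot_def) (simp_all add: algebra_simps u')
qed

section \<open>The generators \<open>Dij\<close> and the one-parameter group
  \<open>g_theta\<close>\<close>

lemma Dij_ka:
  "Dij 1 2 = ka 0 0 2 0 0 0" "Dij 1 3 = ka 0 (- 2) 0 0 0 0" "Dij 2 3 = ka 2 0 0 0 0 0"
  "Dij 4 5 = ka (- 1) 0 0 3 0 0" "Dij 4 6 = ka 0 (- 1) 0 0 3 0" "Dij 4 7 = ka 0 0 (- 1) 0 0 3"
proof -
  have D: "Dij i j $ k $ l = (ocomm (ocomm (oe i) (oe j)) (oe l) - 3 *\<^sub>R oassoc (oe i) (oe j) (oe l)) $ k" for i j k l
    by (simp add: Dij_def inner_der_def matrix_def oe_def)
  show "Dij 1 2 = ka 0 0 2 0 0 0" "Dij 1 3 = ka 0 (- 2) 0 0 0 0" "Dij 2 3 = ka 2 0 0 0 0 0"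
    "Dij 4 5 = ka (- 1) 0 0 3 0 0" "Dij 4 6 = ka 0 (- 1) 0 0 3 0" "Dij 4 7 = ka 0 0 (- 1) 0 0 3"
    unfolding vec8_eq_iff[of "Dij i j $ k" for i j k] vec8_eq_iff[of "Dij i j" for i j] D ocomm_def oassoc_def
    by (simp_all add: oe_v8 omult_v8 ka_def v8_diff v8_scale)
qed

text \<open>The generator acts on the first two coordinate planes as multiplication by
  \<open>i t\<close> and on the third by \<open>2 i t\<close>, so its powers are read off from
  complex powers. The entry \<open>d\<close> serves the two directions \<open>oe 0\<close>,
  \<open>oe 1\<close> that it kills, where only the zeroth power is nonzero.\<close>

definition torus_power :: "real \<Rightarrow> nat \<Rightarrow> real^8^8" where
  "torus_power t n = (let c = Re ((\<i> * t) ^ n); s = Im ((\<i> * t) ^ n);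
      C = Re ((\<i> * (2 * t)) ^ n); S = Im ((\<i> * (2 * t)) ^ n); d = (if n = 0 then 1 else 0) in
    v8 (v8 d 0 0 0 0 0 0 0) (v8 0 d 0 0 0 0 0 0) (v8 0 0 c (-s) 0 0 0 0) (v8 0 0 s c 0 0 0 0)
      (v8 0 0 0 0 c (-s) 0 0) (v8 0 0 0 0 s c 0 0) (v8 0 0 0 0 0 0 C (-S)) (v8 0 0 0 0 0 0 S C))"

lemma torus_power_eq: "((**) (ka (t / 2) 0 0 (3 * t / 2) 0 0) ^^ n) (mat 1) = torus_power t n"
proof (induction n)
  case 0
  then show ?case by (simp add: vec8_eq_iff torus_power_def)
next
  case (Suc n)
  have "ka (t / 2) 0 0 (3 * t / 2) 0 0 ** torus_power t n = torus_power t (Suc n)"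
    by (simp add: vec8_eq_iff torus_power_def Let_def matrix_mult_nth_8 ka_def)
  then show ?case using Suc by simp
qed

lemma sums_v8:
  fixes f0 :: "nat \<Rightarrow> 'a::real_normed_vector"
  assumes "f0 sums l0" "f1 sums l1" "f2 sums l2" "f3 sums l3" "f4 sums l4" "f5 sums l5" "f6 sums l6" "f7 sums l7"
  shows "(\<lambda>n. v8 (f0 n) (f1 n) (f2 n) (f3 n) (f4 n) (f5 n) (f6 n) (f7 n)) sums v8 l0 l1 l2 l3 l4 l5 l6 l7"
  unfolding sums_def
proof (rule vec_tendstoI)
  fix i
  have "\<forall>i. (\<lambda>m. (\<Sum>n<m. v8 (f0 n) (f1 n) (f2 n) (f3 n) (f4 n) (f5 n) (f6 n) (f7 n)) $ i) \<longlonglongrightarrow> v8 l0 l1 l2 l3 l4 l5 l6 l7 $ i"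
    unfolding all_8 using assms by (simp add: sums_def)
  then show "(\<lambda>m. (\<Sum>n<m. v8 (f0 n) (f1 n) (f2 n) (f3 n) (f4 n) (f5 n) (f6 n) (f7 n)) $ i) \<longlonglongrightarrow> v8 l0 l1 l2 l3 l4 l5 l6 l7 $ i"
    by blast
qed

lemma v8_scaleR: "r *\<^sub>R v8 a0 a1 a2 a3 a4 a5 a6 a7 =
    v8 (r *\<^sub>R a0) (r *\<^sub>R a1) (r *\<^sub>R a2) (r *\<^sub>R a3) (r *\<^sub>R a4) (r *\<^sub>R a5) (r *\<^sub>R a6) (r *\<^sub>R a7)"
  by (simp add: vec8_eq_iff)

lemma mexp_torus: "mexp (ka (t / 2) 0 0 (3 * t / 2) 0 0) = Rot (cos t) (sin t)"
proof -
  have E: "(\<lambda>n. (1 / fact n) * Re ((\<i> * complex_of_real t) ^ n)) sums cos t"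
    "(\<lambda>n. (1 / fact n) * Im ((\<i> * complex_of_real t) ^ n)) sums sin t"
    "(\<lambda>n. (1 / fact n) * - Im ((\<i> * complex_of_real t) ^ n)) sums - sin t" for t
  proof -
    have *: "(\<lambda>n. (\<i> * complex_of_real t) ^ n /\<^sub>R fact n) sums exp (\<i> * complex_of_real t)"
      by (rule exp_converges)
    show "(\<lambda>n. (1 / fact n) * Re ((\<i> * complex_of_real t) ^ n)) sums cos t"
      using sums_Re[OF *] by (simp add: divide_inverse Re_exp)
    show "(\<lambda>n. (1 / fact n) * Im ((\<i> * complex_of_real t) ^ n)) sums sin t"
      using sums_Im[OF *] by (simp add: divide_inverse Im_exp)
    then show "(\<lambda>n. (1 / fact n) * - Im ((\<i> * complex_of_real t) ^ n)) sums - sin t"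
      using sums_minus by fastforce
  qed
  have O: "(\<lambda>n. (1 / fact n) * (if n = 0 then 1 else 0)) sums (1 :: real)"
    by (rule sums_cong[THEN iffD1, OF _ sums_single[of 0 "\<lambda>_. 1"]]) simp
  have Z: "(\<lambda>n. (1 / fact n) * 0) sums (0 :: real)" by simp
  have C2: "cos t * cos t - sin t * sin t = cos (2 * t)" "2 * cos t * sin t = sin (2 * t)" "- 2 * cos t * sin t = - sin (2 * t)"
    by (simp_all add: cos_double sin_double power2_eq_square)
  have "(\<lambda>n. (1 / fact n) *\<^sub>R torus_power t n) sums Rot (cos t) (sin t)"
    unfolding torus_power_def Let_def Rot_def C2 v8_scaleR real_scaleR_def
    by (intro sums_v8 E O Z)
  then show ?thesis
    by (simp add: mexp_def torus_power_eq sums_unique[symmetric])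
qed

lemma g_theta_Rot: "g_theta t = Rot (cos t) (sin t)"
proof -
  have "(t / 2) *\<^sub>R (Dij 2 3 + Dij 4 5) = ka (t / 2) 0 0 (3 * t / 2) 0 0"
    by (simp add: Dij_ka ka_add ka_scale mult.commute)
  then show ?thesis by (simp add: g_theta_def mexp_torus)
qed

section \<open>Proper subalgebras from common invariant subspaces\<close>

lemma lie_subalgebra_kH: "subspace H \<Longrightarrow> lie_subalgebra (kH H)"
proof -
  assume H: "subspace H"
  have "subspace (kH H)"
    using subspace_g2 H unfolding subspace_def kH_def
    by (auto simp: image_subset_iff matrix_vector_mult_add_rdistrib simp flip: scaleR_matrix_vector_assoc)
  moreover have "lie_bracket X Y \<in> kH H" if "X \<in> kH H" "Y \<in> kH H" for X Y
    using that lie_subalgebra_g2 H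
    by (auto simp: kH_def lie_subalgebra_def lie_bracket_vec image_subset_iff subspace_diff)
  ultimately show ?thesis by (simp add: lie_subalgebra_def)
qed

lemma kH_spanI:
  assumes "Z \<in> g2" "\<And>b. b \<in> B \<Longrightarrow> Z *v b \<in> span B"
  shows "Z \<in> kH (span B)"
proof -
  have "(\<lambda>x. Z *v x) ` span B = span ((\<lambda>x. Z *v x) ` B)"
    by (rule linear_span_image[symmetric]) simp
  also have "\<dots> \<subseteq> span B"
    using assms(2) by (intro span_minimal) auto
  finally show ?thesis using assms(1) by (simp add: kH_def)
qed

text \<open>The span of \<open>B\<close> is stable under \<open>S\<close>, so \<open>Ad S Z\<close>
  preserves it as soon as \<open>Z\<close> does, and then all of \<open>LZ Z\<close> does. The
  derivation \<open>X\<close> witnesses that \<open>g2\<close> does not.\<close>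

lemma LZ_proper:
  assumes "Z \<in> kH (span B)" "\<And>b. b \<in> B \<Longrightarrow> S *v b \<in> B \<or> - (S *v b) \<in> B" "X \<in> g2" "u \<in> B" "X *v u \<notin> span B"
  shows "LZ Z \<noteq> g2"
proof -
  have "S *v b \<in> span B" if "b \<in> B" for b
    using assms(2)[OF that] by (metis span_base span_neg add.inverse_inverse)
  then have gen: "(\<lambda>x. S *v x) ` B \<subseteq> span B" by blast
  have "(\<lambda>x. S *v x) ` span B = span ((\<lambda>x. S *v x) ` B)"
    by (rule linear_span_image[symmetric]) simp
  also have "\<dots> \<subseteq> span B"
    using gen by (rule span_minimal) (rule subspace_span)
  finally have S: "x \<in> span B \<Longrightarrow> S *v x \<in> span B" for x by auto
  have "Ad S Z \<in> kH (span B)"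
    using assms(1) S by (auto simp: kH_def Ad_S_vec Ad_g2 S_in_G2)
  then have "LZ Z \<subseteq> kH (span B)"
    using assms(1) by (intro LZ_least lie_subalgebra_kH) auto
  moreover have "X \<notin> kH (span B)"
    using assms(5) span_base[OF assms(4)] by (auto simp: kH_def image_subset_iff)
  ultimately show ?thesis using assms(3) by blast
qed

lemma LZ_Rot: "c * c + s * s = 1 \<Longrightarrow> LZ (Ad (Rot c s) Z) = g2 \<longleftrightarrow> LZ Z = g2"
proof -
  assume u: "c * c + s * s = 1"
  note G = Rot_G2[OF u]
  have "inj (Ad (Rot c s))"
    by (rule inj_on_inverseI[of _ "Ad (matrix_inv (Rot c s))"]) (simp add: Ad_inv_left G)
  then show ?thesis
    using LZ_Ad[OF G Rot_S] Ad_g2_image[OF G] by (metis inj_image_eq_iff)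
qed

lemma F_vecI:
  assumes "Z \<in> kA" "v \<noteq> 0" "v $ 0 = 0" "Z *v v = 0" "Z *v (S *v v) = 0"
  shows "Z \<in> F_vec"
proof -
  have "v \<in> kerV Z" "S *v v \<in> kerV Z"
    using assms by (auto simp: kerV_def ImO_eq S_coords)
  then have "v \<in> kerV Z \<inter> (\<lambda>v. S *v v) ` kerV Z"
    using S_involution[of v] by force
  then show ?thesis using assms by (auto simp: F_vec_def)
qed

lemma F_vecE:
  assumes "Z \<in> F_vec"
  obtains v where "Z \<in> kA" "v \<noteq> 0" "v $ 0 = 0" "Z *v v = 0" "Z *v (S *v v) = 0"
proof -
  have "0 \<in> kerV Z" "S *v 0 = 0"
    by (simp_all add: kerV_def ImO_eq)
  then have "0 \<in> kerV Z \<inter> (\<lambda>v. S *v v) ` kerV Z"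
    by (metis IntI imageI)
  then obtain v where v: "v \<noteq> 0" "v \<in> kerV Z" "v \<in> (\<lambda>v. S *v v) ` kerV Z"
    using assms unfolding F_vec_def by blast
  then have "Z *v (S *v v) = 0"
    by (auto simp: kerV_def S_involution)
  then show thesis
    using that[of v] v assms by (simp add: F_vec_def kerV_def ImO_eq)
qed

lemma F_vec_proper: "Z \<in> F_vec \<Longrightarrow> LZ Z \<noteq> g2"
proof
  assume F: "Z \<in> F_vec" and g: "LZ Z = g2"
  obtain v where Z: "Z \<in> kA" and v: "v \<noteq> 0" "v $ 0 = 0" "Z *v v = 0" "Z *v (S *v v) = 0"
    using F by (rule F_vecE)
  have "lie_subalgebra {X. X *v v = 0}"
    by (auto simp: lie_subalgebra_def subspace_def lie_bracket_vec matrix_vector_mult_add_rdistrib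
        simp flip: scaleR_matrix_vector_assoc)
  then have "LZ Z \<subseteq> {X. X *v v = 0}"
    using v by (intro LZ_least) (auto simp: Ad_S_vec)
  then have "X *v v = 0" if "X \<in> g2" for X
    using that g by auto
  \<comment> \<open>The imaginary kernels of these two derivations are the lines of
    \<open>oe 2\<close> and \<open>oe 1\<close>, which meet only in 0.\<close>
  then have "ka 0 1 0 0 0 0 *v v = 0" "ka 1 0 0 0 0 0 *v v = 0"
    using ka_in_g2 by blast+
  then have "v = 0"
    using v(2) v8_eta[of v] by (simp add: vec8_eq_iff mult_v8 inner_8 ka_def)
  with v show False by simp
qed

lemma F_projI:
  assumes "Z \<in> kA" "(c, s) \<noteq> (0, 0)"
    "Z *v (c *\<^sub>R oe 2 + s *\<^sub>R oe 3) \<in> H_cs c s" "Z *v (c *\<^sub>R oe 4 + s *\<^sub>R oe 5) \<in> H_cs c s"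
    "Z *v ((c\<^sup>2 - s\<^sup>2) *\<^sub>R oe 6 + (2 * c * s) *\<^sub>R oe 7) \<in> H_cs c s"
  shows "Z \<in> F_proj"
proof -
  have "Z \<in> g2" using assms(1) by (simp add: kA_def kH_def)
  then have "Z *v oe 0 = 0" by (rule g2_oe_0)
  then have "Z \<in> kH (H_cs c s)"
    unfolding H_cs_def using \<open>Z \<in> g2\<close> assms(3-) unfolding H_cs_def
    by (intro kH_spanI) (auto simp: span_0)
  then show ?thesis
    unfolding F_proj_def using assms(1,2) by blast
qed

lemma F_proj_proper: "Z \<in> F_proj \<Longrightarrow> Z \<in> kA \<and> LZ Z \<noteq> g2"
proof -
  assume "Z \<in> F_proj"
  then obtain c s where cs: "(c, s) \<noteq> (0, 0)" and Z: "Z \<in> kA" "Z \<in> kH (H_cs c s)"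
    by (auto simp: F_proj_def)
  let ?B = "{oe 0, c *\<^sub>R oe 2 + s *\<^sub>R oe 3, c *\<^sub>R oe 4 + s *\<^sub>R oe 5, (c\<^sup>2 - s\<^sup>2) *\<^sub>R oe 6 + (2 * c * s) *\<^sub>R oe 7}"
  have "LZ Z \<noteq> g2"
  proof (rule LZ_proper[of _ ?B "torus (1/2) 0" "c *\<^sub>R oe 2 + s *\<^sub>R oe 3"])
    show "Z \<in> kH (span ?B)" using Z by (simp add: H_cs_def)
    have S: "S *v oe 0 = oe 0" "S *v (c *\<^sub>R oe 2 + s *\<^sub>R oe 3) = c *\<^sub>R oe 4 + s *\<^sub>R oe 5"
      "S *v (c *\<^sub>R oe 4 + s *\<^sub>R oe 5) = c *\<^sub>R oe 2 + s *\<^sub>R oe 3"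
      "S *v ((c\<^sup>2 - s\<^sup>2) *\<^sub>R oe 6 + (2 * c * s) *\<^sub>R oe 7) = - ((c\<^sup>2 - s\<^sup>2) *\<^sub>R oe 6 + (2 * c * s) *\<^sub>R oe 7)"
      by (simp_all add: vec8_eq_iff S_coords)
    show "S *v b \<in> ?B \<or> - (S *v b) \<in> ?B" if "b \<in> ?B" for b
      using that S by auto
    show "torus (1/2) 0 \<in> g2" by (rule ka_in_g2)
    \<comment> \<open>The witness turns \<open>c e2 + s e3\<close> into
      \<open>- s e2 + c e3\<close>, which leaves this hyperplane because
      \<open>c\<^sup>2 + s\<^sup>2\<close> is nonzero.\<close>
    have "span ?B \<subseteq> {x. c * x $ 3 = s * x $ 2}"
      by (rule span_minimal) (auto simp: subspace_def algebra_simps)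
    moreover have "torus (1/2) 0 *v (c *\<^sub>R oe 2 + s *\<^sub>R oe 3) \<notin> {x. c * x $ 3 = s * x $ 2}"
      using cs sumsq_pos[of c s] by (simp add: oe_v8 v8_scale v8_add ka_v8 eq_neg_iff_add_eq_0)
    ultimately show "torus (1/2) 0 *v (c *\<^sub>R oe 2 + s *\<^sub>R oe 3) \<notin> span ?B" by blast
  qed simp
  with Z show ?thesis by simp
qed

text \<open>The hyperplane \<open>x $ 3 + x $ 5 = 0\<close> contains the invariant context but not its image under an
  infinitesimal rotation commuting with \<open>S\<close>.\<close>

lemma context_proper:
  assumes Z: "Z \<in> g2" "Z *v u = a *\<^sub>R w" "Z *v v = b *\<^sub>R w" "Z *v w = c *\<^sub>R u + d *\<^sub>R v"
    and S: "S *v u = u" "S *v v = - v" "S *v w = - w"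
    and h: "u $ 3 + u $ 5 = 0" "v $ 3 + v $ 5 = 0" "w $ 3 + w $ 5 = 0" "u $ 2 + u $ 4 \<noteq> 0"
  shows "LZ Z \<noteq> g2"
proof (rule LZ_proper[of _ "{oe 0, u, v, w}" "torus (1/2) (3/2)" u])
  show "Z \<in> kH (span {oe 0, u, v, w})"
    using Z g2_oe_0[OF Z(1)]
    by (intro kH_spanI) (auto simp: span_0 intro!: span_add span_scale intro: span_base)
  have "S *v oe 0 = oe 0" by (simp add: oe_v8 S_v8)
  then show "S *v x \<in> {oe 0, u, v, w} \<or> - (S *v x) \<in> {oe 0, u, v, w}" if "x \<in> {oe 0, u, v, w}" for x
    using that S by auto
  show "torus (1/2) (3/2) \<in> g2" by (rule ka_in_g2)
  have "span {oe 0, u, v, w} \<subseteq> {x. x $ 3 + x $ 5 = 0}"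
    by (rule span_minimal) (use h in \<open>auto simp: subspace_def algebra_simps simp flip: distrib_left\<close>)
  moreover have "torus (1/2) (3/2) *v u \<notin> {x. x $ 3 + x $ 5 = 0}"
    using h(4) by (simp add: mult_v8 inner_8 ka_def)
  ultimately show "torus (1/2) (3/2) *v u \<notin> span {oe 0, u, v, w}" by blast
qed simp

text \<open>The invariant context has imaginary basis \<open>u = 2 x1 e1 + x2 (e2 + e4)\<close>,
  \<open>v = e2 - e4\<close> and their product. It is the solution \<open>r = 1\<close>,
  \<open>w = 0\<close> of the system in \<open>context_arith\<close>.\<close>

lemma res_proper: "x2 \<noteq> 0 \<Longrightarrow> LZ (ka x1 x2 0 (3 * x1) (3 * x2) 0) \<noteq> g2"
  by (rule context_proper[of _ "v8 0 (2 * x1) x2 0 x2 0 0 0" "- x2" "v8 0 0 0 (2 * x1) 0 (- 2 * x1) (- 2 * x2) 0"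
        "v8 0 0 1 0 (- 1) 0 0 0" 1 "2 * x2" "- 4 * x1 * x1 - 2 * x2 * x2"])
    (simp_all add: ka_in_g2 ka_v8 S_v8 v8_scale v8_add v8_uminus v8_eq_iff algebra_simps)

lemma E_tk_ka: "E_tk \<tau> \<kappa> = ka (3 * \<kappa> * (3 - \<tau>)) (6 * (\<tau>\<^sup>2 + 3)) 0 (3 * \<kappa> * (2 * \<tau>\<^sup>2 + \<tau> + 3)) (- 6 * \<tau> * (\<tau>\<^sup>2 + 3)) 0"
  by (simp add: E_tk_def Let_def Dij_ka ka_scale ka_add ka_diff ka_eq_iff algebra_simps)

text \<open>The vectors solve the system in \<open>context_arith\<close> with
  \<open>x = \<kappa> / 2\<close>: the first is \<open>u\<close>, the one with an
  \<open>e7\<close>-entry is a multiple of \<open>v\<close>, and \<open>u \<odot> v\<close> is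
  \<open>(\<tau> - 3) * (\<tau> + 1) / \<tau>\<close> times the remaining one. The relation for
  \<open>\<kappa>\<^sup>2\<close> makes the images of the last two stay in the span.\<close>

lemma rf_proper:
  assumes "0 < \<tau>" "\<kappa>\<^sup>2 = (1 - \<tau>) * (\<tau>\<^sup>2 + 3) / \<tau>"
  shows "LZ (l *\<^sub>R E_tk \<tau> \<kappa>) \<noteq> g2"
proof -
  define d where "d = \<tau>\<^sup>2 + 3"
  have k: "\<tau> * (\<kappa> * \<kappa>) = (1 - \<tau>) * d"
    using assms by (simp add: d_def power2_eq_square field_simps)
  have d: "d = \<tau> * \<tau> + 3" by (simp add: d_def power2_eq_square)
  have E: "l *\<^sub>R E_tk \<tau> \<kappa> = ka (3 * l * \<kappa> * (3 - \<tau>)) (6 * l * d) 0 (3 * l * \<kappa> * (2 * \<tau> * \<tau> + \<tau> + 3)) (- 6 * l * \<tau> * d) 0"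
    by (simp add: E_tk_ka ka_scale ka_eq_iff d_def power2_eq_square)
  show ?thesis
    unfolding E
  proof (rule context_proper[of _ "v8 0 \<kappa> 2 0 2 0 0 0" "- 12 * l * (1 + \<tau>)" "v8 0 0 0 (\<kappa> * \<tau>) 0 (- \<kappa> * \<tau>) d 0"
        "v8 0 0 d 0 (- d) 0 0 (- (3 + \<tau>) * \<kappa>)" "6 * l * d * (3 - \<tau>) / \<tau>" "12 * l * d * \<tau>" "- 6 * l * d"])
    let ?Z = "ka (3 * l * \<kappa> * (3 - \<tau>)) (6 * l * d) 0 (3 * l * \<kappa> * (2 * \<tau> * \<tau> + \<tau> + 3)) (- 6 * l * \<tau> * d) 0"
    show "?Z *v v8 0 \<kappa> 2 0 2 0 0 0 = (- 12 * l * (1 + \<tau>)) *\<^sub>R v8 0 0 0 (\<kappa> * \<tau>) 0 (- \<kappa> * \<tau>) d 0"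
      by (simp add: ka_v8 v8_scale v8_eq_iff d algebra_simps)
    have "6 * l * d * (d * (1 + \<tau>) + (3 + \<tau>) * (\<kappa> * \<kappa>)) * \<tau> = 6 * l * d * (3 - \<tau>) * d"
      using k by algebra
    then show "?Z *v v8 0 0 d 0 (- d) 0 0 (- (3 + \<tau>) * \<kappa>) = (6 * l * d * (3 - \<tau>) / \<tau>) *\<^sub>R v8 0 0 0 (\<kappa> * \<tau>) 0 (- \<kappa> * \<tau>) d 0"
      using assms(1) by (simp add: ka_v8 v8_scale v8_eq_iff field_simps) (simp add: d algebra_simps)
    show "?Z *v v8 0 0 0 (\<kappa> * \<tau>) 0 (- \<kappa> * \<tau>) d 0 = (12 * l * d * \<tau>) *\<^sub>R v8 0 \<kappa> 2 0 2 0 0 0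
        + (- 6 * l * d) *\<^sub>R v8 0 0 d 0 (- d) 0 0 (- (3 + \<tau>) * \<kappa>)"
    proof -
      have "- (6 * (l * (\<kappa> * (3 - \<tau>))) * (\<kappa> * \<tau>)) = - 6 * l * (3 - \<tau>) * (\<tau> * (\<kappa> * \<kappa>))"
        by (simp add: algebra_simps)
      also have "\<dots> = 24 * (l * (d * \<tau>)) - 6 * l * d * d"
        unfolding k d by (simp add: algebra_simps)
      finally have 1: "- (6 * (l * (\<kappa> * (3 - \<tau>))) * (\<kappa> * \<tau>)) = 24 * (l * (d * \<tau>)) - 6 * l * d * d" .
      have "(6 * l * d + 6 * l * \<tau> * d) * d - (3 * l * \<kappa> * (3 - \<tau>) - 3 * l * \<kappa> * (2 * \<tau> * \<tau> + \<tau> + 3)) * (\<kappa> * \<tau>)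
        = 6 * l * (1 + \<tau>) * d * d + 6 * l * \<tau> * (1 + \<tau>) * (\<tau> * (\<kappa> * \<kappa>))"
        by (simp add: algebra_simps)
      also have "\<dots> = 24 * (l * (d * \<tau>)) + 6 * l * d * d"
        unfolding k d by (simp add: algebra_simps)
      finally show ?thesis
        using 1 by (simp add: ka_v8 v8_scale v8_add v8_eq_iff) (simp add: d algebra_simps)
    qed
  qed (simp_all add: ka_in_g2 S_v8 v8_uminus)
qed

lemma Z_hat_ka: "Z_hat a c s = ka (a * (c\<^sup>2 + s\<^sup>2)) (c * (c\<^sup>2 + s\<^sup>2)) (s * (c\<^sup>2 + s\<^sup>2)) (3 * a * (c\<^sup>2 + s\<^sup>2))
    (3 * (c ^ 3 - 3 * c * s\<^sup>2)) (3 * (3 * c\<^sup>2 * s - s ^ 3))"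
  by (simp add: Z_hat_def Let_def Dij_ka ka_scale ka_add ka_diff ka_eq_iff)
    (simp add: algebra_simps power2_eq_square power3_eq_cube)

text \<open>In polar coordinates for \<open>(c, s)\<close> the cubic coefficients become
  \<open>r ^ 3\<close> times the cosine and sine of the triple angle. Undoing the rotation leaves an
  element whose \<open>y\<close>-part is three times its \<open>x\<close>-part.\<close>

lemma Z_hat_Rot:
  assumes "c\<^sup>2 + s\<^sup>2 > 0"
  defines "r \<equiv> sqrt (c\<^sup>2 + s\<^sup>2)"
  shows "Z_hat a c s = Ad (Rot (c / r) (s / r)) (ka (a * r\<^sup>2) (r ^ 3) 0 (3 * (a * r\<^sup>2)) (3 * r ^ 3) 0)"
    and "(c / r) * (c / r) + (s / r) * (s / r) = 1" and "r \<noteq> 0"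
proof -
  have r: "r\<^sup>2 = c\<^sup>2 + s\<^sup>2" and "r > 0"
    using assms by (simp_all add: r_def)
  then show "r \<noteq> 0" by simp
  have "(c / r) * (c / r) + (s / r) * (s / r) = (c\<^sup>2 + s\<^sup>2) / r\<^sup>2"
    by (simp add: add_divide_distrib power2_eq_square)
  also have "\<dots> = 1"
    unfolding r[symmetric] using \<open>r \<noteq> 0\<close> by simp
  finally show u: "(c / r) * (c / r) + (s / r) * (s / r) = 1" .
  show "Z_hat a c s = Ad (Rot (c / r) (s / r)) (ka (a * r\<^sup>2) (r ^ 3) 0 (3 * (a * r\<^sup>2)) (3 * r ^ 3) 0)"
    unfolding Ad_Rot[OF u] Z_hat_ka r[symmetric] ka_eq_iff
    using \<open>r \<noteq> 0\<close> by (simp add: field_simps power2_eq_square power3_eq_cube)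
qed

lemma F_res_proper: "Z \<in> F_res \<Longrightarrow> Z \<in> kA \<and> LZ Z \<noteq> g2"
proof -
  assume "Z \<in> F_res"
  then consider "Z = 0" | a c s where "c\<^sup>2 + s\<^sup>2 > 0" "Z = Z_hat a c s"
    by (auto simp: F_res_def)
  then show ?thesis
  proof cases
    case 1
    have "(0 :: real^8^8) \<in> kA"
      by (metis ka_0 ka_in_kA)
    then have "Z \<in> F_vec"
      by (intro F_vecI[of _ "oe 1"]) (simp_all add: 1 vec8_eq_iff)
    then show ?thesis using F_vec_proper by (auto simp: F_vec_def)
  next
    case 2
    note R = Z_hat_Rot[OF 2(1)]
    have "LZ Z \<noteq> g2"
      unfolding 2(2) R(1)[of a] LZ_Rot[OF R(2)] by (rule res_proper) (use R(3) in simp)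
    then show ?thesis by (simp add: 2(2) Z_hat_ka)
  qed
qed

lemma F_rf_proper: "Z \<in> F_rf \<Longrightarrow> Z \<in> kA \<and> LZ Z \<noteq> g2"
proof -
  assume "Z \<in> F_rf"
  then obtain l t \<tau> \<kappa> where *: "Z = l *\<^sub>R Ad (g_theta t) (E_tk \<tau> \<kappa>)" "0 < \<tau>" "\<kappa>\<^sup>2 = (1 - \<tau>) * (\<tau>\<^sup>2 + 3) / \<tau>"
    by (auto simp: F_rf_def)
  have u: "cos t * cos t + sin t * sin t = 1"
    using sin_cos_squared_add3[of t] by simp
  have Z: "Z = Ad (Rot (cos t) (sin t)) (l *\<^sub>R E_tk \<tau> \<kappa>)"
    by (simp add: * g_theta_Rot Ad_scale)
  have "LZ Z \<noteq> g2"
    unfolding Z LZ_Rot[OF u] using *(2,3) by (rule rf_proper)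
  moreover have "Z \<in> kA"
    by (simp add: Z E_tk_ka ka_scale Ad_Rot[OF u])
  ultimately show ?thesis by simp
qed

section \<open>Normal forms\<close>

text \<open>Up to a rotation \<open>Rot\<close>, every element of \<open>kA\<close> has the form \<open>zn p q a b e\<close>: it maps \<open>e\<^sub>1, e\<^sub>2, e\<^sub>4\<close> to
  \<open>- q e\<^sub>3\<close>, \<open>p e\<^sub>3\<close> and \<open>a e\<^sub>5 + b e\<^sub>6 + e e\<^sub>7\<close>.\<close>

definition zn :: "real \<Rightarrow> real \<Rightarrow> real \<Rightarrow> real \<Rightarrow> real \<Rightarrow> real^8^8" where
  "zn p q a b e = ka (p / 2) (q / 2) 0 (a + p / 2) (b + q / 2) e"

lemma zn_v8: "zn p q a b e *v v8 v0 v1 v2 v3 v4 v5 v6 v7 = v8 0 (q * v3) (- (p * v3)) (p * v2 - q * v1)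
    (- (a * v5) - b * v6 - e * v7) (a * v4 - e * v6 + (q + b) * v7)
    (b * v4 + e * v5 - (p + a) * v7) (e * v4 - (q + b) * v5 + (p + a) * v6)"
  by (simp add: zn_def ka_v8 v8_eq_iff algebra_simps)

lemma zn_in_kA [simp]: "zn p q a b e \<in> kA"
  by (simp add: zn_def)

lemma normal_form:
  assumes "Z \<in> kA"
  obtains c s p q a b e where "c * c + s * s = 1" "Ad (Rot c s) Z = zn p q a b e"
proof -
  obtain x1 x2 x3 y1 y2 y3 where Z: "Z = ka x1 x2 x3 y1 y2 y3"
    using assms by (auto simp: kA_iff)
  obtain c s where u: "c * c + s * s = 1" "s * x2 + c * x3 = 0"
    using unit_angle by blast
  have zn: "ka x1 x2 0 y1 y2 y3 = zn (2 * x1) (2 * x2) (y1 - x1) (y2 - x2) y3" for x1 x2 y1 y2 y3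
    by (simp add: zn_def ka_eq_iff)
  show thesis
    by (rule that[OF u(1)]) (simp only: Z Ad_Rot[OF u(1)] u(2) zn)
qed

lemma zn_F_vec: "zn p 0 a b e \<in> F_vec"
  by (rule F_vecI[of _ "oe 1"]) (simp_all add: oe_v8 S_v8 zn_v8 v8_0 v8_eq_iff)

lemma zn_F_proj: "zn 0 q 0 b 0 \<in> F_proj"
proof (rule F_projI[of _ 1 0])
  have H: "H_cs 1 0 = span {oe 0, oe 2, oe 4, oe 6}" by (simp add: H_cs_def)
  have "zn 0 q 0 b 0 *v oe 2 = 0" "zn 0 q 0 b 0 *v oe 4 = b *\<^sub>R oe 6" "zn 0 q 0 b 0 *v oe 6 = (- b) *\<^sub>R oe 4"
    by (simp_all add: oe_v8 zn_v8 v8_scale v8_0 v8_eq_iff)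
  then show "zn 0 q 0 b 0 *v (1 *\<^sub>R oe 2 + 0 *\<^sub>R oe 3) \<in> H_cs 1 0" "zn 0 q 0 b 0 *v (1 *\<^sub>R oe 4 + 0 *\<^sub>R oe 5) \<in> H_cs 1 0"
    "zn 0 q 0 b 0 *v ((1\<^sup>2 - 0\<^sup>2) *\<^sub>R oe 6 + (2 * 1 * 0) *\<^sub>R oe 7) \<in> H_cs 1 0"
    unfolding H by (auto simp: span_0 intro: span_scale span_base span_neg)
qed simp_all

section \<open>Solving the resonance equation\<close>

lemma resonant_vec:
  assumes "resonant Z Y"
  obtains \<alpha> \<mu> where "\<And>v. Z *v (Z *v (Y *v v)) - 2 *\<^sub>R (Z *v (Y *v (Z *v v))) + Y *v (Z *v (Z *v v))
    = \<alpha> *\<^sub>R (Z *v v) - \<mu> *\<^sub>R (Y *v v)"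
proof -
  obtain \<alpha> \<mu> where *: "lie_bracket Z (lie_bracket Z Y) = \<alpha> *\<^sub>R Z - \<mu> *\<^sub>R Y"
    using assms by (auto simp: resonant_def)
  show thesis
  proof (rule that)
    fix v
    have "lie_bracket Z (lie_bracket Z Y) *v v = \<alpha> *\<^sub>R (Z *v v) - \<mu> *\<^sub>R (Y *v v)"
      unfolding * by (simp add: matrix_vector_mult_diff_rdistrib scaleR_matrix_vector_assoc)
    then show "Z *v (Z *v (Y *v v)) - 2 *\<^sub>R (Z *v (Y *v (Z *v v))) + Y *v (Z *v (Z *v v))
        = \<alpha> *\<^sub>R (Z *v v) - \<mu> *\<^sub>R (Y *v v)"
      by (simp add: lie_bracket_vec matrix_vector_mult_diff_distrib scaleR_2 algebra_simps)
  qed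
qed

text \<open>If \<open>a\<close> is nonzero, eliminating \<open>\<mu>\<close> and the combination
  \<open>g = q + b\<close> ends in the sum of squares
  \<open>2 * (a + p)\<^sup>2 + 4 * p\<^sup>2 = 0\<close>, which is impossible for nonzero
  \<open>p\<close>.\<close>

lemma resonant_arith:
  fixes p q a b :: real
  assumes q: "q \<noteq> 0" and e: "e = 0"
    and 1: "p * a = \<alpha>" "a\<^sup>2 + 3 * (q + b)\<^sup>2 + q\<^sup>2 = \<mu>" "3 * (q + b) * (p + a) = b * (a - p)"
    and 2: "a * (\<mu> - p\<^sup>2 - q\<^sup>2) = 0" "b\<^sup>2 * a - b * (p + a) * (q + b) - 2 * p * (q + b)\<^sup>2 - p * q\<^sup>2 = 0"
      "b ^ 3 + b * (p + a)\<^sup>2 + 2 * p * (q + b) * (p + a) + p\<^sup>2 * b = \<mu> * b"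
  shows "p = 0 \<and> a = 0"
proof (cases "a = 0")
  case True
  show ?thesis
  proof (rule ccontr)
    assume "\<not> (p = 0 \<and> a = 0)"
    with True have p: "p \<noteq> 0" by simp
    have "p * (3 * (q + b) + b) = 0" using 1(3) True by algebra
    then have b: "b = - 3 * (q + b)" using p by simp
    then have "p * (15 * (q + b)\<^sup>2) = 0" using 2(2) True by algebra
    then have "q + b = 0" using p by simp
    then show False using b q by simp
  qed
next
  case False
  then have mu: "\<mu> = p\<^sup>2 + q\<^sup>2" using 2(1) by simp
  define g where "g = q + b"
  have i: "p\<^sup>2 = a\<^sup>2 + 3 * g\<^sup>2" using 1(2) mu by (simp add: g_def)
  then have p: "p \<noteq> 0" using False by (auto simp: add_nonneg_eq_0_iff)
  have ii: "3 * g * (p + a) = b * (a - p)" using 1(3) by (simp add: g_def)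
  have iii: "b * (p\<^sup>2 + 8 * p * a + 3 * a\<^sup>2 + 3 * (b\<^sup>2 - q\<^sup>2)) = 0"
    using 2(3) ii unfolding mu g_def by algebra
  have b: "b \<noteq> 0"
  proof
    assume "b = 0"
    then have "g \<noteq> 0" "g * (p + a) = 0" using ii q by (auto simp: g_def)
    then have "a = - p" by simp
    then show False using i \<open>g \<noteq> 0\<close> by simp
  qed
  have iv: "p\<^sup>2 + 8 * p * a + 3 * a\<^sup>2 + 3 * (g * (2 * b - g)) = 0"
  proof -
    have "p\<^sup>2 + 8 * p * a + 3 * a\<^sup>2 + 3 * (b\<^sup>2 - q\<^sup>2) = 0"
      using iii b by (metis mult_eq_0_iff)
    moreover have "b\<^sup>2 - q\<^sup>2 = g * (2 * b - g)"
      by (simp add: g_def power2_eq_square algebra_simps)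
    ultimately show ?thesis by simp
  qed
  have ap: "a \<noteq> p"
  proof
    assume "a = p"
    then have "g = 0" using i by simp
    then have "12 * p\<^sup>2 = 0" using iv \<open>a = p\<close> by algebra
    then show False using p by simp
  qed
  \<comment> \<open>The factor \<open>a - p\<close> lets \<open>ii\<close> replace
    \<open>b * (a - p)\<close>; afterwards \<open>i\<close> turns \<open>3 * g\<^sup>2\<close> into
    \<open>p\<^sup>2 - a\<^sup>2\<close>, and the factor cancels.\<close>
  have "(a - p) * (3 * (g * (2 * b - g))) = 3 * g * (2 * (b * (a - p)) - g * (a - p))"
    by (simp add: algebra_simps)
  also have "\<dots> = 3 * g\<^sup>2 * (5 * a + 7 * p)"
    unfolding ii[symmetric] by (simp add: algebra_simps power2_eq_square)
  also have "\<dots> = (p\<^sup>2 - a\<^sup>2) * (5 * a + 7 * p)"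
    using i by simp
  also have "\<dots> = (a - p) * (- (p + a) * (5 * a + 7 * p))"
    by (simp add: algebra_simps power2_eq_square)
  finally have "3 * (g * (2 * b - g)) = - (p + a) * (5 * a + 7 * p)"
    using ap by simp
  then have "2 * (a + p)\<^sup>2 + 4 * p\<^sup>2 = 0"
    using iv by algebra
  then show ?thesis using p by (simp add: add_nonneg_eq_0_iff)
qed

lemma resonant_normal:
  assumes r: "resonant (zn p q a b e) (Ad S (zn p q a b e))"
  shows "zn p q a b e \<in> F_vec \<union> F_proj"
proof (cases "q = 0")
  case True
  then show ?thesis using zn_F_vec by simp
next
  case q: False
  obtain \<alpha> \<mu> where *: "\<And>v. zn p q a b e *v (zn p q a b e *v (Ad S (zn p q a b e) *v v))
      - 2 *\<^sub>R (zn p q a b e *v (Ad S (zn p q a b e) *v (zn p q a b e *v v)))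
      + Ad S (zn p q a b e) *v (zn p q a b e *v (zn p q a b e *v v))
    = \<alpha> *\<^sub>R (zn p q a b e *v v) - \<mu> *\<^sub>R (Ad S (zn p q a b e) *v v)"
    using resonant_vec[OF r] by blast
  note s = Ad_S_vec S_v8 zn_v8 v8_scale v8_diff v8_add v8_eq_iff oe_v8
  \<comment> \<open>The values at \<open>oe 1\<close> and \<open>oe 2\<close> already yield
    \<open>e = 0\<close> and all six equations of \<open>resonant_arith\<close>.\<close>
  note h1 = *[of "oe 1", unfolded s] and h2 = *[of "oe 2", unfolded s]
  have "q * q * e = 0"
    using h1 by (elim conjE) algebra
  then have e: "e = 0" using q by simp
  have "q * (p * a - \<alpha>) = 0"
    using h1 by (elim conjE) algebra
  then have 1: "p * a = \<alpha>" using q by simp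
  have "q * (a\<^sup>2 + 3 * (q + b)\<^sup>2 + q\<^sup>2 - \<mu>) = 0"
    using h1 e by (elim conjE) algebra
  then have 2: "a\<^sup>2 + 3 * (q + b)\<^sup>2 + q\<^sup>2 = \<mu>" using q by simp
  have "q * (3 * (q + b) * (p + a) - b * (a - p)) = 0"
    using h1 e by (elim conjE) algebra
  then have 3: "3 * (q + b) * (p + a) = b * (a - p)" using q by simp
  have 4: "a * (\<mu> - p\<^sup>2 - q\<^sup>2) = 0"
    using h2 e 1 by (elim conjE) algebra
  have 5: "b\<^sup>2 * a - b * (p + a) * (q + b) - 2 * p * (q + b)\<^sup>2 - p * q\<^sup>2 = 0"
    using h2 e 1 by (elim conjE) algebra
  have 6: "b ^ 3 + b * (p + a)\<^sup>2 + 2 * p * (q + b) * (p + a) + p\<^sup>2 * b = \<mu> * b"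
    using h2 e 1 by (elim conjE) algebra
  have "p = 0 \<and> a = 0"
    by (rule resonant_arith[OF q e 1 2 3 4 5 6])
  then show ?thesis using zn_F_proj e by simp
qed

text \<open>The equations for an invariant context spanned by \<open>1\<close>, \<open>u = (x, 1, 0, 1, 0, 0, 0)\<close>,
  \<open>v = (0, r, 0, - r, 0, 0, w)\<close> and \<open>u \<odot> v\<close>. With \<open>W = x w\<close>, elimination of the coefficients of \<open>Z\<close> leaves
  \<open>(W - 2 r) (2 W\<^sup>2 + (1 - r)\<^sup>2 (W - 2 r)) = 0\<close>; the second factor is a rational curve, parametrised by
  \<open>s = W / (1 - r) = - (1 + \<tau>) / 2\<close>.\<close>

lemma context_arith:
  fixes p q a b x r w m :: real
  assumes m: "m \<noteq> 0" and q: "q \<noteq> 0"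
    and 1: "p - q * x = m * (x * r + w)" "a = - m * (x * r + w)" "b = m * (x * w - 2 * r)"
    and 2: "p * r = - m * (x * r + w)" "- a * r + (q + b) * w = m * (x * r + w)" "b * r + (p + a) * w = m * (x * w - 2 * r)"
    and rw: "\<not> (r = 0 \<and> w = 0)"
  shows "p = 0 \<and> a = 0 \<or> a = p \<and> b = q \<or>
    (\<exists>l \<tau> \<kappa>. l \<noteq> 0 \<and> 0 < \<tau> \<and> \<tau> < 1 \<and> \<kappa>\<^sup>2 = (1 - \<tau>) * (\<tau>\<^sup>2 + 3) / \<tau> \<and>
      p = 6 * l * \<kappa> * (3 - \<tau>) \<and> q = 12 * l * (\<tau>\<^sup>2 + 3) \<and> a = 6 * l * \<kappa> * \<tau> * (1 + \<tau>) \<and> b = - 6 * l * (\<tau>\<^sup>2 + 3) * (1 + \<tau>))"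
proof (cases "x * r + w = 0")
  case True
  then have "a = 0" "p * r = 0" "p = q * x" using 1 2 by simp_all
  moreover have "p = 0"
  proof (rule ccontr)
    assume "p \<noteq> 0"
    then have "r = 0" using \<open>p * r = 0\<close> by simp
    then show False using True rw by simp
  qed
  ultimately show ?thesis by simp
next
  case False
  then have pr: "p \<noteq> 0" "r \<noteq> 0" using 2(1) m by auto
  have a: "a = p * r" using 1(2) 2(1) by simp
  have pq: "p * (1 + r) = q * x" using 1(1) 2(1) by (simp add: algebra_simps)
  have x: "x \<noteq> 0"
  proof
    assume "x = 0"
    then have "r = - 1" using pq pr by simp
    then show False using 1(3) 2(3) a m \<open>x = 0\<close> by simp
  qed
  have r1: "1 + r \<noteq> 0" using pq q x by auto
  have e6: "b * (1 - r) = p * (1 + r) * w"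
    using 2(3) 1(3) a by algebra
  have e5: "p * r * (1 - r) + (q + b) * w = 0"
    using 2(1,2) a by (simp add: algebra_simps)
  define Q where "Q = x * r + w"
  have mQ: "m * Q = - p * r" using 2(1) by (simp add: Q_def)
  have bQ: "b * Q = - p * r * (x * w - 2 * r)"
    using 1(3) mQ by algebra
  have "p * (r * (x * w - 2 * r) * (1 - r) + (1 + r) * w * Q) = 0"
    using e6 bQ by algebra
  then have E2: "- r * (x * w - 2 * r) * (1 - r) = (1 + r) * w * Q"
    using pr by simp
  have "q * x * w * Q = p * (1 + r) * w * Q" using pq by simp
  then have "p * (x * r * (1 - r) * Q + (1 + r) * w * Q - x * r * (x * w - 2 * r) * w) = 0"
    using e5 bQ by algebra
  then have "x * r * (1 - r) * Q + (1 + r) * w * Q - x * r * (x * w - 2 * r) * w = 0"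
    using pr by simp
  then have "r * ((1 - r) * (x * Q - x * w + 2 * r) - x * w * (x * w - 2 * r)) = 0"
    using E2 by algebra
  then have "(1 - r) * (x * Q - x * w + 2 * r) - x * w * (x * w - 2 * r) = 0"
    using pr by simp
  define W where "W = x * w"
  have F1: "(1 - r) * r * (x\<^sup>2 + 2) = W * (W - 2 * r)"
    using \<open>(1 - r) * (x * Q - x * w + 2 * r) - x * w * (x * w - 2 * r) = 0\<close> unfolding W_def Q_def by algebra
  have F2: "2 * r\<^sup>2 * (1 - r) = 2 * W * r + w\<^sup>2 * (1 + r)"
    using E2 unfolding W_def Q_def by algebra
  have F3: "2 * r\<^sup>2 * (1 - r) * x\<^sup>2 = 2 * W * r * x\<^sup>2 + W\<^sup>2 * (1 + r)"
    using F2 unfolding W_def by algebra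
  have "(W - 2 * r) * (2 * W\<^sup>2 + (1 - r)\<^sup>2 * (W - 2 * r)) = 0"
    using F1 F3 by algebra
  moreover have "W \<noteq> 2 * r"
  proof
    assume "W = 2 * r"
    then have "(1 - r) * r * (x\<^sup>2 + 2) = 0" using F1 by simp
    moreover have "x\<^sup>2 + 2 > 0" by (simp add: add_nonneg_pos)
    ultimately have "r = 1" using pr by auto
    then have "2 * w\<^sup>2 + 4 = 0" using F2 \<open>W = 2 * r\<close> by simp
    then show False by (simp add: add_nonneg_eq_0_iff)
  qed
  ultimately have K: "2 * W\<^sup>2 + (1 - r)\<^sup>2 * (W - 2 * r) = 0" by simp
  show ?thesis
  \<comment> \<open>Here the parameter \<open>s = W / (1 - r)\<close> breaks down. This point of the
    curve gives \<open>a = p\<close> and \<open>b = q\<close>, the source of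
    \<open>F_res\<close>.\<close>
  proof (cases "r = 1")
    case True
    then have "w = 0" using K x by (simp add: W_def)
    then have "b = - 2 * m" "m * x = - p" using 1(3) 2(1) True by simp_all
    then have "x * b = x * q" using pq True by algebra
    then show ?thesis using x a True by simp
  next
    case False
    define s where "s = W / (1 - r)"
    have Ws: "W = (1 - r) * s" using False by (simp add: s_def)
    have "(1 - r)\<^sup>2 * (2 * s\<^sup>2 + (1 - r) * s - 2 * r) = 0"
      using K unfolding Ws by algebra
    then have ks: "2 * s\<^sup>2 + (1 - r) * s - 2 * r = 0" using False by simp
    define \<tau> where "\<tau> = - (2 * s + 1)"
    have s: "s = - (1 + \<tau>) / 2" by (simp add: \<tau>_def)
    have rt: "r * (3 - \<tau>) = \<tau> * (1 + \<tau>)"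
      using ks unfolding \<tau>_def by algebra
    then have t3: "3 - \<tau> \<noteq> 0" by auto
    have "(1 - r) * (r * (x\<^sup>2 + 2) - s * (W - 2 * r)) = 0"
      using F1 Ws by algebra
    then have "r * (x\<^sup>2 + 2) = s * (W - 2 * r)" using False by simp
    moreover have "W - 2 * r = - 2 * s\<^sup>2" using ks Ws by algebra
    ultimately have "x\<^sup>2 * r + 2 * r + 2 * s ^ 3 = 0" by algebra
    then have "x\<^sup>2 * (r * (3 - \<tau>)) + 2 * (r * (3 - \<tau>)) + 2 * s ^ 3 * (3 - \<tau>) = 0" by algebra
    moreover have "8 * s ^ 3 = - ((1 + \<tau>) ^ 3)"
      by (simp add: s power3_eq_cube) (simp add: algebra_simps)
    ultimately have "4 * (x\<^sup>2 * (\<tau> * (1 + \<tau>)) + 2 * (\<tau> * (1 + \<tau>))) - (1 + \<tau>) ^ 3 * (3 - \<tau>) = 0"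
      unfolding rt by algebra
    then have "(1 + \<tau>) * (4 * x\<^sup>2 * \<tau> - (1 - \<tau>) * (\<tau>\<^sup>2 + 3)) = 0" by algebra
    moreover have "1 + \<tau> \<noteq> 0" using rt t3 pr by auto
    ultimately have xt: "4 * x\<^sup>2 * \<tau> = (1 - \<tau>) * (\<tau>\<^sup>2 + 3)" by simp
    have d: "\<tau>\<^sup>2 + 3 > 0" by (simp add: add_nonneg_pos)
    have x2: "x\<^sup>2 > 0" using x by simp
    \<comment> \<open>The range of \<open>\<tau>\<close> is exactly what positivity of
      \<open>x\<^sup>2\<close> in \<open>xt\<close> allows.\<close>
    have "\<tau> > 0"
    proof (rule ccontr)
      assume "\<not> \<tau> > 0"
      then have "4 * x\<^sup>2 * \<tau> \<le> 0" "(1 - \<tau>) * (\<tau>\<^sup>2 + 3) > 0"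
        using x2 d by (simp_all add: mult_nonneg_nonpos)
      then show False using xt by simp
    qed
    moreover have "\<tau> < 1"
    proof (rule ccontr)
      assume "\<not> \<tau> < 1"
      then have "4 * x\<^sup>2 * \<tau> > 0" "(1 - \<tau>) * (\<tau>\<^sup>2 + 3) \<le> 0"
        using x2 d by (simp_all add: mult_nonpos_nonneg)
      then show False using xt by simp
    qed
    \<comment> \<open>This identifies \<open>\<kappa>\<close> as \<open>2 * x\<close>.\<close>
    moreover have "(2 * x)\<^sup>2 = (1 - \<tau>) * (\<tau>\<^sup>2 + 3) / \<tau>"
      using xt \<open>\<tau> > 0\<close> by (simp add: field_simps power2_eq_square)
    moreover define l where "l = q / (12 * (\<tau>\<^sup>2 + 3))"
    have "l * (12 * (\<tau>\<^sup>2 + 3)) = q"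
    proof -
      have "12 * (\<tau>\<^sup>2 + 3) \<noteq> 0" using d by simp
      then show ?thesis unfolding l_def by (rule nonzero_eq_divide_eq[THEN iffD1, OF _ refl])
    qed
    then have l: "l \<noteq> 0" "q = 12 * l * (\<tau>\<^sup>2 + 3)" using q by auto
    have "(1 + r) * (3 - \<tau>) = \<tau>\<^sup>2 + 3" using rt by algebra
    then have "p * (\<tau>\<^sup>2 + 3) = 12 * l * (3 - \<tau>) * x * (\<tau>\<^sup>2 + 3)"
      using pq l(2) by algebra
    then have p: "p = 6 * l * (2 * x) * (3 - \<tau>)" using d by simp
    moreover have "a = 6 * l * (2 * x) * \<tau> * (1 + \<tau>)"
      using a p rt by algebra
    moreover have "b = - 6 * l * (\<tau>\<^sup>2 + 3) * (1 + \<tau>)"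
    proof -
      have "(1 - r) * (b * x - q * x * s) = 0"
        using e6 pq Ws unfolding W_def by algebra
      then have "b * x - q * x * s = 0" using False by simp
      then have "x * (b - q * s) = 0" by (simp add: algebra_simps)
      then have bs: "b = q * s" using x by simp
      show ?thesis unfolding bs s by (subst l(2)) (simp add: field_simps)
    qed
    ultimately show ?thesis using l by blast
  qed
qed

lemma context_normal:
  assumes u: "u \<noteq> 0" "u $ 0 = 0" "S *v u = u" and v: "v \<noteq> 0" "v $ 0 = 0" "S *v v = - v"
    and Zu: "zn p q a b e *v u = m *\<^sub>R (u \<odot> v)" and Zv: "zn p q a b e *v v = - m *\<^sub>R (u \<odot> v)"
  shows "zn p q a b e \<in> F_vec \<union> F_proj \<or> (a = p \<and> b = q \<and> e = 0 \<and> q \<noteq> 0) \<or>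
    (\<exists>l \<tau> \<kappa>. l \<noteq> 0 \<and> 0 < \<tau> \<and> \<tau> < 1 \<and> \<kappa>\<^sup>2 = (1 - \<tau>) * (\<tau>\<^sup>2 + 3) / \<tau> \<and> zn p q a b e = l *\<^sub>R E_tk \<tau> \<kappa>)"
proof (cases "q = 0 \<or> m = 0")
  case True
  moreover have "zn p q a b e \<in> F_vec" if "m = 0"
    by (rule F_vecI[OF _ u(1,2)]) (use Zu that u(3) in simp_all)
  ultimately show ?thesis using zn_F_vec by auto
next
  case False
  then have q: "q \<noteq> 0" and m: "m \<noteq> 0" by simp_all
  have "u $ 4 = u $ 2" "u $ 5 = u $ 3" "u $ 6 = 0" "u $ 7 = 0"
    using S_coords(5-8)[of u] unfolding u(3) by simp_all
  then have "u = v8 0 (u $ 1) (u $ 2) (u $ 3) (u $ 2) (u $ 3) 0 0"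
    using u(2) by (simp add: vec8_eq_iff)
  then obtain u1 u2 u3 where U: "u = v8 0 u1 u2 u3 u2 u3 0 0" by (rule that)
  have "v $ 1 = 0" "v $ 4 = - (v $ 2)" "v $ 5 = - (v $ 3)"
    using S_coords(2,5,6)[of v] unfolding v(3) vector_uminus_component by linarith+
  then have "v = v8 0 0 (v $ 2) (v $ 3) (- (v $ 2)) (- (v $ 3)) (v $ 6) (v $ 7)"
    using v(2) by (simp add: vec8_eq_iff)
  then obtain v2 v3 v6 v7 where V: "v = v8 0 0 v2 v3 (- v2) (- v3) v6 v7" by (rule that)
  note hu = Zu[unfolded U V omult_v8 zn_v8 v8_scale v8_eq_iff]
    and hv = Zv[unfolded U V omult_v8 zn_v8 v8_scale v8_eq_iff]
  \<comment> \<open>The product \<open>u \<odot> v\<close> is negated by \<open>S\<close>, so its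
    \<open>e1\<close>-coordinate is 0, whereas that of the image of \<open>u\<close> is
    \<open>q * u3\<close>; the same holds for \<open>v\<close>.\<close>
  have "q * u3 = 0"
    using hu by (elim conjE) algebra
  moreover have "q * v3 = 0"
    using hv by (elim conjE) algebra
  ultimately have z: "u3 = 0" "v3 = 0" using q by simp_all
  have u2: "u2 \<noteq> 0"
  proof
    assume "u2 = 0"
    then have "u1 \<noteq> 0" using u(1) U z by (auto simp: v8_0 v8_eq_iff)
    have "m * (u1 * v2) = 0"
      using hu \<open>u2 = 0\<close> z by (elim conjE) algebra
    moreover have "m * (u1 * v7) = 0"
      using hu \<open>u2 = 0\<close> z by (elim conjE) algebra
    moreover have "m * (u1 * v6) = 0"
      using hu \<open>u2 = 0\<close> z by (elim conjE) algebra
    ultimately have "v = 0" using m \<open>u1 \<noteq> 0\<close> V z by (simp add: v8_0)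
    then show False using v(1) by simp
  qed
  have "m * (u2 * v6) = 0"
    using hu z by (elim conjE) algebra
  then have v6: "v6 = 0" using m u2 by simp
  have "e * u2 = 0"
    using hu z v6 by (elim conjE) algebra
  then have e: "e = 0" using u2 by simp
  \<comment> \<open>Scaling both vectors by \<open>1 / u2\<close> gives the shape assumed in
    \<open>context_arith\<close>; the product scales quadratically, and \<open>M\<close> absorbs the
    remaining factor.\<close>
  define x r w M where "x = u1 / u2" and "r = v2 / u2" and "w = v7 / u2" and "M = m * u2"
  have n: "u1 = x * u2" "v2 = r * u2" "v7 = w * u2" using u2 by (simp_all add: x_def r_def w_def)
  have M: "M \<noteq> 0" using m u2 by (simp add: M_def)
  have c: "s = t" if "u2 * s = u2 * t" for s t using that u2 by simp
  have "p - q * x = M * (x * r + w)"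
    by (rule c, use hu z v6 e in \<open>unfold n M_def, elim conjE, algebra\<close>)
  moreover have "a = - M * (x * r + w)"
    by (rule c, use hu z v6 e in \<open>unfold n M_def, elim conjE, algebra\<close>)
  moreover have "b = M * (x * w - 2 * r)"
    by (rule c, use hu z v6 e in \<open>unfold n M_def, elim conjE, algebra\<close>)
  moreover have "p * r = - M * (x * r + w)"
    by (rule c, use hv z v6 e in \<open>unfold n M_def, elim conjE, algebra\<close>)
  moreover have "- a * r + (q + b) * w = M * (x * r + w)"
    by (rule c, use hv z v6 e in \<open>unfold n M_def, elim conjE, algebra\<close>)
  moreover have "b * r + (p + a) * w = M * (x * w - 2 * r)"
    by (rule c, use hv z v6 e in \<open>unfold n M_def, elim conjE, algebra\<close>)
  moreover have "\<not> (r = 0 \<and> w = 0)"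
  proof
    assume "r = 0 \<and> w = 0"
    then have "v = 0" using V z v6 n by (simp add: v8_0)
    then show False using v(1) by simp
  qed
  ultimately consider "p = 0 \<and> a = 0" | "a = p \<and> b = q" | l \<tau> \<kappa> where "l \<noteq> 0" "0 < \<tau>" "\<tau> < 1"
    "\<kappa>\<^sup>2 = (1 - \<tau>) * (\<tau>\<^sup>2 + 3) / \<tau>" "p = 6 * l * \<kappa> * (3 - \<tau>)" "q = 12 * l * (\<tau>\<^sup>2 + 3)"
    "a = 6 * l * \<kappa> * \<tau> * (1 + \<tau>)" "b = - 6 * l * (\<tau>\<^sup>2 + 3) * (1 + \<tau>)"
    using context_arith[OF M q, of p x r w a b] by blast
  then show ?thesis
  proof cases
    case 1
    then show ?thesis using zn_F_proj e by simp
  next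
    case 2
    then show ?thesis using e q by simp
  next
    case 3
    have "zn p q a b e = l *\<^sub>R E_tk \<tau> \<kappa>"
      by (simp add: zn_def E_tk_ka ka_scale ka_eq_iff 3(5-8) e) (simp add: algebra_simps power2_eq_square)
    then show ?thesis using 3 by blast
  qed
qed

section \<open>Undoing the normalising rotation\<close>

context
  fixes c s :: real and Z
  assumes cs: "c * c + s * s = 1" and Z: "Z \<in> kA"
begin

lemma Rot_inv_Rot: "Rot c (- s) *v (Rot c s *v v) = v" "Rot c s *v (Rot c (- s) *v v) = v"
  using G2_inv_left_vec[OF Rot_G2[OF cs]] G2_inv_right_vec[OF Rot_G2[OF cs]] by (simp_all add: Rot_inv[OF cs])

lemma Rot_S_vec: "Rot c t *v (S *v v) = S *v (Rot c t *v v)"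
  by (simp add: matrix_vector_mul_assoc Rot_S)

lemma Ad_Rot_vec: "Z *v (Rot c (- s) *v v) = Rot c (- s) *v (Ad (Rot c s) Z *v v)"
proof -
  have "Rot c s *v (Z *v (Rot c (- s) *v v)) = Ad (Rot c s) Z *v v"
    using Ad_vec[OF Rot_G2[OF cs], of Z "Rot c (- s) *v v"] by (simp add: Rot_inv_Rot)
  then show ?thesis by (metis Rot_inv_Rot(1))
qed

lemma F_vec_Rot: "Ad (Rot c s) Z \<in> F_vec \<Longrightarrow> Z \<in> F_vec"
proof -
  assume "Ad (Rot c s) Z \<in> F_vec"
  then obtain v where v: "v \<noteq> 0" "v $ 0 = 0" "Ad (Rot c s) Z *v v = 0" "Ad (Rot c s) Z *v (S *v v) = 0"
    by (rule F_vecE)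
  show ?thesis
  proof (rule F_vecI[OF Z])
    show "Rot c (- s) *v v \<noteq> 0" using v(1) Rot_inv_Rot(2)[of v] by force
    show "(Rot c (- s) *v v) $ 0 = 0" using v(2) by (simp add: mult_v8 inner_8 Rot_def)
    show "Z *v (Rot c (- s) *v v) = 0" "Z *v (S *v (Rot c (- s) *v v)) = 0"
      unfolding Rot_S_vec[symmetric] Ad_Rot_vec v(3,4) by simp_all
  qed
qed

lemma F_proj_Rot: "Ad (Rot c s) Z \<in> F_proj \<Longrightarrow> Z \<in> F_proj"
proof -
  assume "Ad (Rot c s) Z \<in> F_proj"
  then obtain c0 s0 where nz: "(c0, s0) \<noteq> (0, 0)" and k: "Ad (Rot c s) Z \<in> kH (H_cs c0 s0)"
    by (auto simp: F_proj_def)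
  \<comment> \<open>The point \<open>[c0 : s0]\<close> turned back by the angle of
    \<open>(c, s)\<close>; the third generator of the context turns by the double angle.\<close>
  let ?c = "c * c0 + s * s0" and ?s = "c * s0 - s * c0"
  have gen: "Rot c (- s) *v oe 0 = oe 0"
    "Rot c (- s) *v (c0 *\<^sub>R oe 2 + s0 *\<^sub>R oe 3) = ?c *\<^sub>R oe 2 + ?s *\<^sub>R oe 3"
    "Rot c (- s) *v (c0 *\<^sub>R oe 4 + s0 *\<^sub>R oe 5) = ?c *\<^sub>R oe 4 + ?s *\<^sub>R oe 5"
    "Rot c (- s) *v ((c0\<^sup>2 - s0\<^sup>2) *\<^sub>R oe 6 + (2 * c0 * s0) *\<^sub>R oe 7) = (?c\<^sup>2 - ?s\<^sup>2) *\<^sub>R oe 6 + (2 * ?c * ?s) *\<^sub>R oe 7"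
    by (simp_all add: oe_v8 v8_scale v8_add Rot_v8 v8_eq_iff) (simp_all add: algebra_simps power2_eq_square)
  have "(\<lambda>x. Rot c (- s) *v x) ` H_cs c0 s0 = span ((\<lambda>x. Rot c (- s) *v x) `
      {oe 0, c0 *\<^sub>R oe 2 + s0 *\<^sub>R oe 3, c0 *\<^sub>R oe 4 + s0 *\<^sub>R oe 5, (c0\<^sup>2 - s0\<^sup>2) *\<^sub>R oe 6 + (2 * c0 * s0) *\<^sub>R oe 7})"
    unfolding H_cs_def by (rule linear_span_image[symmetric]) simp
  also have "\<dots> = H_cs ?c ?s"
    unfolding H_cs_def by (simp only: image_insert image_empty gen)
  finally have "H_cs ?c ?s = (\<lambda>x. Rot c (- s) *v x) ` H_cs c0 s0" ..
  moreover have "Z *v (Rot c (- s) *v x) \<in> (\<lambda>x. Rot c (- s) *v x) ` H_cs c0 s0" if "x \<in> H_cs c0 s0" for x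
    unfolding Ad_Rot_vec using that k by (auto simp: kH_def)
  ultimately have "Z \<in> kH (H_cs ?c ?s)"
    using Z by (auto simp: kH_def kA_def)
  moreover have "(?c, ?s) \<noteq> (0, 0)"
  proof
    assume z: "(?c, ?s) = (0, 0)"
    have "c0 = (c * c + s * s) * c0" "s0 = (c * c + s * s) * s0" using cs by simp_all
    moreover have "(c * c + s * s) * c0 = c * ?c - s * ?s" "(c * c + s * s) * s0 = s * ?c + c * ?s"
      by (simp_all add: algebra_simps)
    ultimately show False using z nz by simp
  qed
  ultimately show ?thesis using Z unfolding F_proj_def by blast
qed

lemma Ad_Rot_eqD: "Ad (Rot c s) Z = W \<Longrightarrow> Z = Ad (Rot c (- s)) W"
  using Ad_inv_left[OF Rot_G2[OF cs], of Z] by (simp add: Rot_inv[OF cs])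

lemma F_res_Rot: "Ad (Rot c s) Z = zn p q p q 0 \<Longrightarrow> q \<noteq> 0 \<Longrightarrow> Z \<in> F_res"
proof -
  assume eq: "Ad (Rot c s) Z = zn p q p q 0" and q: "q \<noteq> 0"
  \<comment> \<open>\<open>Z_hat\<close> has cubic coefficients on its second and third coordinates,
    so its parameter has to be a cube root; the real one exists for either sign of
    \<open>q\<close>.\<close>
  define r where "r = root 3 (q / 2)"
  have r: "r ^ 3 = q / 2" by (simp add: r_def odd_real_root_pow)
  then have r0: "r \<noteq> 0" using q by auto
  have cs': "c * c + (- s) * (- s) = 1" using cs by simp
  have n: "(r * c)\<^sup>2 + (- r * s)\<^sup>2 = r\<^sup>2"
    using cs by algebra
  have "Z = Z_hat (p / 2 / r\<^sup>2) (r * c) (- r * s)"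
    unfolding Ad_Rot_eqD[OF eq] zn_def Ad_Rot[OF cs'] Z_hat_ka n ka_eq_iff
    using r0 r by (auto simp: power2_eq_square power3_eq_cube algebra_simps)
  moreover have "(r * c)\<^sup>2 + (- r * s)\<^sup>2 > 0" unfolding n using r0 by simp
  ultimately show ?thesis unfolding F_res_def by blast
qed

lemma F_rf_Rot:
  assumes "Ad (Rot c s) Z = l *\<^sub>R E_tk \<tau> \<kappa>" "l \<noteq> 0" "0 < \<tau>" "\<tau> < 1" "\<kappa>\<^sup>2 = (1 - \<tau>) * (\<tau>\<^sup>2 + 3) / \<tau>"
  shows "Z \<in> F_rf"
proof -
  obtain t where "c = cos t" "- s = sin t"
    using sincos_total_2pi[of c "- s"] cs by (auto simp: power2_eq_square)
  then have "Z = l *\<^sub>R Ad (g_theta t) (E_tk \<tau> \<kappa>)"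
    using Ad_Rot_eqD[OF assms(1)] by (simp add: g_theta_Rot Ad_scale)
  then show ?thesis using assms(2-) unfolding F_rf_def by blast
qed

end

lemma resonant_families:
  assumes Z: "Z \<in> kA" and "resonant Z (Ad S Z)"
  shows "Z \<in> F_vec \<union> F_proj"
proof -
  obtain c s p q a b e where cs: "c * c + s * s = 1" and eq: "Ad (Rot c s) Z = zn p q a b e"
    using normal_form[OF Z] by blast
  note G = Rot_G2[OF cs]
  have Y: "Ad S (Ad (Rot c s) Z) = Ad (Rot c s) (Ad S Z)"
    by (simp add: Rot_S G S_in_G2 flip: Ad_mult)
  have "resonant (Ad (matrix_inv (Rot c s)) (Ad (Rot c s) Z)) (Ad (matrix_inv (Rot c s)) (Ad (Rot c s) (Ad S Z)))"
    using assms(2) by (simp add: Ad_inv_left G)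
  then have "resonant (Ad (Rot c s) Z) (Ad S (Ad (Rot c s) Z))"
    unfolding Y by (rule resonant_Ad[OF G2_inv[OF G]])
  then have "Ad (Rot c s) Z \<in> F_vec \<union> F_proj"
    unfolding eq by (rule resonant_normal)
  then show ?thesis using F_vec_Rot[OF cs Z] F_proj_Rot[OF cs Z] by blast
qed

lemma context_families:
  assumes Z: "Z \<in> kA" and u: "u \<noteq> 0" "u $ 0 = 0" "S *v u = u" and v: "v \<noteq> 0" "v $ 0 = 0" "S *v v = - v"
    and Zu: "Z *v u = m *\<^sub>R (u \<odot> v)" and Zv: "Z *v v = - m *\<^sub>R (u \<odot> v)"
  shows "Z \<in> F_vec \<union> F_proj \<union> F_res \<union> F_rf"
proof -
  obtain c s p q a b e where cs: "c * c + s * s = 1" and eq: "Ad (Rot c s) Z = zn p q a b e"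
    using normal_form[OF Z] by blast
  note G = Rot_G2[OF cs]
  let ?R = "\<lambda>v. Rot c s *v v"
  have inj: "?R x = 0 \<Longrightarrow> x = 0" for x using Rot_inv_Rot(1)[OF cs Z, of x] by simp
  have S: "S *v (?R x) = ?R (S *v x)" for x by (simp add: Rot_S matrix_vector_mul_assoc)
  have z0: "(?R x) $ 0 = x $ 0" for x by (simp add: mult_v8 inner_8 Rot_def)
  have "zn p q a b e *v (?R u) = m *\<^sub>R ((?R u) \<odot> (?R v))" "zn p q a b e *v (?R v) = - m *\<^sub>R ((?R u) \<odot> (?R v))"
    unfolding eq[symmetric] Ad_vec[OF G] Zu Zv G2_omult[OF G, symmetric]
    by (simp_all add: matrix_vector_mult_scaleR del: scaleR_minus_left)
  note R = this
  have R': "?R u \<noteq> 0" "(?R u) $ 0 = 0" "S *v (?R u) = ?R u" "?R v \<noteq> 0" "(?R v) $ 0 = 0" "S *v (?R v) = - ?R v"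
    using inj[of u] inj[of v] u v unfolding S z0 by (auto simp: vec.neg)
  consider "Ad (Rot c s) Z \<in> F_vec \<union> F_proj" | "Ad (Rot c s) Z = zn p q p q 0" "q \<noteq> 0"
    | l \<tau> \<kappa> where "l \<noteq> 0" "0 < \<tau>" "\<tau> < 1" "\<kappa>\<^sup>2 = (1 - \<tau>) * (\<tau>\<^sup>2 + 3) / \<tau>" "Ad (Rot c s) Z = l *\<^sub>R E_tk \<tau> \<kappa>"
    using context_normal[OF R' R] unfolding eq by blast
  then show ?thesis
  proof cases
    case 1
    then show ?thesis using F_vec_Rot[OF cs Z] F_proj_Rot[OF cs Z] by blast
  next
    case 2
    then show ?thesis using F_res_Rot[OF cs Z] by blast
  next
    case 3
    then show ?thesis using F_rf_Rot[OF cs Z] by blast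
  qed
qed

section \<open>Invariant quaternionic contexts\<close>

lemma norm_omult: "(x \<odot> y) \<bullet> (x \<odot> y) = (x \<bullet> x) * (y \<bullet> y)"
  by (simp add: inner_8 omult_coords algebra_simps)

lemma inner_omult_left: "x \<bullet> (x \<odot> y) = y $ 0 * (x \<bullet> x)"
  and inner_omult_right: "y \<bullet> (x \<odot> y) = x $ 0 * (y \<bullet> y)"
  by (simp_all add: inner_8 omult_coords algebra_simps)

context
  fixes g assumes g: "g \<in> G2"
begin

lemma G2_oe_0: "g *v oe 0 = oe 0"
proof -
  have "(g *v oe 0) \<odot> (g *v x) = g *v x" for x
    by (simp add: oe_0_omult flip: G2_omult[OF g])
  from this[of "matrix_inv g *v oe 0"] show ?thesis
    by (simp add: G2_inv_right_vec[OF g] omult_oe_0)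
qed

text \<open>An imaginary octonion is characterised by its square being a nonpositive real.\<close>

lemma G2_imaginary: "x $ 0 = 0 \<Longrightarrow> (g *v x) $ 0 = 0"
proof (rule ccontr)
  assume x: "x $ 0 = 0" and f: "(g *v x) $ 0 \<noteq> 0"
  let ?f = "g *v x"
  have "x \<odot> x = - (x \<bullet> x) *\<^sub>R oe 0"
    using x by (simp add: vec8_eq_iff omult_coords inner_8)
  then have sq: "?f \<odot> ?f = - (x \<bullet> x) *\<^sub>R oe 0"
    by (simp add: matrix_vector_mult_scaleR G2_oe_0 vec.neg flip: G2_omult[OF g])
  have "?f $ i = 0" if "i \<noteq> 0" for i
    using anticommutator[OF that, of ?f ?f] f that by (simp add: sq)
  then have "(?f \<odot> ?f) $ 0 = (?f $ 0)\<^sup>2"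
    by (simp add: omult_coords power2_eq_square)
  then have "(?f $ 0)\<^sup>2 = - (x \<bullet> x)" by (simp add: sq)
  then show False using f by (metis add.inverse_inverse inner_ge_zero neg_0_le_iff_le power2_less_eq_zero_iff)
qed

lemma G2_nth_0: "(g *v x) $ 0 = x $ 0"
proof -
  have "(g *v (x - x $ 0 *\<^sub>R oe 0)) $ 0 = 0"
    by (rule G2_imaginary) simp
  then show ?thesis
    by (simp add: matrix_vector_mult_diff_distrib matrix_vector_mult_scaleR G2_oe_0)
qed

text \<open>Automorphisms preserve real parts, and the inner product is recovered from the real part
  of a product.\<close>

lemma G2_inner: "(g *v x) \<bullet> (g *v y) = x \<bullet> y"
  using omult_0[of "g *v x" "g *v y"] omult_0[of x y] G2_nth_0[of "x \<odot> y"]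
  by (simp add: G2_omult[OF g] G2_nth_0)

end

text \<open>These are the imaginary parts of quaternionic contexts. Closure is required only for
  orthogonal pairs because the product of other imaginary pairs has a nonzero real part.\<close>

definition assoc_plane :: "octonion set \<Rightarrow> bool" where
  "assoc_plane W \<longleftrightarrow> subspace W \<and> dim W = 3 \<and> (\<forall>x\<in>W. x $ 0 = 0) \<and>
     (\<forall>x\<in>W. \<forall>y\<in>W. x \<bullet> y = 0 \<longrightarrow> x \<odot> y \<in> W)"

text \<open>The vectors \<open>u\<close>, \<open>v\<close>, \<open>u \<odot> v\<close> are
  orthogonal, and nonzero by multiplicativity of the norm. So two orthogonal vectors determine the
  plane, and distinct associative planes share at most a line.\<close>

lemma assoc_plane_span:
  assumes W: "assoc_plane W" and "u \<in> W" "v \<in> W" "u \<noteq> 0" "v \<noteq> 0" "u \<bullet> v = 0"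
  shows "W = span {u, v, u \<odot> v}"
proof -
  have z: "u $ 0 = 0" "v $ 0 = 0" and uv: "u \<odot> v \<in> W" and dim: "subspace W" "dim W = 3"
    using assms by (auto simp: assoc_plane_def)
  have o: "u \<bullet> (u \<odot> v) = 0" "v \<bullet> (u \<odot> v) = 0"
    by (simp_all add: inner_omult_left inner_omult_right z)
  have nz: "u \<odot> v \<noteq> 0"
    using norm_omult[of u v] assms by auto
  have "u \<noteq> v" "u \<noteq> u \<odot> v" "v \<noteq> u \<odot> v"
    using assms o by auto
  then have card: "card {u, v, u \<odot> v} = 3" by simp
  have "pairwise orthogonal {u, v, u \<odot> v}"
    using o assms by (auto simp: pairwise_def orthogonal_def inner_commute)
  then have "independent {u, v, u \<odot> v}"
    using assms nz by (intro pairwise_orthogonal_independent) auto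
  then have "dim {u, v, u \<odot> v} = 3"
    using card by (simp add: dim_eq_card_independent)
  then have "span {u, v, u \<odot> v} = span W"
    using assms uv dim by (intro dim_eq_span) auto
  then show ?thesis
    using dim(1) by (metis span_eq_iff)
qed

lemma assoc_plane_image:
  assumes g: "g \<in> G2" and W: "assoc_plane W"
  shows "assoc_plane ((\<lambda>x. g *v x) ` W)"
proof -
  have "inj (\<lambda>x. g *v x)"
    using G2_inv_left_vec[OF g] by (rule inj_on_inverseI)
  then have "dim ((\<lambda>x. g *v x) ` W) = dim W"
    by (intro dim_image_eq) (auto intro: inj_on_subset)
  then show ?thesis
    using W by (auto simp: assoc_plane_def G2_nth_0[OF g] G2_inner[OF g] linear_subspace_image simp flip: G2_omult[OF g])
qed

lemma assoc_plane_HA: "assoc_plane {x \<in> HA. x $ 0 = 0}"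
proof -
  have eq: "{x \<in> HA. x $ 0 = 0} = span {oe 1, oe 2, oe 3}"
  proof
    show "span {oe 1, oe 2, oe 3} \<subseteq> {x \<in> HA. x $ 0 = 0}"
      by (rule span_minimal) (auto simp: HA_eq subspace_def)
    show "{x \<in> HA. x $ 0 = 0} \<subseteq> span {oe 1, oe 2, oe 3}"
    proof
      fix x assume "x \<in> {x \<in> HA. x $ 0 = 0}"
      then have "x = x $ 1 *\<^sub>R oe 1 + x $ 2 *\<^sub>R oe 2 + x $ 3 *\<^sub>R oe 3"
        by (simp add: HA_eq vec8_eq_iff)
      also have "\<dots> \<in> span {oe 1, oe 2, oe 3}"
        by (intro span_add span_scale span_base) auto
      finally show "x \<in> span {oe 1, oe 2, oe 3}" .
    qed
  qed
  have ne: "oe 1 \<noteq> oe 2" "oe 1 \<noteq> oe 3" "oe 2 \<noteq> oe 3"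
    by (simp_all add: oe_v8 v8_eq_iff)
  then have "independent {oe 1, oe 2, oe 3}"
    by (intro pairwise_orthogonal_independent)
      (auto simp: pairwise_def orthogonal_def inner_8 vec8_eq_iff)
  then have "dim (span {oe 1, oe 2, oe 3}) = 3"
    using ne by (simp add: dim_eq_card_independent)
  then have "dim {x \<in> HA. x $ 0 = 0} = 3" by (simp add: eq)
  moreover have "subspace {x \<in> HA. x $ 0 = 0}" by (simp add: eq)
  ultimately show ?thesis
    by (auto simp: assoc_plane_def HA_eq omult_coords inner_8)
qed

text \<open>Two distinct invariant associative planes meet in a fixed line, or in \<open>0\<close>, in which case the line
  orthogonal to their sum is fixed.\<close>

lemma assoc_planes_fixed_vector:
  assumes W: "assoc_plane W" "assoc_plane W'" "W \<noteq> W'"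
    and M: "\<And>M. M \<in> A \<Longrightarrow> M \<in> g2 \<and> (\<lambda>x. M *v x) ` W \<subseteq> W \<and> (\<lambda>x. M *v x) ` W' \<subseteq> W'"
  obtains v where "v \<noteq> 0" "v $ 0 = 0" "\<And>M. M \<in> A \<Longrightarrow> M *v v = 0"
proof -
  have sub: "subspace W" "subspace W'" "dim W = 3" "dim W' = 3" and im: "\<And>x. x \<in> W \<union> W' \<Longrightarrow> x $ 0 = 0"
    using W by (auto simp: assoc_plane_def)
  have skew: "(M *v x) \<bullet> x = 0" if "M \<in> A" for M x
    using g2_skew[of M x x] M[OF that] by (simp add: inner_commute)
  show thesis
  proof (cases "W \<inter> W' = {0}")
    case True
    let ?U = "{x + y | x y. x \<in> W \<and> y \<in> W'}"
    have U: "subspace ?U" by (rule subspace_sums) (rule sub)+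
    have dU: "dim ?U = 6"
      using dim_sums_Int[OF sub(1,2)] True sub by simp
    let ?T = "{x. oe 0 \<bullet> x = 0}"
    have T: "x \<in> ?T \<longleftrightarrow> x $ 0 = 0" for x by (simp add: inner_8)
    have "oe 0 \<noteq> 0" by (simp add: vec8_eq_iff)
    then have dT: "dim ?T = 7" by (simp add: dim_hyperplane)
    have sT: "subspace ?T" by (rule subspace_hyperplane)
    have UT: "?U \<subseteq> ?T" by (auto simp: inner_8 im)
    then have "span ?U \<subset> span ?T"
      using dU dT U sT by (metis (no_types, lifting) dim_span less_irrefl numeral_eq_iff psubsetI semiring_norm(89) span_mono)
    then obtain v where v: "v \<noteq> 0" "v \<in> span ?T" "\<And>y. y \<in> span ?U \<Longrightarrow> orthogonal v y"
      using orthogonal_to_subspace_exists_gen by blast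
    have v0: "v $ 0 = 0" using v(2) sT T by (metis span_eq_iff)
    have vU: "v \<bullet> y = 0" if "y \<in> ?U" for y
      using v(3)[OF span_base[OF that]] by (simp add: orthogonal_def)
    have "v \<notin> span ?U"
      using v(1) v(3)[of v] by (auto simp: orthogonal_self)
    then have "dim (insert v ?U) = 7" using dU by (simp add: dim_insert)
    moreover have "insert v ?U \<subseteq> ?T" using UT v0 T by blast
    ultimately have sp: "span (insert v ?U) = span ?T"
      using dT by (intro dim_eq_span) auto
    \<comment> \<open>A skew map preserving \<open>?U\<close> also preserves the orthogonal line of
      \<open>v\<close> within the imaginary octonions, and a skew map kills an invariant
      line.\<close>
    have "M *v v = 0" if A: "M \<in> A" for M
    proof -
      let ?w = "M *v v"
      have "?w \<in> span (insert v ?U)"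
        unfolding sp using T g2_nth_0[of M v] M[OF A] by (auto intro: span_base)
      then obtain k where "?w - k *\<^sub>R v \<in> span ?U" by (auto simp: span_insert)
      then have "?w - k *\<^sub>R v \<in> ?U" using U by (simp only: span_eq_iff[THEN iffD2])
      then obtain a b where ab: "?w - k *\<^sub>R v = a + b" "a \<in> W" "b \<in> W'" by blast
      have "M *v a \<in> W" "M *v b \<in> W'" using M[OF A] ab(2,3) by blast+
      then have "M *v (?w - k *\<^sub>R v) \<in> ?U"
        unfolding ab(1) matrix_vector_right_distrib by blast
      then have "v \<bullet> (M *v (?w - k *\<^sub>R v)) = 0" by (rule vU)
      then have "?w \<bullet> (?w - k *\<^sub>R v) = 0"
        using g2_skew[of M v "?w - k *\<^sub>R v"] M[OF A] by simp
      then have "?w \<bullet> ?w = 0" using skew[OF A, of v] by (simp add: inner_diff_right)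
      then show ?thesis by simp
    qed
    then show thesis using that v(1) v0 by blast
  next
    case False
    then obtain v where v: "v \<in> W" "v \<in> W'" "v \<noteq> 0"
      using sub subspace_0 by blast
    have "W \<inter> W' \<subseteq> span {v}"
    proof (rule ccontr)
      assume "\<not> W \<inter> W' \<subseteq> span {v}"
      then obtain u where u: "u \<in> W" "u \<in> W'" "u \<notin> span {v}" by blast
      define w where "w = u - ((u \<bullet> v) / (v \<bullet> v)) *\<^sub>R v"
      have w: "w \<in> W" "w \<in> W'" using u v sub by (simp_all add: w_def subspace_diff subspace_scale)
      have "w \<noteq> 0" using u(3) by (auto simp: w_def span_singleton)
      moreover have "v \<bullet> w = 0" using v(3) by (simp add: w_def inner_diff_right inner_commute)
      ultimately have "W = W'"
        using assoc_plane_span[OF W(1) v(1) w(1) v(3)] assoc_plane_span[OF W(2) v(2) w(2) v(3)] by simp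
      then show False using W(3) by simp
    qed
    have "M *v v = 0" if A: "M \<in> A" for M
    proof -
      have "M *v v \<in> W \<inter> W'" using M[OF A] v by auto
      then obtain k where k: "M *v v = k *\<^sub>R v"
        using \<open>W \<inter> W' \<subseteq> span {v}\<close> by (auto simp: span_singleton)
      then have "k * (v \<bullet> v) = 0" using skew[OF A, of v] by simp
      then show ?thesis using k v(3) by simp
    qed
    then show thesis using that v im by blast
  qed
qed

lemma invariant_context:
  assumes Z: "Z \<in> kA" and g: "g \<in> G2" and inv: "Ad (matrix_inv g) Z \<in> kA" "Ad (matrix_inv g) (Ad S Z) \<in> kA"
  shows "Z \<in> F_vec \<union> F_proj \<union> F_res \<union> F_rf"
proof -
  let ?W0 = "{x \<in> HA. x $ 0 = 0}" and ?Y = "Ad S Z"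
  define W where "W = (\<lambda>x. g *v x) ` ?W0"
  define W' where "W' = (\<lambda>x. S *v x) ` W"
  have W: "assoc_plane W" "assoc_plane W'"
    unfolding W'_def W_def by (intro assoc_plane_image assoc_plane_HA g S_in_G2)+
  have Zg: "Z \<in> g2" "?Y \<in> g2" using Z by (auto simp: kA_def kH_def Ad_g2 S_in_G2)
  have inv_W: "(\<lambda>x. M *v x) ` W \<subseteq> W" if M: "Ad (matrix_inv g) M \<in> kA" for M
  proof -
    have "M *v (g *v x) = g *v (Ad (matrix_inv g) M *v x)" for x
      using Ad_vec[OF g, of "Ad (matrix_inv g) M" x] by (simp add: Ad_inv_right g)
    moreover have "Ad (matrix_inv g) M *v x \<in> ?W0" if "x \<in> ?W0" for x
      using M that g2_nth_0[of "Ad (matrix_inv g) M" x] by (auto simp: kA_def kH_def)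
    ultimately show ?thesis by (auto simp: W_def)
  qed
  \<comment> \<open>Conjugation by \<open>S\<close> exchanges \<open>Z\<close> and
    \<open>?Y\<close>, so invariance of \<open>W\<close> under both passes to
    \<open>W'\<close>.\<close>
  have "Z *v (S *v x) = S *v (?Y *v x)" "?Y *v (S *v x) = S *v (Z *v x)" for x
    by (simp_all add: Ad_S_vec S_involution)
  then have inv_W': "(\<lambda>x. Z *v x) ` W' \<subseteq> W'" "(\<lambda>x. ?Y *v x) ` W' \<subseteq> W'"
    using inv_W[OF inv(1)] inv_W[OF inv(2)] by (auto simp: W'_def image_subset_iff)
  have vec: "Z \<in> F_vec" if "v \<noteq> 0" "v $ 0 = 0" "Z *v v = 0" "?Y *v v = 0" for v
  proof (rule F_vecI[OF Z that(1-3)])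
    show "Z *v (S *v v) = 0"
      using that(4) S_involution[of "Z *v (S *v v)"] by (simp add: Ad_S_vec)
  qed
  show ?thesis
  proof (cases "W = W'")
    case False
    then obtain v where "v \<noteq> 0" "v $ 0 = 0" "\<And>M. M \<in> {Z, ?Y} \<Longrightarrow> M *v v = 0"
      using assoc_planes_fixed_vector[OF W False, of "{Z, ?Y}"] inv_W[OF inv(1)] inv_W[OF inv(2)] inv_W' Zg
      by blast
    then show ?thesis using vec by blast
  next
    case True
    have sub: "subspace W" and im: "\<And>x. x \<in> W \<Longrightarrow> x $ 0 = 0"
      using W(1) by (auto simp: assoc_plane_def)
    obtain x1 x2 x3 y1 y2 y3 where X: "Ad (matrix_inv g) Z = ka x1 x2 x3 y1 y2 y3"
      using inv(1) by (auto simp: kA_iff)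
    \<comment> \<open>On the imaginary part of \<open>HA\<close>, \<open>ka\<close> acts as twice
      the cross product with \<open>(x1, x2, x3)\<close> and therefore kills this axis.\<close>
    obtain k0 where k0: "k0 \<noteq> 0" "k0 \<in> ?W0" "Ad (matrix_inv g) Z *v k0 = 0"
    proof (cases "x1 = 0 \<and> x2 = 0 \<and> x3 = 0")
      case True
      then show thesis
        by (intro that[of "oe 1"]) (simp_all add: X oe_v8 ka_v8 HA_eq v8_0 v8_eq_iff)
    next
      case False
      then show thesis
        by (intro that[of "v8 0 x1 x2 x3 0 0 0 0"]) (simp_all add: X ka_v8 HA_eq v8_0 v8_eq_iff)
    qed
    define k where "k = g *v k0"
    have "matrix_inv g *v k = k0" by (simp add: k_def G2_inv_left_vec[OF g])
    then have k: "k \<in> W" "k \<noteq> 0" using k0 by (auto simp: k_def W_def)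
    have Zk: "Z *v k = 0"
      using Ad_vec[OF g, of "Ad (matrix_inv g) Z" k0] k0(3) by (simp add: k_def Ad_inv_right g)
    have Sk: "S *v k \<in> W" using k(1) True unfolding W'_def by blast
    define u v where "u = k + S *v k" and "v = k - S *v k"
    have uv: "u \<in> W" "v \<in> W" using k Sk sub by (simp_all add: u_def v_def subspace_add subspace_diff)
    have Su: "S *v u = u" "S *v v = - v"
      by (simp_all add: u_def v_def matrix_vector_right_distrib matrix_vector_mult_diff_distrib S_involution add.commute)
    have k0': "k $ 0 = 0" using im k(1) by blast
    have Zuv: "Z *v v = - (Z *v u)"
      by (simp add: u_def v_def matrix_vector_right_distrib matrix_vector_mult_diff_distrib Zk)
    show ?thesis
    proof (cases "u = 0 \<or> v = 0")
      case True
      then have "S *v k = k \<or> S *v k = - k"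
        by (auto simp: u_def v_def add_eq_0_iff)
      then have "Z *v (S *v k) = 0" using Zk by (auto simp: vec.neg)
      then have "Z \<in> F_vec" using F_vecI[OF Z k(2) k0' Zk] by blast
      then show ?thesis by blast
    next
      case False
      have o: "u \<bullet> v = 0"
        using G2_inner[OF S_in_G2, of u v] unfolding Su by simp
      have sp: "W = span {u, v, u \<odot> v}"
        using assoc_plane_span[OF W(1) uv] False o by blast
      have "Z *v u \<in> W" using inv_W[OF inv(1)] uv by blast
      then have "Z *v u \<in> span (insert u (insert v {u \<odot> v}))" by (simp only: sp)
      then obtain a b m where abm: "Z *v u = a *\<^sub>R u + b *\<^sub>R v + m *\<^sub>R (u \<odot> v)"
        by (auto simp: span_insert span_singleton algebra_simps)
      have z: "u $ 0 = 0" "v $ 0 = 0" using im uv by blast+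
      \<comment> \<open>Skewness removes the \<open>u\<close>-component of \<open>Z *v u\<close>.
        Since \<open>Z *v v\<close> is opposite to \<open>Z *v u\<close>, skewness at
        \<open>v\<close> removes the \<open>v\<close>-component as well, and only
        \<open>u \<odot> v\<close> remains.\<close>
      have "u \<bullet> (Z *v u) = 0" using g2_skew[OF Zg(1), of u u] by (simp add: inner_commute)
      then have "a * (u \<bullet> u) = 0"
        unfolding abm by (simp add: inner_add_right o inner_omult_left z)
      moreover have "v \<bullet> (Z *v u) = 0" using g2_skew[OF Zg(1), of v v] Zuv by (simp add: inner_commute)
      then have "b * (v \<bullet> v) = 0"
        unfolding abm using o by (simp add: inner_add_right inner_commute inner_omult_right z)
      ultimately have "Z *v u = m *\<^sub>R (u \<odot> v)" using False abm by simp
      then show ?thesis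
        using context_families[OF Z _ z(1) Su(1) _ z(2) Su(2), of m] Zuv False by simp
    qed
  qed
qed

lemma proper_families:
  assumes Z: "Z \<in> kA" and ne: "LZ Z \<noteq> g2"
  shows "Z \<in> F_vec \<union> F_proj \<union> F_res \<union> F_rf"
proof -
  have Zg: "Z \<in> g2" using Z by (simp add: kA_def kH_def)
  have Y: "Ad S Z \<in> g2" using Zg by (simp add: Ad_g2 S_in_G2)
  consider "resonant Z (Ad S Z)" | "contains_torus (LZ Z)"
    using torus_or_resonant[OF LZ_subalgebra Z LZ_in Y] by blast
  then show ?thesis
  proof cases
    case 1
    then show ?thesis using resonant_families[OF Z] by blast
  next
    case 2
    from contains_torus_reducible[OF LZ_subalgebra LZ_subset_g2[OF Zg] ne 2] show ?thesis
    proof cases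
      case (1 g)
      have "Z *v (g *v oe 1) = 0" "Ad S Z *v (g *v oe 1) = 0"
        using 1 LZ_in by blast+
      moreover have "g *v oe 1 \<noteq> 0"
        using G2_inner[OF 1(1), of "oe 1" "oe 1"] by (auto simp: inner_8)
      moreover have "(g *v oe 1) $ 0 = 0" using G2_nth_0[OF 1(1)] by simp
      moreover have "Z *v (S *v (g *v oe 1)) = 0"
        using calculation(2) S_involution[of "Z *v (S *v (g *v oe 1))"] by (simp add: Ad_S_vec)
      ultimately have "Z \<in> F_vec" using F_vecI[OF Z] by blast
      then show ?thesis by blast
    next
      case (2 g)
      then show ?thesis using invariant_context[OF Z] LZ_in by blast
    qed
  qed
qed

theorem theorem7p18:
  shows "{Z \<in> kA. LZ Z \<noteq> g2} = F_vec \<union> F_proj \<union> F_res \<union> F_rf"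
proof -
  have "F_vec \<subseteq> kA" by (auto simp: F_vec_def)
  then show ?thesis
    using proper_families F_vec_proper F_proj_proper F_res_proper F_rf_proper by blast
qed

end
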